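(* Let $G$ be a finite group. Then $G$ is balanced if and only if $G$ is isomorphic to one of the following groups: (1) a finite abelian group; (2) $Q_8 \times (C_2)^n$ for some integer $n \ge 0$; (3) one of $D_6$, $D_8$, $D_{10}$, $Q_{12}$, $Q_{16}$, $C_4 \ltimes C_4$ (the non-abelian semidirect product), $Q_{20}$.
   Context: For a subset $A$ of a group $G$, write $AA^{-1} = \{ab^{-1} : a,b \in A\}$ and $A^{-1}A = \{a^{-1}b : a,b\in A\}$. A finite group $G$ is balanced if $|AA^{-1}| = |A^{-1}A|$ for every subset $A \subseteq G$. Notation: $C_n$ is the cyclic group of order $n$. $D_{2n} = \langle r,s \mid r^n = s^2 = 1,\ sr = r^{-1}s\rangle$ is the dihedral group of order $2n$ (so the subscript is the order). $Q_{4n} = \langle a,x \mid a^{2n} = 1,\ x^2 = a^n,\ xax^{-1} = a^{-1}\rangle$ is the dicyclic group of order $4n$; in particular $Q_8$ is the quaternion group. $C_4 \ltimes C_4$ is the non-trivial semidirect product, i.e. $\langle t,u \mid t^4 = u^4 = 1,\ tut^{-1} = u^{-1}\rangle$, of order $16$. *)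

theory Defs
  imports "HOL-Algebra.Elementary_Groups" "HOL-Algebra.Product_Groups"
begin

section \<open>Balanced groups\<close>

definition balanced :: "('a, 'b) monoid_scheme \<Rightarrow> bool" where
  "balanced G \<longleftrightarrow> group G \<and> finite (carrier G) \<and>
     (\<forall>A \<subseteq> carrier G.
        card {a \<otimes>\<^bsub>G\<^esub> inv\<^bsub>G\<^esub> b | a b. a \<in> A \<and> b \<in> A}
      = card {inv\<^bsub>G\<^esub> a \<otimes>\<^bsub>G\<^esub> b | a b. a \<in> A \<and> b \<in> A})"

section \<open>Groups given by generators and relations\<close>

text \<open>
  A word is a list of letters; the letter \<open>(x, True)\<close> stands for the generator \<open>x\<close> and
  \<open>(x, False)\<close> for its formal inverse. All elements of the type \<open>'g\<close> are generators.
\<close>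

type_synonym 'g word = "('g \<times> bool) list"

definition wgen :: "'g \<Rightarrow> 'g word" where
  "wgen x = [(x, True)]"

definition winv :: "'g word \<Rightarrow> 'g word" where
  "winv w = rev (map (\<lambda>(x, e). (x, \<not> e)) w)"

definition wpow :: "'g word \<Rightarrow> nat \<Rightarrow> 'g word" where
  "wpow w n = concat (replicate n w)"

text \<open>
  A relation \<open>u = v\<close> is a pair \<open>(u, v)\<close> of words. Two words are equal in the presented group iff
  they are related by the least congruence that contains the relations and cancels
  \<open>x x\<^sup>-\<^sup>1\<close> and \<open>x\<^sup>-\<^sup>1 x\<close>.
\<close>

inductive pres_eq :: "('g word \<times> 'g word) set \<Rightarrow> 'g word \<Rightarrow> 'g word \<Rightarrow> bool"
  for R :: "('g word \<times> 'g word) set" where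
  relation: "(u, v) \<in> R \<Longrightarrow> pres_eq R u v"
| cancel: "pres_eq R [(x, e), (x, \<not> e)] []"
| refl: "pres_eq R u u"
| sym: "pres_eq R u v \<Longrightarrow> pres_eq R v u"
| trans: "pres_eq R u v \<Longrightarrow> pres_eq R v w \<Longrightarrow> pres_eq R u w"
| append: "pres_eq R u v \<Longrightarrow> pres_eq R u' v' \<Longrightarrow> pres_eq R (u @ u') (v @ v')"

definition pres_rel :: "('g word \<times> 'g word) set \<Rightarrow> ('g word \<times> 'g word) set" where
  "pres_rel R = {(u, v). pres_eq R u v}"

definition presented_group :: "('g word \<times> 'g word) set \<Rightarrow> 'g word set monoid" where
  "presented_group R =
     \<lparr> carrier = UNIV // pres_rel R,
       mult = (\<lambda>U V. \<Union>u\<in>U. \<Union>v\<in>V. pres_rel R `` {u @ v}),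
       one = pres_rel R `` {[]} \<rparr>"

subsection \<open>The construction yields a group with the universal property of the presentation\<close>

lemma equiv_pres_rel: "equiv UNIV (pres_rel R)"
  by (auto simp: equiv_def refl_on_def sym_def trans_def pres_rel_def
      intro: pres_eq.refl pres_eq.sym pres_eq.trans)

lemma pres_class_eq_iff: "pres_rel R `` {u} = pres_rel R `` {v} \<longleftrightarrow> pres_eq R u v"
  using eq_equiv_class_iff[OF equiv_pres_rel, of u v R] by (simp add: pres_rel_def)

lemma presented_group_mult:
  "pres_rel R `` {u} \<otimes>\<^bsub>presented_group R\<^esub> pres_rel R `` {v} = pres_rel R `` {u @ v}"
proof -
  have "congruent2 (pres_rel R) (pres_rel R) (\<lambda>u v. pres_rel R `` {u @ v})"
    by (auto simp: congruent2_def pres_class_eq_iff) (auto simp: pres_rel_def intro: pres_eq.append)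
  then show ?thesis
    by (simp add: presented_group_def UN_equiv_class2[OF equiv_pres_rel equiv_pres_rel])
qed

lemma winv_left: "pres_eq R (winv w @ w) []"
proof (induction w)
  case Nil
  then show ?case by (simp add: winv_def pres_eq.refl)
next
  case (Cons a w)
  obtain x e where a: "a = (x, e)" by (cases a)
  have "pres_eq R ([(x, \<not> e), (x, e)] @ w) ([] @ w)"
    using pres_eq.append[OF pres_eq.cancel[of R x "\<not> e"] pres_eq.refl[of R w]] by simp
  then have "pres_eq R (winv w @ ([(x, \<not> e), (x, e)] @ w)) (winv w @ ([] @ w))"
    by (rule pres_eq.append[OF pres_eq.refl])
  then show ?case
    using Cons.IH by (auto simp: a winv_def intro: pres_eq.trans)
qed

lemma group_presented_group: "group (presented_group R)"
proof (rule groupI)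
  fix X assume "X \<in> carrier (presented_group R)"
  then obtain u where u: "X = pres_rel R `` {u}"
    by (auto simp: presented_group_def quotient_def)
  have one: "\<one>\<^bsub>presented_group R\<^esub> = pres_rel R `` {[]}"
    by (simp add: presented_group_def)
  show "\<one>\<^bsub>presented_group R\<^esub> \<otimes>\<^bsub>presented_group R\<^esub> X = X"
    by (simp add: u one presented_group_mult)
  show "\<exists>Y\<in>carrier (presented_group R). Y \<otimes>\<^bsub>presented_group R\<^esub> X = \<one>\<^bsub>presented_group R\<^esub>"
  proof
    show "pres_rel R `` {winv u} \<otimes>\<^bsub>presented_group R\<^esub> X = \<one>\<^bsub>presented_group R\<^esub>"
      by (simp add: u one presented_group_mult pres_class_eq_iff winv_left)
    show "pres_rel R `` {winv u} \<in> carrier (presented_group R)"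
      by (simp add: presented_group_def quotientI)
  qed
next
  fix X Y Z
  assume "X \<in> carrier (presented_group R)" "Y \<in> carrier (presented_group R)"
    "Z \<in> carrier (presented_group R)"
  then obtain u v w where "X = pres_rel R `` {u}" "Y = pres_rel R `` {v}" "Z = pres_rel R `` {w}"
    by (auto simp: presented_group_def quotient_def)
  then show "X \<otimes>\<^bsub>presented_group R\<^esub> Y \<otimes>\<^bsub>presented_group R\<^esub> Z
      = X \<otimes>\<^bsub>presented_group R\<^esub> (Y \<otimes>\<^bsub>presented_group R\<^esub> Z)"
    by (simp add: presented_group_mult)
next
  fix X Y
  assume "X \<in> carrier (presented_group R)" "Y \<in> carrier (presented_group R)"
  then obtain u v where "X = pres_rel R `` {u}" "Y = pres_rel R `` {v}"
    by (auto simp: presented_group_def quotient_def)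
  then have "X \<otimes>\<^bsub>presented_group R\<^esub> Y = pres_rel R `` {u @ v}"
    by (simp add: presented_group_mult)
  then show "X \<otimes>\<^bsub>presented_group R\<^esub> Y \<in> carrier (presented_group R)"
    by (simp add: presented_group_def quotientI)
qed (simp add: presented_group_def quotientI)

definition word_val :: "('a, 'b) monoid_scheme \<Rightarrow> ('g \<Rightarrow> 'a) \<Rightarrow> 'g word \<Rightarrow> 'a" where
  "word_val H f w =
     foldr (\<lambda>(x, e) y. (if e then f x else inv\<^bsub>H\<^esub> f x) \<otimes>\<^bsub>H\<^esub> y) w \<one>\<^bsub>H\<^esub>"

lemma presented_group_universal:
  assumes "group H" and f: "\<And>x. f x \<in> carrier H"
    and R: "\<And>u v. (u, v) \<in> R \<Longrightarrow> word_val H f u = word_val H f v"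
  shows "\<exists>h \<in> hom (presented_group R) H. \<forall>x. h (pres_rel R `` {wgen x}) = f x"
proof -
  interpret H: group H by fact
  have Nil: "word_val H f [] = \<one>\<^bsub>H\<^esub>"
    and Cons: "word_val H f ((x, e) # w) =
      (if e then f x else inv\<^bsub>H\<^esub> f x) \<otimes>\<^bsub>H\<^esub> word_val H f w" for x e w
    by (simp_all add: word_val_def)
  have closed: "word_val H f w \<in> carrier H" for w
    by (induction w) (auto simp: Nil Cons f)
  have append: "word_val H f (u @ v) = word_val H f u \<otimes>\<^bsub>H\<^esub> word_val H f v" for u v
    by (induction u) (auto simp: Nil Cons f closed H.m_assoc)
  have eq: "word_val H f u = word_val H f v" if "pres_eq R u v" for u v
    using that by induction (auto simp: R append Nil Cons f)
  define h where "h X = the_elem (word_val H f ` X)" for X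
  have h: "h (pres_rel R `` {u}) = word_val H f u" for u
  proof -
    have "word_val H f ` (pres_rel R `` {u}) = {word_val H f u}"
      using eq by (auto simp: pres_rel_def intro: pres_eq.refl)
    then show ?thesis by (simp add: h_def)
  qed
  have "h \<in> hom (presented_group R) H"
  proof (rule homI)
    fix X Y assume X: "X \<in> carrier (presented_group R)" and Y: "Y \<in> carrier (presented_group R)"
    obtain u v where "X = pres_rel R `` {u}" "Y = pres_rel R `` {v}"
      using X Y by (auto simp: presented_group_def quotient_def)
    then show "h X \<in> carrier H"
      and "h (X \<otimes>\<^bsub>presented_group R\<^esub> Y) = h X \<otimes>\<^bsub>H\<^esub> h Y"
      by (simp_all add: h closed append presented_group_mult)
  qed
  moreover have "h (pres_rel R `` {wgen x}) = f x" for x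
    by (simp add: h wgen_def Cons Nil f)
  ultimately show ?thesis by blast
qed

section \<open>The named groups\<close>

datatype gen2 = Gen1 | Gen2

text \<open>Dihedral group of order \<open>2n\<close>, i.e. \<open>D\<^bsub>2n\<^esub>\<close> with the order as subscript.\<close>

definition dihedral :: "nat \<Rightarrow> gen2 word set monoid" where
  "dihedral n =
     (let r = wgen Gen1; s = wgen Gen2
      in presented_group {(wpow r n, []), (wpow s 2, []), (s @ r, winv r @ s)})"

text \<open>Dicyclic group of order \<open>4n\<close>, i.e. \<open>Q\<^bsub>4n\<^esub>\<close> with the order as subscript.\<close>

definition dicyclic :: "nat \<Rightarrow> gen2 word set monoid" where
  "dicyclic n =
     (let a = wgen Gen1; x = wgen Gen2
      in presented_group
           {(wpow a (2 * n), []), (wpow x 2, wpow a n), (x @ a @ winv x, winv a)})"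

definition C4_sdprod_C4 :: "gen2 word set monoid" where
  "C4_sdprod_C4 =
     (let t = wgen Gen1; u = wgen Gen2
      in presented_group {(wpow t 4, []), (wpow u 4, []), (t @ u @ winv t, winv u)})"

end

theory Submission
  imports Defs "HOL-Algebra.Multiplicative_Group"
begin

text \<open>
  The nonabelian groups of the list share one shape: an abelian subgroup \<open>C\<close> of index two and an
  element \<open>x\<close> outside \<open>C\<close> that inverts \<open>C\<close>. Put \<open>z = x^2\<close> and \<open>Z = {\<one>, z}\<close>; since \<open>x\<close> both fixes
  and inverts \<open>z\<close>, we have \<open>z^2 = \<one>\<close>. A subset of such a group is \<open>A = B \<union> Dx\<close> with \<open>B, D \<subseteq> C\<close>,
  and moving \<open>x\<close> past the elements of \<open>C\<close> yields
  \<open>A A^-1 = E \<union> (Z B D) x\<close> and \<open>A^-1 A = E \<union> (Z B^-1 D) x\<close> with the same set \<open>E \<subseteq> C\<close>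
  (\<open>card_quotients_inverted_abelian\<close>). So balance is the statement that \<open>Z B D\<close> and \<open>Z B^-1 D\<close>
  always have the same size. If all squares of elements of \<open>C\<close> lie in \<open>Z\<close>, then \<open>Z B^-1 = Z B\<close>;
  this covers the products of \<open>Q\<^sub>8\<close> with elementary abelian 2-groups. The other groups have at most
  five cosets of \<open>Z\<close> in \<open>C\<close>. If \<open>B\<close> or \<open>D\<close> meets at most two of them, then inverting it is, up to
  \<open>Z\<close>, a translation; if both meet at least three, then \<open>3 + 3 > 5\<close> forces
  \<open>Z B D = C = Z B^-1 D\<close> (\<open>card_thick_mult_inv\<close>).

  Conversely, a balanced group is restricted by a few test subsets. The set \<open>{\<one>, a, b, ab}\<close> shows
  that an involution \<open>a\<close> conjugates every \<open>b\<close> with \<open>b^2 \<noteq> \<one>\<close> to \<open>b\<close> or \<open>b^-1\<close>. The set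
  \<open>D \<union> Dh\<close> shows that a cyclic subgroup \<open>D\<close> of odd order is normal. Finally, let \<open>K\<close> be a
  subgroup normalized by \<open>b \<notin> K\<close>, and let \<open>S\<close> be a small subset of \<open>K\<close>. The set
  \<open>S \<union> (Kb - Sb - Sb^-1)\<close> produces an element \<open>u\<close> of the coset \<open>Kb\<close> with
  \<open>uS \<subseteq> Sb \<union> Sb^-1\<close> (\<open>coset_test\<close>); for \<open>S = {\<one>, h}\<close> this leaves few possibilities for
  \<open>b h b^-1\<close>.

  The classification then splits into three cases.

  Suppose that some involution \<open>a\<close> is not central. It inverts an element \<open>b\<close> with \<open>b^2 \<noteq> \<one>\<close>, it
  inverts the whole centralizer \<open>C\<close> of \<open>b\<close>, and \<open>C\<close> has index two. Subsets \<open>S \<union> Sa\<close> with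
  \<open>S \<subseteq> C\<close> translate balance into equality of the sizes of \<open>S S\<close> and \<open>S S^-1\<close>, and
  \<open>S = {\<one>, b, c}\<close> shows that \<open>C\<close> is cyclic of order 3, 4 or 5: the group is dihedral.

  Suppose that all involutions are central, but some cyclic subgroup generated by \<open>x\<close> of order four
  is not normal. Quotients of balanced groups are balanced, and modulo \<open>x^2\<close> the element \<open>x\<close> becomes
  a noncentral involution. The first case describes the quotient, and lifting it gives \<open>Q\<^bsub>12\<^esub>\<close>,
  \<open>Q\<^bsub>16\<^esub>\<close>, \<open>Q\<^bsub>20\<^esub>\<close> or the nontrivial semidirect product of two cyclic groups of order four.

  Suppose that all involutions are central and all cyclic subgroups of order four are normal. Then
  elements of odd order are central. A noncommuting pair of elements of minimal orders consists of
  two elements of order four that generate a quaternion group \<open>Q\<^sub>8\<close>; larger orders are excluded by the coset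
  test. The centralizer of \<open>Q\<^sub>8\<close> has exponent two, and every element of the group acts on \<open>Q\<^sub>8\<close> by an
  inner automorphism. So the group is the product of \<open>Q\<^sub>8\<close> with central involutions.
\<close>

section \<open>Words and centralizers\<close>

context group begin

lemma inv_mult_cancel:
  assumes "x \<in> carrier G" "y \<in> carrier G"
  shows "inv x \<otimes> (x \<otimes> y) = y" "x \<otimes> (inv x \<otimes> y) = y"
  using assms by (simp_all flip: m_assoc)

lemmas word_simps = m_assoc inv_mult_group inv_mult_cancel

definition centralizer :: "'a set \<Rightarrow> 'a set" where
  "centralizer S = {g \<in> carrier G. \<forall>s\<in>S. g \<otimes> s = s \<otimes> g}"

lemma subgroup_centralizer:
  assumes "S \<subseteq> carrier G"
  shows "subgroup (centralizer S) G"
proof (rule subgroupI)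
  show "centralizer S \<noteq> {}" using assms by (force simp: centralizer_def)
next
  fix a assume a: "a \<in> centralizer S"
  have "inv a \<otimes> s = s \<otimes> inv a" if "s \<in> S" for s
  proof -
    have "s \<in> carrier G" "a \<in> carrier G" "a \<otimes> s = s \<otimes> a"
      using a that assms by (auto simp: centralizer_def)
    then show ?thesis by (metis inv_closed inv_solve_left inv_solve_right m_assoc m_closed)
  qed
  then show "inv a \<in> centralizer S" using a by (auto simp: centralizer_def)
next
  fix a b assume a: "a \<in> centralizer S" "b \<in> centralizer S"
  have "a \<otimes> b \<otimes> s = s \<otimes> (a \<otimes> b)" if "s \<in> S" for s
  proof -
    have "s \<in> carrier G" "a \<in> carrier G" "a \<otimes> s = s \<otimes> a" "b \<in> carrier G" "b \<otimes> s = s \<otimes> b"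
      using a that assms by (auto simp: centralizer_def)
    then show ?thesis by (metis m_assoc)
  qed
  then show "a \<otimes> b \<in> centralizer S" using a by (auto simp: centralizer_def)
qed (auto simp: centralizer_def)

lemma in_centralizer_iff: "g \<in> centralizer S \<longleftrightarrow> g \<in> carrier G \<and> (\<forall>s\<in>S. g \<otimes> s = s \<otimes> g)"
  by (simp add: centralizer_def)

lemma commutes_inv:
  assumes "a \<in> carrier G" "b \<in> carrier G" "a \<otimes> b = b \<otimes> a"
  shows "a \<otimes> inv b = inv b \<otimes> a"
  using assms by (metis inv_closed inv_solve_left inv_solve_right m_assoc m_closed)

lemma conj_in_centralizer:
  assumes S: "S \<subseteq> carrier G" and b: "b \<in> carrier G" and k: "k \<in> centralizer S"
    and comm: "\<And>s. s \<in> S \<Longrightarrow> k \<otimes> (inv b \<otimes> s \<otimes> b) = (inv b \<otimes> s \<otimes> b) \<otimes> k"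
  shows "b \<otimes> k \<otimes> inv b \<in> centralizer S"
proof -
  have kc: "k \<in> carrier G" using k by (simp add: centralizer_def)
  have "(b \<otimes> k \<otimes> inv b) \<otimes> s = s \<otimes> (b \<otimes> k \<otimes> inv b)" if s: "s \<in> S" for s
  proof -
    have sc: "s \<in> carrier G" using s S by blast
    have "(b \<otimes> k \<otimes> inv b) \<otimes> s = b \<otimes> (k \<otimes> (inv b \<otimes> s \<otimes> b)) \<otimes> inv b" using sc kc b by (simp add: word_simps)
    also have "\<dots> = s \<otimes> (b \<otimes> k \<otimes> inv b)" unfolding comm[OF s] using sc kc b by (simp add: word_simps)
    finally show ?thesis .
  qed
  then show ?thesis using kc b by (simp add: centralizer_def)
qed

end

section \<open>Test subsets\<close>

locale balanced_group = group G for G (structure) +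
  assumes bal: "balanced G"
begin

lemma finite_carrier [simp]: "finite (carrier G)"
  using bal by (simp add: balanced_def)

lemma card_quotients_eq:
  "A \<subseteq> carrier G \<Longrightarrow>
    card {a \<otimes> inv b | a b. a \<in> A \<and> b \<in> A} = card {inv a \<otimes> b | a b. a \<in> A \<and> b \<in> A}"
  using bal by (simp add: balanced_def)

text \<open>
  For \<open>A = {\<one>, a, b, ab}\<close> the set \<open>A^-1 A\<close> consists of \<open>\<one>, a, b, ab, b^-1, b^-1 a, b^-1 a b\<close>,
  while \<open>A A^-1\<close> contains \<open>\<one>, b, b^-1, a, ab, b^-1 a, a b^-1, ba\<close>. These eight elements are
  distinct unless \<open>a b a\<close> is \<open>b\<close> or \<open>b^-1\<close>.
\<close>

lemma involution_acts_by_sign: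
  assumes a: "a \<in> carrier G" "a \<otimes> a = \<one>" and b: "b \<in> carrier G" "b \<otimes> b \<noteq> \<one>"
  shows "a \<otimes> b \<otimes> a = b \<or> a \<otimes> b \<otimes> a = inv b"
proof (rule ccontr)
  assume neg: "\<not> ?thesis"
  have ia: "inv a = a" using a by (simp add: inv_equality)
  have aa: "a \<otimes> (a \<otimes> x) = x" if "x \<in> carrier G" for x
    using a that by (simp flip: m_assoc)
  let ?A = "{\<one>, a, b, a \<otimes> b}"
  let ?P = "{x \<otimes> inv y | x y. x \<in> ?A \<and> y \<in> ?A}"
  let ?Q = "{inv x \<otimes> y | x y. x \<in> ?A \<and> y \<in> ?A}"
  have A: "?A \<subseteq> carrier G" using a b by auto
  have "?Q \<subseteq> set [\<one>, a, b, a \<otimes> b, inv b, inv b \<otimes> a, inv b \<otimes> a \<otimes> b]"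
    using a b by (auto simp: word_simps ia aa)
  then have "card ?Q \<le> card (set [\<one>, a, b, a \<otimes> b, inv b, inv b \<otimes> a, inv b \<otimes> a \<otimes> b])"
    by (intro card_mono) auto
  also have "\<dots> \<le> 7" by (rule order_trans[OF card_length]) simp
  finally have Q: "card ?Q \<le> 7" .
  have nc: "a \<otimes> b \<noteq> b \<otimes> a"
    using neg a b by (metis m_assoc r_one)
  have ni: "a \<otimes> b \<noteq> inv b \<otimes> a"
    using neg a b by (metis inv_closed m_assoc r_one)
  have ni': "a \<otimes> inv b \<noteq> b \<otimes> a"
  proof
    assume "a \<otimes> inv b = b \<otimes> a"
    then have "inv (a \<otimes> inv b) = inv (b \<otimes> a)" by simp
    then have "b \<otimes> a = a \<otimes> inv b" "inv (b \<otimes> a) = inv (a \<otimes> inv b)" using a b by (simp_all add: inv_mult_group ia)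
    then have "a \<otimes> (b \<otimes> a) = inv b" using a b aa by simp
    then show False using neg a b by (simp add: m_assoc)
  qed
  have bC: "b \<in> centralizer {b}" using b by (simp add: centralizer_def)
  have na: "a \<notin> centralizer {b}" using nc by (auto simp: centralizer_def)
  interpret C: subgroup "centralizer {b}" G using b by (intro subgroup_centralizer) auto
  \<comment> \<open>\<open>\<one>, b, b^-1\<close> commute with \<open>b\<close>; the other five elements of the list do not\<close>
  have nC: "a \<otimes> x \<notin> centralizer {b}" "x \<otimes> a \<notin> centralizer {b}" if "x \<in> centralizer {b}" for x
  proof -
    have xc: "x \<in> carrier G" using that by simp
    show "a \<otimes> x \<notin> centralizer {b}"
      using C.m_closed[OF _ C.m_inv_closed[OF that], of "a \<otimes> x"] na a xc by (auto simp: m_assoc)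
    show "x \<otimes> a \<notin> centralizer {b}"
      using C.m_closed[OF C.m_inv_closed[OF that], of "x \<otimes> a"] na a xc by (auto simp: inv_mult_cancel)
  qed
  have bne: "b \<noteq> inv b" using b by (metis r_inv)
  let ?L = "[\<one>, b, inv b, a, a \<otimes> b, inv b \<otimes> a, a \<otimes> inv b, b \<otimes> a]"
  have "b \<noteq> \<one>" using b by auto
  then have "\<one> \<noteq> inv b" using b by (metis inv_eq_1_iff)
  with \<open>b \<noteq> \<one>\<close> have dist1: "distinct [\<one>, b, inv b]" using bne by simp
  have dist2: "distinct [a, a \<otimes> b, inv b \<otimes> a, a \<otimes> inv b, b \<otimes> a]"
  proof -
    have b1: "b \<noteq> \<one>" "inv b \<noteq> \<one>" using dist1 by auto
    have "inv b \<otimes> a \<noteq> a \<otimes> inv b"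
    proof
      assume "inv b \<otimes> a = a \<otimes> inv b"
      then have "inv (inv b \<otimes> a) = inv (a \<otimes> inv b)" by simp
      then show False using nc a b by (simp add: inv_mult_group ia)
    qed
    then show ?thesis using a b b1 nc ni ni' bne by (auto simp: word_simps)
  qed
  have disj: "set [\<one>, b, inv b] \<inter> set [a, a \<otimes> b, inv b \<otimes> a, a \<otimes> inv b, b \<otimes> a] = {}"
  proof -
    have "set [\<one>, b, inv b] \<subseteq> centralizer {b}" using bC by auto
    moreover have "set [a, a \<otimes> b, inv b \<otimes> a, a \<otimes> inv b, b \<otimes> a] \<inter> centralizer {b} = {}"
      using bC na nC by auto
    ultimately show ?thesis by blast
  qed
  have "distinct ([\<one>, b, inv b] @ [a, a \<otimes> b, inv b \<otimes> a, a \<otimes> inv b, b \<otimes> a])"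
    using dist1 dist2 disj by (simp only: distinct_append)
  then have L: "distinct ?L" by (simp only: append.simps)
  have "set ?L \<subseteq> ?P"
  proof -
    have mem: "x \<otimes> inv y \<in> ?P" if "x \<in> ?A" "y \<in> ?A" for x y using that by blast
    have "\<one> \<in> ?P" using mem[of \<one> \<one>] by simp
    moreover have "b \<in> ?P" using mem[of b \<one>] b by simp
    moreover have "inv b \<in> ?P" using mem[of \<one> b] b by simp
    moreover have "a \<in> ?P" using mem[of a \<one>] a by simp
    moreover have "a \<otimes> b \<in> ?P" using mem[of "a \<otimes> b" \<one>] a b by simp
    moreover have "inv b \<otimes> a \<in> ?P" using mem[of \<one> "a \<otimes> b"] a b by (simp add: inv_mult_group ia)
    moreover have "a \<otimes> inv b \<in> ?P" using mem[of a b] by simp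
    moreover have "b \<otimes> a \<in> ?P" using mem[of b a] by (simp add: ia)
    ultimately show ?thesis by simp
  qed
  moreover have "finite ?P"
  proof (rule finite_subset[OF _ finite_carrier])
    show "?P \<subseteq> carrier G" using A by blast
  qed
  ultimately have "card (set ?L) \<le> card ?P" by (intro card_mono)
  moreover have "card (set ?L) = 8" using distinct_card[OF L] by (simp only: list.size)
  ultimately show False using Q card_quotients_eq[OF A] by linarith
qed

text \<open>
  The test subset is \<open>A = S \<union> R\<close> with \<open>R = Kb - Sb - Sb^-1\<close>. The cardinality condition says that
  \<open>R\<close> is more than half of \<open>Kb\<close>, so both quotient sets contain \<open>K\<close>. The set \<open>A^-1 A\<close> misses \<open>b\<close>:
  if \<open>b = x^-1 y\<close> with \<open>x\<close> and \<open>y\<close> in \<open>A\<close>, then one of them lies in \<open>S\<close> and the other in \<open>R\<close>, and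
  \<open>y = xb\<close>, \<open>x = y b^-1\<close> put the latter in \<open>Sb\<close> or \<open>Sb^-1\<close>. If no \<open>u\<close> exists as claimed, then every
  \<open>u \<in> Kb\<close> is \<open>(us) s^-1\<close> with \<open>us \<in> R\<close>, so \<open>A A^-1\<close> is the full union of \<open>K\<close>, \<open>Kb\<close> and \<open>(Kb)^-1\<close>,
  and it is strictly larger than \<open>A^-1 A\<close>.
\<close>

lemma coset_test:
  assumes K: "subgroup K G" and b: "b \<in> carrier G" "b \<notin> K"
    and nrm: "\<And>k. k \<in> K \<Longrightarrow> b \<otimes> k \<otimes> inv b \<in> K" "\<And>k. k \<in> K \<Longrightarrow> inv b \<otimes> k \<otimes> b \<in> K"
    and S: "S \<subseteq> K"
    and card: "2 * card ((((\<lambda>s. s \<otimes> b) ` S) \<union> ((\<lambda>s. s \<otimes> inv b) ` S)) \<inter> (\<lambda>k. k \<otimes> b) ` K) < card K"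
  shows "\<exists>u \<in> (\<lambda>k. k \<otimes> b) ` K. \<forall>s\<in>S. u \<otimes> s \<in> (\<lambda>s. s \<otimes> b) ` S \<union> (\<lambda>s. s \<otimes> inv b) ` S"
proof (rule ccontr)
  assume neg: "\<not> ?thesis"
  interpret K: subgroup K G by fact
  define Kb where "Kb = (\<lambda>k. k \<otimes> b) ` K"
  define bK where "bK = (\<lambda>k. inv b \<otimes> k) ` K"
  define T where "T = (\<lambda>s. s \<otimes> b) ` S \<union> (\<lambda>s. s \<otimes> inv b) ` S"
  define R where "R = Kb - T"
  let ?A = "S \<union> R"
  let ?P = "{x \<otimes> inv y | x y. x \<in> ?A \<and> y \<in> ?A}"
  let ?Q = "{inv x \<otimes> y | x y. x \<in> ?A \<and> y \<in> ?A}"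
  have Kc: "K \<subseteq> carrier G" by (rule K.subset)
  have Kbc: "Kb \<subseteq> carrier G" using Kc b by (auto simp: Kb_def)
  have fK: "finite K" using Kc finite_carrier finite_subset by blast
  have fKb: "finite Kb" using fK by (simp add: Kb_def)
  have A: "?A \<subseteq> carrier G" using S Kc Kbc by (auto simp: R_def)
  have cKb: "card Kb = card K"
    unfolding Kb_def by (rule card_image) (use Kc b in \<open>auto simp: inj_on_def subset_iff\<close>)
  have "card R \<ge> card Kb - card (T \<inter> Kb)"
    using fKb by (metis R_def Diff_Int_distrib2 Int_absorb Int_commute card_Diff_subset_Int diff_le_mono2 finite_Int inf.idem order_refl)
  moreover have "2 * card (T \<inter> Kb) < card K" using card by (simp add: T_def Kb_def)
  ultimately have cR: "2 * card R > card K" using cKb by linarith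
  have RKb: "R \<subseteq> Kb" by (simp add: R_def)
  have Kmul: "x \<otimes> y \<in> Kb" if "x \<in> K" "y \<in> Kb" for x y
    using that b Kc by (auto simp: Kb_def m_assoc[symmetric] subset_iff)
  have Kmul': "y \<otimes> x \<in> Kb" if xK: "x \<in> K" and yK: "y \<in> Kb" for x y
  proof -
    obtain k where k: "k \<in> K" "y = k \<otimes> b" using yK unfolding Kb_def by blast
    have c: "k \<in> carrier G" "x \<in> carrier G" using k(1) xK by simp_all
    have "y \<otimes> x = (k \<otimes> (b \<otimes> x \<otimes> inv b)) \<otimes> b" using k(2) c b by (simp add: word_simps)
    then show ?thesis unfolding Kb_def using nrm(1)[OF xK] k by auto
  qed
  have inter: "\<exists>y. y \<in> X \<and> y \<in> Y" if "X \<subseteq> Kb" "Y \<subseteq> Kb" "card X + card Y > card K" for X Y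
  proof (rule ccontr)
    assume "\<not> ?thesis"
    then have "X \<inter> Y = {}" by auto
    then have "card (X \<union> Y) = card X + card Y"
      using that fKb finite_subset by (metis card_Un_disjoint)
    moreover have "card (X \<union> Y) \<le> card Kb" using that fKb by (intro card_mono) auto
    ultimately show False using that cKb by simp
  qed
  \<comment> \<open>\<open>R\<close> is more than half of \<open>Kb\<close>, so it meets its translates by \<open>k\<close>\<close>
  have KP: "k \<in> ?P" "k \<in> ?Q" if k: "k \<in> K" for k
  proof -
    have kc: "k \<in> carrier G" using k Kc by auto
    have "(\<otimes>) k ` R \<subseteq> Kb" using Kmul k RKb by auto
    moreover have "card ((\<otimes>) k ` R) = card R"
      by (rule card_image) (use kc RKb Kbc in \<open>auto simp: inj_on_def subset_iff\<close>)
    ultimately obtain x y where "x \<in> R" "y \<in> R" "k \<otimes> y = x"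
      using inter[of R "(\<otimes>) k ` R"] RKb cR by auto
    moreover have "x \<in> carrier G" "y \<in> carrier G" using RKb Kbc \<open>x \<in> R\<close> \<open>y \<in> R\<close> by auto
    ultimately have "k = x \<otimes> inv y" using kc by (auto simp: m_assoc)
    then show "k \<in> ?P" using \<open>x \<in> R\<close> \<open>y \<in> R\<close> by blast
    have "(\<lambda>y. y \<otimes> k) ` R \<subseteq> Kb" using Kmul' k RKb by auto
    moreover have "card ((\<lambda>y. y \<otimes> k) ` R) = card R"
      by (rule card_image) (use kc RKb Kbc in \<open>auto simp: inj_on_def subset_iff\<close>)
    ultimately obtain x y where "x \<in> R" "y \<in> R" "y \<otimes> k = x"
      using inter[of R "(\<lambda>y. y \<otimes> k) ` R"] RKb cR by auto
    moreover have "x \<in> carrier G" "y \<in> carrier G" using RKb Kbc \<open>x \<in> R\<close> \<open>y \<in> R\<close> by auto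
    ultimately have "k = inv y \<otimes> x" using kc by (auto simp: inv_mult_cancel)
    then show "k \<in> ?Q" using \<open>x \<in> R\<close> \<open>y \<in> R\<close> by blast
  qed
  have Pinv: "inv x \<in> ?P" if xP: "x \<in> ?P" for x
  proof -
    obtain p q where "p \<in> ?A" "q \<in> ?A" "x = p \<otimes> inv q" using xP by blast
    moreover have "p \<in> carrier G" "q \<in> carrier G" using A calculation by auto
    ultimately have "inv x = q \<otimes> inv p" by (simp add: inv_mult_group)
    then show ?thesis using \<open>p \<in> ?A\<close> \<open>q \<in> ?A\<close> by blast
  qed
  \<comment> \<open>this is where the negated claim enters\<close>
  have KbP: "u \<in> ?P" if u: "u \<in> Kb" for u
  proof -
    have uc: "u \<in> carrier G" using u Kbc by auto
    obtain s where s: "s \<in> S" "u \<otimes> s \<notin> T"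
      using neg u unfolding T_def Kb_def by blast
    have sc: "s \<in> carrier G" "s \<in> K" using s S Kc by auto
    have "u \<otimes> s \<in> R" using s Kmul'[OF sc(2) u] by (simp add: R_def)
    moreover have "u = (u \<otimes> s) \<otimes> inv s" using uc sc by (simp add: m_assoc)
    ultimately show ?thesis using s by blast
  qed
  have bQ: "b \<notin> ?Q"
  proof
    assume "b \<in> ?Q"
    then obtain x y where xy: "x \<in> ?A" "y \<in> ?A" "b = inv x \<otimes> y"
      unfolding mem_Collect_eq by (elim exE conjE) (rule that)
    have c: "x \<in> carrier G" "y \<in> carrier G" using A xy by auto
    have yeq: "y = x \<otimes> b" using xy c by (simp add: inv_mult_cancel)
    have xeq: "x = y \<otimes> inv b" using yeq c b by (simp add: m_assoc)
    show False
    proof (cases "x \<in> S")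
      case True
      then have "y \<in> T" using yeq by (auto simp: T_def)
      then have "y \<in> S" using xy by (auto simp: R_def)
      then have "b \<in> K" using xy True S by (auto intro: K.m_closed K.m_inv_closed)
      then show False using b by simp
    next
      case False
      then have xR: "x \<in> R" using xy by auto
      show False
      proof (cases "y \<in> S")
        case True
        then have "x \<in> T" using xeq by (auto simp: T_def)
        then show False using xR by (simp add: R_def)
      next
        case False
        then have "y \<in> R" using xy by auto
        then obtain k l where "k \<in> K" "l \<in> K" "x = k \<otimes> b" "y = l \<otimes> b"
          using xR RKb unfolding Kb_def by blast
        moreover then have "k \<in> carrier G" "l \<in> carrier G" using Kc by auto
        ultimately have "inv x \<otimes> y = inv b \<otimes> (inv k \<otimes> l) \<otimes> b" using b by (simp add: word_simps)
        also have "\<dots> \<in> K" by (intro nrm(2) K.m_closed K.m_inv_closed) fact+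
        finally show False using b xy(3) by metis
      qed
    qed
  qed
  have Psup: "K \<union> Kb \<union> (\<lambda>x. inv x) ` Kb \<subseteq> ?P"
    using KP KbP Pinv by blast
  have Qsub: "?Q \<subseteq> K \<union> Kb \<union> (\<lambda>x. inv x) ` Kb"
  proof
    fix q assume "q \<in> ?Q"
    then obtain x y where xy: "x \<in> ?A" "y \<in> ?A" "q = inv x \<otimes> y" by blast
    consider "x \<in> S" "y \<in> S" | "x \<in> S" "y \<in> R" | "x \<in> R" "y \<in> S" | "x \<in> R" "y \<in> R"
      using xy by blast
    then show "q \<in> K \<union> Kb \<union> (\<lambda>x. inv x) ` Kb"
    proof cases
      case 1 then show ?thesis using xy S by (auto intro: K.m_closed K.m_inv_closed)
    next
      case 2 then show ?thesis using xy S RKb Kmul[of "inv x" y] by auto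
    next
      case 3
      then have c: "x \<in> carrier G" "y \<in> carrier G" using A by auto
      have "inv y \<otimes> x \<in> Kb" using 3 S RKb Kmul[of "inv y" x] by auto
      moreover have "q = inv (inv y \<otimes> x)" using xy c by (simp add: inv_mult_group)
      ultimately show ?thesis by blast
    next
      case 4
      then obtain k l where "k \<in> K" "l \<in> K" "x = k \<otimes> b" "y = l \<otimes> b"
        using RKb unfolding Kb_def by blast
      moreover then have "k \<in> carrier G" "l \<in> carrier G" using Kc by auto
      ultimately have "q = inv b \<otimes> (inv k \<otimes> l) \<otimes> b" using xy b by (simp add: word_simps)
      then show ?thesis using nrm(2) \<open>k \<in> K\<close> \<open>l \<in> K\<close> by auto
    qed
  qed
  have "\<one> \<otimes> b \<in> Kb" unfolding Kb_def by (intro imageI K.one_closed)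
  then have "b \<in> Kb" using b by simp
  then have "b \<in> ?P" by (rule KbP)
  have "?Q \<subset> ?P"
  proof (rule psubsetI)
    show "?Q \<subseteq> ?P" using Qsub Psup by (rule order.trans)
    show "?Q \<noteq> ?P" using \<open>b \<in> ?P\<close> bQ by metis
  qed
  moreover have "finite ?P"
  proof (rule finite_subset[OF _ finite_carrier])
    show "?P \<subseteq> carrier G" using A by blast
  qed
  ultimately have "card ?Q < card ?P" by (rule psubset_card_mono[rotated])
  then show False using card_quotients_eq[OF A] by linarith
qed

end

context group begin

lemma conj_pow:
  fixes n :: nat
  assumes "h \<in> carrier G" "d \<in> carrier G"
  shows "(h \<otimes> d \<otimes> inv h) [^] n = h \<otimes> d [^] n \<otimes> inv h"
proof (induction n)
  case (Suc n)
  then show ?case using assms by (simp add: word_simps)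
qed (use assms in simp)

lemma square_pow:
  fixes n :: nat
  assumes "x \<in> carrier G"
  shows "(x \<otimes> x) [^] n = x [^] (2 * n)"
  by (induction n) (use assms in \<open>simp_all add: m_assoc\<close>)

lemma conj_mult:
  assumes "h \<in> carrier G" "x \<in> carrier G" "y \<in> carrier G"
  shows "h \<otimes> (x \<otimes> y) \<otimes> inv h = (h \<otimes> x \<otimes> inv h) \<otimes> (h \<otimes> y \<otimes> inv h)"
  using assms by (simp add: word_simps)

lemma conj_eq_iff:
  assumes "h \<in> carrier G" "x \<in> carrier G" "y \<in> carrier G"
  shows "h \<otimes> x \<otimes> inv h = y \<longleftrightarrow> h \<otimes> x = y \<otimes> h"
  using assms by (metis inv_solve_right m_closed)

end

context balanced_group begin

lemma finite_subset_carrier: "X \<subseteq> carrier G \<Longrightarrow> finite X"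
  using finite_carrier finite_subset by blast

text \<open>
  A finite set mapped into itself by conjugation with \<open>b\<close> is mapped onto itself.
\<close>

lemma conj_closed_inv:
  assumes K: "K \<subseteq> carrier G" and b: "b \<in> carrier G"
    and nrm: "\<And>k. k \<in> K \<Longrightarrow> b \<otimes> k \<otimes> inv b \<in> K" and k: "k \<in> K"
  shows "inv b \<otimes> k \<otimes> b \<in> K"
proof -
  have "inj_on (\<lambda>k. b \<otimes> k \<otimes> inv b) K"
    using K b by (auto simp: inj_on_def subset_iff)
  moreover have "(\<lambda>k. b \<otimes> k \<otimes> inv b) ` K \<subseteq> K" using nrm by auto
  ultimately have "(\<lambda>k. b \<otimes> k \<otimes> inv b) ` K = K"
    using finite_subset_carrier[OF K] by (metis endo_inj_surj)
  then obtain l where "l \<in> K" "k = b \<otimes> l \<otimes> inv b" using k by blast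
  moreover then have "l \<in> carrier G" using K by auto
  ultimately show ?thesis using b by (simp add: word_simps)
qed

text \<open>
  Because \<open>b^2 \<notin> K\<close>, the coset \<open>Kb\<close> contains no element of \<open>Sb^-1\<close>. For \<open>S = {\<one>, h}\<close> the element
  \<open>u\<close> of \<open>coset_test\<close> therefore satisfies \<open>u \<in> {b, hb}\<close> and \<open>uh \<in> {b, hb}\<close>. The four
  combinations read \<open>bh = b\<close>, \<open>bh = hb\<close>, \<open>hbh = b\<close> and \<open>hbh = hb\<close>.
\<close>

lemma coset_test_sign:
  assumes K: "subgroup K G" and b: "b \<in> carrier G" "b \<otimes> b \<notin> K"
    and nrm: "\<And>k. k \<in> K \<Longrightarrow> b \<otimes> k \<otimes> inv b \<in> K"
    and card: "4 < card K" and h: "h \<in> K"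
  shows "b \<otimes> h \<otimes> inv b = h \<or> b \<otimes> h \<otimes> inv b = inv h"
proof -
  interpret K: subgroup K G by fact
  have hc: "h \<in> carrier G" using h by simp
  have bK: "b \<notin> K" using b K.m_closed by blast
  let ?X = "(\<lambda>s. s \<otimes> b) ` {\<one>, h} \<union> (\<lambda>s. s \<otimes> inv b) ` {\<one>, h}"
  have no: "s \<otimes> inv b \<notin> (\<lambda>k. k \<otimes> b) ` K" if s: "s \<in> K" for s
  proof
    assume "s \<otimes> inv b \<in> (\<lambda>k. k \<otimes> b) ` K"
    then obtain k where k: "k \<in> K" "s \<otimes> inv b = k \<otimes> b" by blast
    have "s = k \<otimes> (b \<otimes> b)" using k s b(1) by (metis K.mem_carrier inv_solve_right m_assoc m_closed inv_closed inv_inv)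
    then have "b \<otimes> b = inv k \<otimes> s" using k s b(1) by (simp add: inv_mult_cancel)
    then show False using k s b by (metis K.m_closed K.m_inv_closed)
  qed
  have sub: "?X \<inter> (\<lambda>k. k \<otimes> b) ` K \<subseteq> set [b, h \<otimes> b]"
    using no[of \<one>] no[OF h] b(1) by auto
  then have "card (?X \<inter> (\<lambda>k. k \<otimes> b) ` K) \<le> 2"
    using card_length[of "[b, h \<otimes> b]"] card_mono[OF _ sub] by simp
  then have "\<exists>u \<in> (\<lambda>k. k \<otimes> b) ` K. \<forall>s\<in>{\<one>, h}. u \<otimes> s \<in> ?X"
    using coset_test[OF K b(1) bK nrm conj_closed_inv[OF K.subset b(1) nrm], of "{\<one>, h}"] card h by force
  then obtain u where u1: "u \<in> (\<lambda>k. k \<otimes> b) ` K" and us: "\<forall>s\<in>{\<one>, h}. u \<otimes> s \<in> ?X"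
    by (rule bexE)
  have u: "u \<in> (\<lambda>k. k \<otimes> b) ` K" "u \<otimes> \<one> \<in> ?X" "u \<otimes> h \<in> ?X"
    using u1 us[rule_format, OF insertI1] us[rule_format, OF insertI2[OF singletonI]] by blast+
  obtain k where k: "k \<in> K" "u = k \<otimes> b" using u1 by (rule imageE)
  have kc: "k \<in> carrier G" using k by simp
  have "u \<otimes> h = (k \<otimes> (b \<otimes> h \<otimes> inv b)) \<otimes> b" using k kc hc b by (simp add: word_simps)
  then have "u \<otimes> h \<in> (\<lambda>k. k \<otimes> b) ` K" using nrm[OF h] k by auto
  then have uh: "u \<otimes> h = b \<or> u \<otimes> h = h \<otimes> b" using u(3) sub by auto
  have uc: "u \<in> carrier G" using k kc b by simp
  have "u \<in> ?X" using u(2) unfolding r_one[OF uc] .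
  then have "u \<in> set [b, h \<otimes> b]" using u1 by (intro subsetD[OF sub] IntI)
  then have u': "u = b \<or> u = h \<otimes> b" by simp
  consider "b \<otimes> h = b" | "b \<otimes> h = h \<otimes> b" | "h \<otimes> b \<otimes> h = b" | "h \<otimes> b \<otimes> h = h \<otimes> b"
    using u' uh by blast
  then show ?thesis
  proof cases
    case 1 then show ?thesis using b hc by simp
  next
    case 2 then show ?thesis using b hc by (simp add: m_assoc)
  next
    case 3
    then have "b \<otimes> h = inv h \<otimes> b" using b hc by (metis inv_solve_left m_assoc m_closed)
    then show ?thesis using b hc by (simp add: m_assoc)
  next
    case 4 then show ?thesis using b hc by (simp add: m_assoc)
  qed
qed

text \<open>
  For \<open>S = {\<one>, h}\<close> the element \<open>u\<close> of \<open>coset_test\<close> satisfies \<open>u = pe\<close> and \<open>uh = p'e'\<close> with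
  \<open>p, p' \<in> {\<one>, h}\<close> and \<open>e, e' \<in> {b, b^-1}\<close>. As \<open>b^2\<close> commutes with \<open>h\<close>, the elements \<open>b\<close> and
  \<open>b^-1\<close> conjugate \<open>h\<close> to the same element \<open>c\<close>. Hence \<open>p c e = p' e'\<close>, that is
  \<open>c = (p^-1 p') (e' e^-1)\<close>.
\<close>

lemma coset_test_square:
  assumes K: "subgroup K G" and b: "b \<in> carrier G" "b \<notin> K"
    and nrm: "\<And>k. k \<in> K \<Longrightarrow> b \<otimes> k \<otimes> inv b \<in> K"
    and card: "8 < card K" and h: "h \<in> K"
    and comm: "b \<otimes> b \<otimes> h = h \<otimes> (b \<otimes> b)"
  shows "\<exists>p\<in>{\<one>, h, inv h}. \<exists>q\<in>{\<one>, b \<otimes> b, inv (b \<otimes> b)}. b \<otimes> h \<otimes> inv b = p \<otimes> q"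
proof -
  interpret K: subgroup K G by fact
  have hc: "h \<in> carrier G" using h by simp
  let ?X = "(\<lambda>s. s \<otimes> b) ` {\<one>, h} \<union> (\<lambda>s. s \<otimes> inv b) ` {\<one>, h}"
  let ?L = "[b, h \<otimes> b, inv b, h \<otimes> inv b]"
  have sub: "?X \<inter> (\<lambda>k. k \<otimes> b) ` K \<subseteq> set ?L"
    using b hc by auto
  have "card (?X \<inter> (\<lambda>k. k \<otimes> b) ` K) \<le> card (set ?L)"
    by (rule card_mono[OF _ sub]) simp
  also have "\<dots> \<le> 4" by (rule order_trans[OF card_length]) simp
  finally have "card (?X \<inter> (\<lambda>k. k \<otimes> b) ` K) \<le> 4" .
  then have "\<exists>u \<in> (\<lambda>k. k \<otimes> b) ` K. \<forall>s\<in>{\<one>, h}. u \<otimes> s \<in> ?X"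
    using coset_test[OF K b nrm conj_closed_inv[OF K.subset b(1) nrm], of "{\<one>, h}"] card h by force
  then obtain u where u1: "u \<in> (\<lambda>k. k \<otimes> b) ` K" and us: "\<forall>s\<in>{\<one>, h}. u \<otimes> s \<in> ?X"
    by (rule bexE)
  have u: "u \<in> (\<lambda>k. k \<otimes> b) ` K" "u \<otimes> \<one> \<in> ?X" "u \<otimes> h \<in> ?X"
    using u1 us[rule_format, OF insertI1] us[rule_format, OF insertI2[OF singletonI]] by blast+
  have uc: "u \<in> carrier G" using u(1) b by auto
  define c where "c = b \<otimes> h \<otimes> inv b"
  have cc: "c \<in> carrier G" using b hc by (simp add: c_def)
  have c1: "b \<otimes> h = c \<otimes> b" using b hc by (simp add: c_def m_assoc)
  have c2: "inv b \<otimes> h = c \<otimes> inv b"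
  proof -
    have "c \<otimes> inv b = inv b \<otimes> (b \<otimes> b \<otimes> h) \<otimes> inv (b \<otimes> b)" using b hc by (simp add: c_def word_simps)
    also have "\<dots> = inv b \<otimes> h" unfolding comm using b hc by (simp add: word_simps)
    finally show ?thesis by simp
  qed
  have "u \<in> ?X" using u(2) unfolding r_one[OF uc] .
  then obtain p e where pe: "p \<in> {\<one>, h}" "e \<in> {b, inv b}" "u = p \<otimes> e" by blast
  obtain p' e' where pe': "p' \<in> {\<one>, h}" "e' \<in> {b, inv b}" "u \<otimes> h = p' \<otimes> e'" using u(3) by blast
  have car: "p \<in> carrier G" "p' \<in> carrier G" "e \<in> carrier G" "e' \<in> carrier G" using pe pe' hc b by auto
  have "e \<otimes> h = c \<otimes> e" using c1 c2 pe(2) by auto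
  then have "p \<otimes> c \<otimes> e = p' \<otimes> e'" using pe pe' car hc cc by (simp add: m_assoc)
  then have "c = (inv p \<otimes> p') \<otimes> (e' \<otimes> inv e)"
    using car cc by (metis inv_solve_left inv_solve_right inv_closed m_assoc m_closed)
  moreover have "inv p \<otimes> p' \<in> {\<one>, h, inv h}" using pe(1) pe'(1) hc by auto
  moreover have "e' \<otimes> inv e \<in> {\<one>, b \<otimes> b, inv (b \<otimes> b)}" using pe(2) pe'(2) b by (auto simp: inv_mult_group)
  ultimately show ?thesis unfolding c_def by blast
qed

text \<open>
  Let \<open>B\<close> be generated by \<open>d\<close> and take \<open>A = B \<union> Bh\<close>. If \<open>h d h^-1 \<notin> B\<close>, then also
  \<open>h d^2 h^-1 \<notin> B\<close>, because \<open>d\<close> is a power of \<open>d^2\<close>. So \<open>A A^-1\<close> contains the four disjoint cosets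
  \<open>B\<close>, \<open>Bh\<close>, \<open>Bhd\<close> and \<open>Bhd^2\<close>. But \<open>A^-1 A\<close> is covered by \<open>B\<close>, \<open>h^-1 B h\<close>, \<open>Bh\<close> and \<open>h^-1 B\<close>, and
  the first two of these meet.
\<close>

lemma odd_order_normal:
  assumes d: "d \<in> carrier G" "odd (ord d)" and h: "h \<in> carrier G"
  shows "h \<otimes> d \<otimes> inv h \<in> generate G {d}"
proof (rule ccontr)
  assume neg: "\<not> ?thesis"
  define B where "B = generate G {d}"
  interpret B: subgroup B G unfolding B_def using d by (intro generate_is_subgroup) auto
  have dB: "d \<in> B" unfolding B_def by (simp add: generate.incl)
  have Bc: "B \<subseteq> carrier G" by (rule B.subset)
  have fB: "finite B" using Bc finite_subset_carrier by blast
  have n1: "h \<otimes> d \<otimes> inv h \<notin> B" using neg by (simp add: B_def)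
  have hB: "h \<notin> B" using n1 dB B.m_closed B.m_inv_closed by blast
  have n2: "h \<otimes> (d \<otimes> d) \<otimes> inv h \<notin> B"
  proof
    assume *: "h \<otimes> (d \<otimes> d) \<otimes> inv h \<in> B"
    obtain k where k: "ord d + 1 = 2 * k" using d(2) by (metis evenE odd_even_add odd_one)
    have "(d \<otimes> d) [^] k = d [^] (ord d + 1)"
      unfolding k using d by (simp add: square_pow)
    also have "\<dots> = d" using d by simp
    finally have "h \<otimes> d \<otimes> inv h = (h \<otimes> (d \<otimes> d) \<otimes> inv h) [^] k" using conj_pow[of h "d \<otimes> d" k] h d by simp
    moreover have "(h \<otimes> (d \<otimes> d) \<otimes> inv h) [^] k \<in> B" for k :: nat
      by (induction k) (use * in \<open>auto intro: B.m_closed\<close>)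
    ultimately show False using n1 by metis
  qed
  let ?A = "B \<union> (\<lambda>x. x \<otimes> h) ` B"
  define P where "P = {x \<otimes> inv y | x y. x \<in> ?A \<and> y \<in> ?A}"
  define Q where "Q = {inv x \<otimes> y | x y. x \<in> ?A \<and> y \<in> ?A}"
  have A: "?A \<subseteq> carrier G" using Bc h by auto
  define C where "C t = (\<lambda>x. x \<otimes> t) ` B" for t
  have cC: "card (C t) = card B" if "t \<in> carrier G" for t
    unfolding C_def by (rule card_image) (use Bc that in \<open>auto simp: inj_on_def subset_iff\<close>)
  \<comment> \<open>\<open>C t\<close> is the coset \<open>B t\<close>, and the four values of \<open>t\<close> below represent distinct cosets\<close>
  have disj: "C s \<inter> C t = {}" if st: "s \<in> carrier G" "t \<in> carrier G" "t \<otimes> inv s \<notin> B" for s t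
  proof (rule ccontr)
    assume "C s \<inter> C t \<noteq> {}"
    then obtain x y where xy: "x \<in> B" "y \<in> B" "x \<otimes> s = y \<otimes> t" unfolding C_def by blast
    then have "t \<otimes> inv s = inv y \<otimes> x"
      using st by (metis B.mem_carrier inv_closed inv_solve_left inv_solve_right m_assoc m_closed)
    then show False using st(3) xy by (metis B.m_closed B.m_inv_closed)
  qed
  let ?L = "[\<one>, h, h \<otimes> d, h \<otimes> (d \<otimes> d)]"
  have t2: "h \<otimes> d \<notin> B" "h \<otimes> (d \<otimes> d) \<notin> B"
    using hB dB h d B.m_closed B.m_inv_closed by (metis inv_solve_right m_assoc m_closed)+
  have dis: "C \<one> \<inter> C h = {}" "C \<one> \<inter> C (h \<otimes> d) = {}" "C \<one> \<inter> C (h \<otimes> (d \<otimes> d)) = {}"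
    "C h \<inter> C (h \<otimes> d) = {}" "C h \<inter> C (h \<otimes> (d \<otimes> d)) = {}" "C (h \<otimes> d) \<inter> C (h \<otimes> (d \<otimes> d)) = {}"
    using hB t2 n1 n2 h d by (intro disj; simp add: word_simps)+
  have fC: "finite (C t)" for t using fB by (simp add: C_def)
  have "card (C \<one> \<union> C h \<union> C (h \<otimes> d) \<union> C (h \<otimes> (d \<otimes> d))) = 4 * card B"
    using h d dis by (simp add: card_Un_disjoint fC Int_Un_distrib2 cC)
  moreover have "C \<one> \<union> C h \<union> C (h \<otimes> d) \<union> C (h \<otimes> (d \<otimes> d)) \<subseteq> P"
  proof -
    have "x \<otimes> t \<in> P" if x: "x \<in> B" and t: "t = \<one> \<or> t = h \<or> t = h \<otimes> d \<or> t = h \<otimes> (d \<otimes> d)" for x t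
    proof -
      have xc: "x \<in> carrier G" using x by simp
      have mem: "y \<otimes> inv z \<in> P" if "y \<in> ?A" "z \<in> ?A" for y z using that unfolding P_def by blast
      have xA: "x \<in> ?A" "x \<otimes> h \<in> ?A" using x by auto
      have "\<one> \<in> ?A" "inv d \<in> ?A" "inv (d \<otimes> d) \<in> ?A" using dB by (auto intro: B.m_closed B.m_inv_closed)
      then have "x \<otimes> inv \<one> \<in> P" "x \<otimes> h \<otimes> inv \<one> \<in> P" "x \<otimes> h \<otimes> inv (inv d) \<in> P" "x \<otimes> h \<otimes> inv (inv (d \<otimes> d)) \<in> P"
        using xA by (simp_all only: mem)
      moreover have "x \<otimes> inv \<one> = x \<otimes> \<one>" "x \<otimes> h \<otimes> inv \<one> = x \<otimes> h"
        "x \<otimes> h \<otimes> inv (inv d) = x \<otimes> (h \<otimes> d)" "x \<otimes> h \<otimes> inv (inv (d \<otimes> d)) = x \<otimes> (h \<otimes> (d \<otimes> d))"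
        using xc h d by (simp_all add: m_assoc)
      ultimately show ?thesis using t by (elim disjE) simp_all
    qed
    then show ?thesis unfolding C_def by blast
  qed
  moreover have "finite P"
  proof (rule finite_subset_carrier)
    show "P \<subseteq> carrier G" using A unfolding P_def by blast
  qed
  ultimately have P: "4 * card B \<le> card P" by (metis (no_types) card_mono)
  define E where "E = (\<lambda>x. inv h \<otimes> x \<otimes> h) ` B"
  define F where "F = (\<lambda>x. inv h \<otimes> x) ` B"
  have "Q \<subseteq> (B \<union> (E - {\<one>})) \<union> (C h \<union> F)"
  proof
    fix q assume "q \<in> Q"
    then obtain x y where xy: "x \<in> ?A" "y \<in> ?A" "q = inv x \<otimes> y" unfolding Q_def by blast
    obtain s where s: "s \<in> B" "x = s \<or> x = s \<otimes> h" using xy(1) by blast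
    obtain t where t: "t \<in> B" "y = t \<or> y = t \<otimes> h" using xy(2) by blast
    have w: "inv s \<otimes> t \<in> B" "s \<in> carrier G" "t \<in> carrier G" using s t by auto
    have "q = inv s \<otimes> t \<or> q = (inv s \<otimes> t) \<otimes> h \<or> q = inv h \<otimes> (inv s \<otimes> t) \<or> q = inv h \<otimes> (inv s \<otimes> t) \<otimes> h"
      using s t xy w h by (auto simp: word_simps)
    then have "q \<in> B \<or> q \<in> C h \<or> q \<in> F \<or> q \<in> E" using w unfolding C_def E_def F_def by blast
    then show "q \<in> (B \<union> (E - {\<one>})) \<union> (C h \<union> F)" using B.one_closed by blast
  qed
  moreover have fin: "finite E" "finite F" using fB by (auto simp: E_def F_def)
  ultimately have "card Q \<le> card ((B \<union> (E - {\<one>})) \<union> (C h \<union> F))"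
    using fB fC by (intro card_mono) auto
  also have "\<dots> \<le> (card B + card (E - {\<one>})) + (card (C h) + card F)"
    using card_Un_le[of "B \<union> (E - {\<one>})" "C h \<union> F"] card_Un_le[of B "E - {\<one>}"] card_Un_le[of "C h" F] by linarith
  \<comment> \<open>\<open>\<one>\<close> lies in \<open>B\<close> and in \<open>h^-1 B h\<close>; this common element makes the inequality strict\<close>
  also have "card (E - {\<one>}) < card E"
  proof (rule card_Diff1_less)
    have "inv h \<otimes> \<one> \<otimes> h \<in> E" unfolding E_def by (intro imageI B.one_closed)
    then show "\<one> \<in> E" using h by simp
  qed (fact fin)
  also have "card E \<le> card B" unfolding E_def using fB by (rule card_image_le)
  also have "card (C h) = card B" using h by (rule cC)
  also have "card F \<le> card B" unfolding F_def using fB by (rule card_image_le)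
  finally have "card Q < 4 * card B" by simp
  then show False using P card_quotients_eq[OF A] unfolding P_def Q_def by linarith
qed

end

section \<open>Products and quotients in abelian groups\<close>

context group begin

lemma assoc_rewrite:
  assumes "x \<otimes> y = z" "x \<in> carrier G" "y \<in> carrier G" "w \<in> carrier G"
  shows "x \<otimes> (y \<otimes> w) = z \<otimes> w"
  using assms by (simp flip: m_assoc)

end

context comm_group begin

text \<open>
  For \<open>S = {\<one>, b, c}\<close> there are at most six products but up to seven quotients. This gap is what
  makes small groups the only solutions.
\<close>

lemma product_and_quotient_set_cards:
  assumes eq: "\<And>S. S \<subseteq> carrier G \<Longrightarrow> card {x \<otimes> y | x y. x \<in> S \<and> y \<in> S} = card {x \<otimes> inv y | x y. x \<in> S \<and> y \<in> S}"
    and b: "b \<in> carrier G" and c: "c \<in> carrier G"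
  shows "card (set [\<one>, b, c, b \<otimes> b, c \<otimes> c, b \<otimes> c]) = card (set [\<one>, b, inv b, c, inv c, b \<otimes> inv c, c \<otimes> inv b])"
proof -
  have 1: "{x \<otimes> y | x y. x \<in> {\<one>, b, c} \<and> y \<in> {\<one>, b, c}} = set [\<one>, b, c, b \<otimes> b, c \<otimes> c, b \<otimes> c]" (is "?l = ?r")
  proof
    show "?l \<subseteq> ?r" using b c by (auto simp: m_comm[of c b])
    have mem: "x \<otimes> y \<in> ?l" if "x \<in> {\<one>, b, c}" "y \<in> {\<one>, b, c}" for x y using that by blast
    show "?r \<subseteq> ?l"
      using mem[of \<one> \<one>] mem[of b \<one>] mem[of c \<one>] mem[of b b] mem[of c c] mem[of b c] b c
      by (simp only: list.set insert_subset empty_subsetI r_one one_closed simp_thms insert_iff)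
  qed
  have 2: "{x \<otimes> inv y | x y. x \<in> {\<one>, b, c} \<and> y \<in> {\<one>, b, c}} = set [\<one>, b, inv b, c, inv c, b \<otimes> inv c, c \<otimes> inv b]" (is "?l = ?r")
  proof
    show "?l \<subseteq> ?r" using b c by auto
    have mem: "x \<otimes> inv y \<in> ?l" if "x \<in> {\<one>, b, c}" "y \<in> {\<one>, b, c}" for x y using that by blast
    show "?r \<subseteq> ?l"
      using mem[of \<one> \<one>] mem[of b \<one>] mem[of c \<one>] mem[of \<one> b] mem[of \<one> c] mem[of b c] mem[of c b] b c
      by (simp only: list.set insert_subset empty_subsetI r_one l_one inv_one one_closed inv_closed simp_thms insert_iff)
  qed
  have "{\<one>, b, c} \<subseteq> carrier G" using b c by simp
  from eq[OF this] show ?thesis unfolding 1 2 .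
qed

text \<open>
  An involution \<open>c \<noteq> b^2\<close> would give five products but six quotients from \<open>{\<one>, b, c}\<close>. An element
  \<open>c\<close> outside \<open>{\<one>, b, b^-1, b^2}\<close> with \<open>c^2 \<noteq> b\<close> would give at most six products but seven
  quotients. So every remaining \<open>c\<close> is a square root of \<open>b\<close>. Then \<open>c^-1\<close> is not, hence it is in the
  list, which forces \<open>c = b^-2\<close> and \<open>b^5 = \<one>\<close>. The second claim is the first one for \<open>c = b^3\<close>.
\<close>

lemma small_of_product_quotient_cards:
  assumes eq: "\<And>S. S \<subseteq> carrier G \<Longrightarrow> card {x \<otimes> y | x y. x \<in> S \<and> y \<in> S} = card {x \<otimes> inv y | x y. x \<in> S \<and> y \<in> S}"
    and b: "b \<in> carrier G" "b \<otimes> b \<noteq> \<one>"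
  shows "carrier G \<subseteq> {\<one>, b, b \<otimes> b, inv b, inv (b \<otimes> b)}"
    and "b \<otimes> b \<otimes> b = \<one> \<or> b \<otimes> b \<otimes> b \<otimes> b = \<one> \<or> b \<otimes> b \<otimes> b \<otimes> b \<otimes> b = \<one>"
proof -
  have b1: "b \<noteq> \<one>" using b by auto
  have bi: "b \<noteq> inv b" using b by (metis r_inv)
  have ib1: "\<one> \<noteq> inv b" using b1 b by (metis inv_eq_1_iff)
  \<comment> \<open>five products against six quotients\<close>
  have invol: "c = b \<otimes> b" if c: "c \<in> carrier G" "c \<otimes> c = \<one>" "c \<noteq> \<one>" for c
  proof (rule ccontr)
    assume ne: "c \<noteq> b \<otimes> b"
    have ic: "inv c = c" using c by (simp add: inv_equality)
    have cb: "c \<noteq> b" "c \<noteq> inv b" using c b by (auto simp: ic) (metis b(1) ic inv_inv c(2) b(2))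
    have "set [\<one>, b, c, b \<otimes> b, c \<otimes> c, b \<otimes> c] = set [\<one>, b, c, b \<otimes> b, b \<otimes> c]" using c by auto
    then have "card (set [\<one>, b, c, b \<otimes> b, c \<otimes> c, b \<otimes> c]) \<le> 5" using card_length[of "[\<one>, b, c, b \<otimes> b, b \<otimes> c]"] by simp
    moreover have "distinct [\<one>, b, inv b, c, b \<otimes> inv c, c \<otimes> inv b]"
    proof -
      have 1: "b \<otimes> inv c \<noteq> \<one>" "c \<otimes> inv b \<noteq> \<one>" using cb b c by (metis inv_equality inv_inv inv_closed)+
      have 2: "b \<otimes> inv c \<noteq> b" "c \<otimes> inv b \<noteq> c" "b \<otimes> inv c \<noteq> c" "c \<otimes> inv b \<noteq> inv b" using b c b1 by (simp_all add: ic)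
      have 3: "b \<otimes> inv c \<noteq> inv b"
      proof
        assume "b \<otimes> inv c = inv b"
        then have "b \<otimes> c \<otimes> b = \<one>" using ic b c by simp
        then have "c \<otimes> (b \<otimes> b) = \<one>" using b c by (simp add: m_ac)
        then show False using ne ic b c by (metis inv_equality inv_inv m_closed inv_comm)
      qed
      have 4: "c \<otimes> inv b \<noteq> b" using ne b c by (metis inv_solve_right)
      have 5: "b \<otimes> inv c \<noteq> c \<otimes> inv b"
      proof
        assume "b \<otimes> inv c = c \<otimes> inv b"
        then have "c \<otimes> b = c \<otimes> inv b" using b c ic m_comm[of b c] by metis
        then show False using b c bi by simp
      qed
      show ?thesis using 1 2 3 4 5 b1 ib1 bi cb c(3) by auto
    qed
    then have "card (set [\<one>, b, inv b, c, b \<otimes> inv c, c \<otimes> inv b]) = 6" using distinct_card by fastforce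
    moreover have "set [\<one>, b, inv b, c, inv c, b \<otimes> inv c, c \<otimes> inv b] = set [\<one>, b, inv b, c, b \<otimes> inv c, c \<otimes> inv b]"
      using ic by auto
    ultimately show False using product_and_quotient_set_cards[OF eq b(1) c(1)] by simp
  qed
  \<comment> \<open>at most six products against seven quotients\<close>
  have sq: "c \<in> {\<one>, b, inv b, b \<otimes> b} \<or> c \<otimes> c = b" if c: "c \<in> carrier G" for c
  proof (rule ccontr)
    assume ne: "\<not> ?thesis"
    have c2: "c \<otimes> c \<noteq> \<one>" using invol[OF c] ne by blast
    have c3: "c \<otimes> c \<noteq> b \<otimes> b"
    proof
      assume eq: "c \<otimes> c = b \<otimes> b"
      have "(c \<otimes> inv b) \<otimes> (c \<otimes> inv b) = (c \<otimes> c) \<otimes> inv (b \<otimes> b)" using b c by (simp add: inv_mult m_ac)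
      also have "\<dots> = \<one>" using eq b by simp
      finally consider "c \<otimes> inv b = \<one>" | "c \<otimes> inv b = b \<otimes> b" using invol[of "c \<otimes> inv b"] b c by blast
      then show False
      proof cases
        case 1 then show False using ne b c by (metis inv_equality inv_inv inv_closed insertCI)
      next
        case 2
        then have cc: "c = b \<otimes> b \<otimes> b" using b c by (metis inv_solve_right m_closed)
        have "(b \<otimes> b) \<otimes> (b \<otimes> b) = (c \<otimes> inv b) \<otimes> (c \<otimes> inv b)" using 2 by simp
        also have "\<dots> = \<one>" using \<open>(c \<otimes> inv b) \<otimes> (c \<otimes> inv b) = (c \<otimes> c) \<otimes> inv (b \<otimes> b)\<close> \<open>(c \<otimes> c) \<otimes> inv (b \<otimes> b) = \<one>\<close> by simp
        finally have "c \<otimes> b = \<one>" using cc b by (simp add: m_assoc)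
        then show False using ne b c by (metis inv_equality insertCI)
      qed
    qed
    have "card (set [\<one>, b, c, b \<otimes> b, c \<otimes> c, b \<otimes> c]) \<le> 6" using card_length[of "[\<one>, b, c, b \<otimes> b, c \<otimes> c, b \<otimes> c]"] by simp
    moreover have "distinct [\<one>, b, inv b, c, inv c, b \<otimes> inv c, c \<otimes> inv b]"
    proof -
      have ci: "c \<noteq> inv c" using c2 c by (metis r_inv)
      have 0: "inv c \<noteq> \<one>" "inv c \<noteq> b" "inv c \<noteq> inv b" using ne b c by auto
      have 1: "b \<otimes> inv c \<noteq> \<one>" "c \<otimes> inv b \<noteq> \<one>" using ne b c by (metis inv_equality inv_inv inv_closed insertCI)+
      have 2: "b \<otimes> inv c \<noteq> b" "c \<otimes> inv b \<noteq> c" using b c b1 0 by auto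
      have 3: "c \<otimes> inv b \<noteq> inv b" "b \<otimes> inv c \<noteq> inv c" using b c ne b1 by auto
      have 4: "c \<otimes> inv b \<noteq> b" using ne b c by (metis inv_solve_right insertCI)
      have 5: "b \<otimes> inv c \<noteq> c" using ne b c by (metis inv_solve_right)
      have 6: "b \<otimes> inv c \<noteq> inv b"
      proof
        assume "b \<otimes> inv c = inv b"
        then have "inv (b \<otimes> inv c) = b" using b by simp
        then show False using 4 b c m_comm by (metis inv_closed inv_inv inv_mult)
      qed
      have 7: "c \<otimes> inv b \<noteq> inv c"
      proof
        assume "c \<otimes> inv b = inv c"
        then have "inv (c \<otimes> inv b) = c" using c by simp
        then show False using 5 b c m_comm by (metis inv_closed inv_inv inv_mult)
      qed
      have 8: "b \<otimes> inv c \<noteq> c \<otimes> inv b"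
      proof
        assume "b \<otimes> inv c = c \<otimes> inv b"
        then have "b \<otimes> inv c \<otimes> c = c \<otimes> inv b \<otimes> c" by simp
        then have "b = c \<otimes> c \<otimes> inv b" using b c by (simp add: m_ac)
        then have "b \<otimes> b = c \<otimes> c" using b c by (metis inv_solve_right m_closed)
        then show False using c3 by simp
      qed
      have 9: "inv b \<noteq> \<one>" "\<one> \<noteq> inv b" "\<one> \<noteq> inv c" "b \<noteq> \<one>" "c \<noteq> \<one>" "c \<noteq> b" "c \<noteq> inv b" using b1 ib1 ne 0 by auto
      note ne' = 0 1 2 3 4 5 6 7 8 9 bi ci
      show ?thesis using ne' ne'[THEN not_sym]
        by (simp only: distinct.simps list.set insert_iff empty_iff de_Morgan_disj simp_thms)
    qed
    then have "card (set [\<one>, b, inv b, c, inv c, b \<otimes> inv c, c \<otimes> inv b]) = 7" using distinct_card by fastforce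
    ultimately show False using product_and_quotient_set_cards[OF eq b(1) c] by simp
  qed
  have sqr: "c = inv (b \<otimes> b) \<and> b \<otimes> b \<otimes> b \<otimes> b \<otimes> b = \<one>"
    if c: "c \<in> carrier G" "c \<notin> {\<one>, b, inv b, b \<otimes> b}" "c \<otimes> c = b" for c
  proof -
    have "inv c \<otimes> inv c = inv b" using c by (simp flip: inv_mult)
    then have "inv c \<in> {\<one>, b, inv b, b \<otimes> b}" using sq[of "inv c"] c bi by auto
    moreover have "inv c \<notin> {\<one>, b, inv b}" using c(1,2) b(1) by (metis inv_inv inv_one insertCI insertE singletonD)
    ultimately have ic: "inv c = b \<otimes> b" by (simp only: insert_iff empty_iff) metis
    then have "c = inv (b \<otimes> b)" using c by (metis inv_inv)
    moreover have "b \<otimes> b \<otimes> b \<otimes> b \<otimes> b = inv c \<otimes> inv c \<otimes> b" using ic b by (simp add: m_assoc)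
    then have "b \<otimes> b \<otimes> b \<otimes> b \<otimes> b = \<one>" using \<open>inv c \<otimes> inv c = inv b\<close> b by simp
    ultimately show ?thesis by simp
  qed
  show "carrier G \<subseteq> {\<one>, b, b \<otimes> b, inv b, inv (b \<otimes> b)}"
    using sq sqr by blast
  show "b \<otimes> b \<otimes> b = \<one> \<or> b \<otimes> b \<otimes> b \<otimes> b = \<one> \<or> b \<otimes> b \<otimes> b \<otimes> b \<otimes> b = \<one>"
  proof -
    define c where "c = b \<otimes> b \<otimes> b"
    have c: "c \<in> carrier G" using b by (simp add: c_def)
    consider "c = \<one>" | "c = b" | "c = inv b" | "c = b \<otimes> b" | "c \<notin> {\<one>, b, inv b, b \<otimes> b}" "c \<otimes> c = b"
      using sq[OF c] by blast
    then show ?thesis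
    proof cases
      case 2 then show ?thesis using b by (simp add: c_def m_assoc)
    next
      case 3 then show ?thesis using b by (simp add: c_def)
    next
      case 4 then show ?thesis using b b1 by (simp add: c_def m_assoc)
    next
      case 5 then show ?thesis using sqr[OF c] by blast
    qed (simp add: c_def)
  qed
qed

end

section \<open>Balanced groups from an inverted abelian subgroup\<close>

lemma balanced_iso:
  assumes "group G" "group H" "G \<cong> H" "balanced H"
  shows "balanced G"
proof -
  interpret G: group G by fact
  interpret H: group H by fact
  obtain h where h: "h \<in> iso G H" using assms(3) by (auto simp: is_iso_def)
  interpret h: group_hom G H h
    using h by (simp add: group_hom_def group_hom_axioms_def G.is_group H.is_group iso_def)
  have inj: "inj_on h (carrier G)" and surj: "h ` carrier G = carrier H"
    using h by (auto simp: iso_def bij_betw_def)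
  have bH: "group H" "finite (carrier H)" "\<And>A. A \<subseteq> carrier H \<Longrightarrow>
      card {a \<otimes>\<^bsub>H\<^esub> inv\<^bsub>H\<^esub> b | a b. a \<in> A \<and> b \<in> A} = card {inv\<^bsub>H\<^esub> a \<otimes>\<^bsub>H\<^esub> b | a b. a \<in> A \<and> b \<in> A}"
    using assms(4) unfolding balanced_def by blast+
  show ?thesis unfolding balanced_def
  proof (intro conjI allI impI)
    show "finite (carrier G)" using bH(2) assms(3) iso_finite by blast
    fix A assume A: "A \<subseteq> carrier G"
    define P where "P = {a \<otimes>\<^bsub>G\<^esub> inv\<^bsub>G\<^esub> b | a b. a \<in> A \<and> b \<in> A}"
    define Q where "Q = {inv\<^bsub>G\<^esub> a \<otimes>\<^bsub>G\<^esub> b | a b. a \<in> A \<and> b \<in> A}"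
    have PQ: "P \<subseteq> carrier G" "Q \<subseteq> carrier G" using A unfolding P_def Q_def by auto
    have c: "a \<in> carrier G" if "a \<in> A" for a using A that by blast
    have "h ` P = (\<Union>a\<in>A. \<Union>b\<in>A. {h (a \<otimes>\<^bsub>G\<^esub> inv\<^bsub>G\<^esub> b)})" unfolding P_def by blast
    also have "\<dots> = (\<Union>a\<in>A. \<Union>b\<in>A. {h a \<otimes>\<^bsub>H\<^esub> inv\<^bsub>H\<^esub> h b})" using c by simp
    finally have "h ` P = {a \<otimes>\<^bsub>H\<^esub> inv\<^bsub>H\<^esub> b | a b. a \<in> h ` A \<and> b \<in> h ` A}" by blast
    moreover have "h ` Q = (\<Union>a\<in>A. \<Union>b\<in>A. {h (inv\<^bsub>G\<^esub> a \<otimes>\<^bsub>G\<^esub> b)})" unfolding Q_def by blast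
    then have "h ` Q = (\<Union>a\<in>A. \<Union>b\<in>A. {inv\<^bsub>H\<^esub> h a \<otimes>\<^bsub>H\<^esub> h b})" using c by simp
    then have "h ` Q = {inv\<^bsub>H\<^esub> a \<otimes>\<^bsub>H\<^esub> b | a b. a \<in> h ` A \<and> b \<in> h ` A}" by blast
    moreover have "h ` A \<subseteq> carrier H" using A surj by blast
    ultimately have "card (h ` P) = card (h ` Q)" using bH(3) by simp
    moreover have "card (h ` P) = card P" "card (h ` Q) = card Q"
      using PQ inj by (meson card_image inj_on_subset)+
    ultimately show "card {a \<otimes>\<^bsub>G\<^esub> inv\<^bsub>G\<^esub> b | a b. a \<in> A \<and> b \<in> A} = card {inv\<^bsub>G\<^esub> a \<otimes>\<^bsub>G\<^esub> b | a b. a \<in> A \<and> b \<in> A}"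
      unfolding P_def Q_def by simp
  qed (rule assms)
qed

lemma (in comm_group) balanced_if_finite:
  assumes "finite (carrier G)"
  shows "balanced G"
  unfolding balanced_def
proof (intro conjI allI impI)
    fix A assume A: "A \<subseteq> carrier G"
    have "{a \<otimes> inv b | a b. a \<in> A \<and> b \<in> A} = {inv a \<otimes> b | a b. a \<in> A \<and> b \<in> A}"
    proof (intro Collect_cong)
      fix p
      have "a \<otimes> inv b = inv b \<otimes> a" if "a \<in> A" "b \<in> A" for a b
        using A that by (intro m_comm) auto
      then show "(\<exists>a b. p = a \<otimes> inv b \<and> a \<in> A \<and> b \<in> A) = (\<exists>a b. p = inv a \<otimes> b \<and> a \<in> A \<and> b \<in> A)" by metis
    qed
    then show "card {a \<otimes> inv b | a b. a \<in> A \<and> b \<in> A} = card {inv a \<otimes> b | a b. a \<in> A \<and> b \<in> A}" by simp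
qed (use assms is_group in auto)

context group begin

text \<open>
  For \<open>z^2 = \<one>\<close> this is \<open>Z B\<close> with the subgroup \<open>Z = {\<one>, z}\<close>, written as a union of cosets of \<open>Z\<close>.
\<close>

definition thick :: "'a \<Rightarrow> 'a set \<Rightarrow> 'a set" where
  "thick z B = (\<Union>b\<in>B. {b, z \<otimes> b})"

text \<open>
  With \<open>z = x^2\<close> the rules \<open>x c = c^-1 x\<close> and \<open>x^-1 = z x\<close> bring every quotient of elements of \<open>A\<close>
  to the form \<open>c\<close> or \<open>c x\<close>. Quotients within \<open>B\<close> or within \<open>Dx\<close> contribute \<open>E\<close> on both sides. The
  mixed quotients \<open>b (dx)^-1 = z b d x\<close> and \<open>(dx) b^-1 = b d x\<close> contribute \<open>Z B D x\<close> on one side;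
  \<open>b^-1 (dx)\<close> and \<open>(dx)^-1 b = z b^-1 d x\<close> contribute \<open>Z B^-1 D x\<close> on the other.
\<close>

lemma card_quotients_inverted_abelian:
  assumes C: "subgroup C G" "finite C" and comm: "\<And>c d. c \<in> C \<Longrightarrow> d \<in> C \<Longrightarrow> c \<otimes> d = d \<otimes> c"
    and x: "x \<in> carrier G" "x \<notin> C" "x \<otimes> x \<in> C" and inv: "\<And>c. c \<in> C \<Longrightarrow> x \<otimes> c = inv c \<otimes> x"
    and BC: "B \<subseteq> C" and DC: "D \<subseteq> C"
  defines "A \<equiv> B \<union> (\<lambda>d. d \<otimes> x) ` D"
    and "E \<equiv> {b \<otimes> inv b' | b b'. b \<in> B \<and> b' \<in> B} \<union> {d \<otimes> inv d' | d d'. d \<in> D \<and> d' \<in> D}"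
  shows "card {a \<otimes> inv b | a b. a \<in> A \<and> b \<in> A} = card E + card (thick (x \<otimes> x) B <#> D)"
    and "card {inv a \<otimes> b | a b. a \<in> A \<and> b \<in> A} = card E + card (thick (x \<otimes> x) ((\<lambda>b. inv b) ` B) <#> D)"
proof -
  interpret C: subgroup C G by (fact C)
  define z where "z = x \<otimes> x"
  have zC: "z \<in> C" using x by (simp add: z_def)
  then have zc: "z \<in> carrier G" by simp
  have zz: "z \<otimes> z = \<one>"
  proof -
    have "inv z \<otimes> x = z \<otimes> x" using inv[OF zC] x(1) by (simp add: z_def m_assoc)
    then show ?thesis using x(1) zc by (metis inv_closed r_inv right_cancel)
  qed
  have ix: "inv x = z \<otimes> x"
  proof (rule inv_equality)
    have "z \<otimes> x \<otimes> x = z \<otimes> z" using x zc by (simp add: z_def m_assoc)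
    then show "z \<otimes> x \<otimes> x = \<one>" using zz by simp
  qed (use x zc in auto)
  have f: "c \<otimes> inv (d \<otimes> x) = (z \<otimes> c \<otimes> d) \<otimes> x" "(d \<otimes> x) \<otimes> inv c = (c \<otimes> d) \<otimes> x"
    "(c \<otimes> x) \<otimes> inv (d \<otimes> x) = c \<otimes> inv d"
    "inv c \<otimes> (d \<otimes> x) = (inv c \<otimes> d) \<otimes> x" "inv (d \<otimes> x) \<otimes> c = (z \<otimes> inv c \<otimes> d) \<otimes> x"
    "inv (c \<otimes> x) \<otimes> (d \<otimes> x) = c \<otimes> inv d" "inv c \<otimes> d = d \<otimes> inv c"
    if cd: "c \<in> B \<union> D" "d \<in> B \<union> D" for c d
  proof -
    have cd: "c \<in> C" "d \<in> C" using that BC DC by auto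
    have i: "inv c \<in> C" "inv d \<in> C" using cd by auto
    have cc: "c \<in> carrier G" "d \<in> carrier G" using cd by auto
    have "c \<otimes> inv (d \<otimes> x) = c \<otimes> (z \<otimes> (x \<otimes> inv d))" using cc x zc by (simp add: inv_mult_group ix m_assoc)
    also have "\<dots> = (c \<otimes> z) \<otimes> d \<otimes> x" using inv[OF i(2)] cc x zc by (simp add: m_assoc)
    finally show "c \<otimes> inv (d \<otimes> x) = (z \<otimes> c \<otimes> d) \<otimes> x" unfolding comm[OF cd(1) zC] .
    have "(d \<otimes> x) \<otimes> inv c = (d \<otimes> c) \<otimes> x" using inv[OF i(1)] cc x by (simp add: m_assoc)
    then show "(d \<otimes> x) \<otimes> inv c = (c \<otimes> d) \<otimes> x" unfolding comm[OF cd] .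
    show "(c \<otimes> x) \<otimes> inv (d \<otimes> x) = c \<otimes> inv d" using cc x by (simp add: word_simps)
    show "inv c \<otimes> (d \<otimes> x) = (inv c \<otimes> d) \<otimes> x" using cc x by (simp add: m_assoc)
    have w: "inv d \<otimes> c \<in> C" "inv c \<otimes> d \<in> C" using cd i by auto
    have "inv (d \<otimes> x) \<otimes> c = z \<otimes> (x \<otimes> (inv d \<otimes> c))" using cc x zc by (simp add: inv_mult_group ix m_assoc)
    also have "\<dots> = z \<otimes> (inv c \<otimes> d) \<otimes> x" unfolding inv[OF w(1)] using cc x zc by (simp add: inv_mult_group m_assoc)
    finally show "inv (d \<otimes> x) \<otimes> c = (z \<otimes> inv c \<otimes> d) \<otimes> x" using cc zc by (simp add: m_assoc)
    have "inv (c \<otimes> x) \<otimes> (d \<otimes> x) = z \<otimes> (x \<otimes> (inv c \<otimes> d)) \<otimes> x" using cc x zc by (simp add: inv_mult_group ix m_assoc)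
    also have "\<dots> = z \<otimes> (inv d \<otimes> c) \<otimes> z" unfolding inv[OF w(2)] using cc x zc by (simp add: inv_mult_group m_assoc z_def)
    also have "\<dots> = (inv d \<otimes> c) \<otimes> (z \<otimes> z)" unfolding comm[OF zC w(1)] using cc zc by (simp add: m_assoc)
    also have "\<dots> = inv d \<otimes> c" using zz cc by simp
    finally show "inv (c \<otimes> x) \<otimes> (d \<otimes> x) = c \<otimes> inv d" unfolding comm[OF cd(1) i(2)] .
    show "inv c \<otimes> d = d \<otimes> inv c" by (rule comm[OF i(1) cd(2)])
  qed
  let ?P = "{a \<otimes> inv b | a b. a \<in> A \<and> b \<in> A}" and ?Q = "{inv a \<otimes> b | a b. a \<in> A \<and> b \<in> A}"
  have split: "{g a b | a b. a \<in> A \<and> b \<in> A} = (\<Union>b\<in>B. \<Union>b'\<in>B. {g b b'}) \<union>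
      (\<Union>d\<in>D. \<Union>d'\<in>D. {g (d \<otimes> x) (d' \<otimes> x)}) \<union> (\<Union>b\<in>B. \<Union>d\<in>D. {g (d \<otimes> x) b, g b (d \<otimes> x)})"
    for g :: "'a \<Rightarrow> 'a \<Rightarrow> 'a"
    unfolding A_def by auto
  have E: "E = (\<Union>b\<in>B. \<Union>b'\<in>B. {b \<otimes> inv b'}) \<union> (\<Union>d\<in>D. \<Union>d'\<in>D. {d \<otimes> inv d'})"
    unfolding E_def by auto
  have "E = (\<Union>b\<in>B. \<Union>b'\<in>B. {inv b \<otimes> b'}) \<union> (\<Union>d\<in>D. \<Union>d'\<in>D. {d \<otimes> inv d'})"
  proof -
    have "inv b \<otimes> b' = b' \<otimes> inv b" if "b \<in> B" "b' \<in> B" for b b' using f(7) that by blast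
    then show ?thesis unfolding E by auto
  qed
  note E' = this
  have M: "(\<lambda>w. w \<otimes> x) ` (thick z X <#> D) = (\<Union>b\<in>X. \<Union>d\<in>D. {(b \<otimes> d) \<otimes> x, (z \<otimes> b \<otimes> d) \<otimes> x})" for X
    by (auto simp: thick_def set_mult_def)
  have P: "?P = E \<union> (\<lambda>w. w \<otimes> x) ` (thick z B <#> D)"
    unfolding split E M
    by (intro arg_cong2[where f = "(\<union>)"] SUP_cong HOL.refl; simp only: f(1-3) UnI1 UnI2)
  have Q: "?Q = E \<union> (\<lambda>w. w \<otimes> x) ` (thick z ((\<lambda>b. inv b) ` B) <#> D)"
    unfolding split E' M image_image UN_simps
    by (intro arg_cong2[where f = "(\<union>)"] SUP_cong HOL.refl; simp only: f(4-6) UnI1 UnI2 insert_commute)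
  have "card (E \<union> (\<lambda>w. w \<otimes> x) ` (thick z X <#> D)) = card E + card (thick z X <#> D)" if X: "X \<subseteq> C" for X
  proof -
    have EC: "E \<subseteq> C" "thick z X <#> D \<subseteq> C"
      unfolding E_def thick_def set_mult_def using X BC DC zC by (auto intro!: C.m_closed C.m_inv_closed)
    have "w \<otimes> x \<notin> C" if "w \<in> C" for w
      using C.m_closed[OF C.m_inv_closed[OF that], of "w \<otimes> x"] that x by (auto simp: inv_mult_cancel)
    then have "E \<inter> (\<lambda>w. w \<otimes> x) ` (thick z X <#> D) = {}" using EC by blast
    moreover have "inj_on (\<lambda>w. w \<otimes> x) (thick z X <#> D)"
      using EC(2) x by (intro inj_on_subset[OF inj_on_multc]) auto
    moreover have "finite E" "finite (thick z X <#> D)" using EC C(2) finite_subset by blast+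
    ultimately show ?thesis by (simp add: card_Un_disjoint card_image)
  qed
  moreover have "(\<lambda>b. inv b) ` B \<subseteq> C" using BC by auto
  ultimately show "card ?P = card E + card (thick (x \<otimes> x) B <#> D)"
    "card ?Q = card E + card (thick (x \<otimes> x) ((\<lambda>b. inv b) ` B) <#> D)"
    unfolding P Q z_def[symmetric] using BC by simp_all
qed

end

context comm_group begin

lemma inv_image_set_mult:
  assumes "X \<subseteq> carrier G" "Y \<subseteq> carrier G"
  shows "(\<lambda>w. inv w) ` (X <#> Y) = (\<lambda>w. inv w) ` X <#> (\<lambda>w. inv w) ` Y"
proof -
  have "inv (x \<otimes> y) = inv x \<otimes> inv y" if "x \<in> X" "y \<in> Y" for x y using that assms by (intro inv_mult) auto
  then show ?thesis unfolding set_mult_def by (simp add: image_UN)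
qed

lemma inj_on_inv: "inj_on (\<lambda>w. inv w) (carrier G)"
  by (rule inj_onI) (metis inv_inv)

context
  fixes z B D
  assumes z: "z \<in> carrier G" "z \<otimes> z = \<one>" and BD: "B \<subseteq> carrier G" "D \<subseteq> carrier G"
begin

lemma inv_involution: "inv z = z"
  using z by (simp add: inv_equality)

lemma involution_cancel: "w \<in> carrier G \<Longrightarrow> z \<otimes> (z \<otimes> w) = w"
  using z by (simp flip: m_assoc)

lemma thick_subset: "X \<subseteq> carrier G \<Longrightarrow> thick z X \<subseteq> carrier G"
  using z by (auto simp: thick_def)

lemma thick_inv: "thick z ((\<lambda>b. inv b) ` B) = (\<lambda>b. inv b) ` thick z B"
proof -
  have "inv (z \<otimes> b) = z \<otimes> inv b" if "b \<in> B" for b using that z BD inv_involution by (auto simp: inv_mult)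
  then show ?thesis by (simp add: thick_def image_UN)
qed

lemma thick_inv_eq_if_squares:
  assumes sq: "\<And>b. b \<in> B \<Longrightarrow> b \<otimes> b \<in> {\<one>, z}"
  shows "thick z ((\<lambda>b. inv b) ` B) = thick z B"
proof -
  have "{inv b, z \<otimes> inv b} = {b, z \<otimes> b}" if b: "b \<in> B" for b
  proof -
    have bc: "b \<in> carrier G" using b BD by blast
    have "inv b = b \<or> inv b = z \<otimes> b"
      using sq[OF b] bc z by (auto simp: m_assoc intro: inv_equality)
    then show ?thesis using involution_cancel[OF bc] by auto
  qed
  then show ?thesis by (simp add: thick_def)
qed

text \<open>
  Multiplication by \<open>b1^-1 b2^-1\<close> maps \<open>b1\<close> to \<open>b2^-1\<close> and \<open>b2\<close> to \<open>b1^-1\<close>. So it maps \<open>Z B\<close> onto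
  \<open>Z B^-1\<close>.
\<close>

lemma card_thick_mult_inv_two_cosets:
  assumes b: "b1 \<in> B" "b2 \<in> B" "\<And>b. b \<in> B \<Longrightarrow> b \<in> {b1, z \<otimes> b1, b2, z \<otimes> b2}"
  shows "card (thick z ((\<lambda>b. inv b) ` B) <#> D) = card (thick z B <#> D)"
proof -
  have bc: "b1 \<in> carrier G" "b2 \<in> carrier G" using b BD by auto
  let ?t = "inv b1 \<otimes> inv b2"
  have tc: "?t \<in> carrier G" using bc by simp
  have t: "?t \<otimes> b1 = inv b2" "?t \<otimes> b2 = inv b1"
    using bc by (simp_all add: m_assoc m_comm[of "inv b2" b1] inv_mult_cancel)
  have tz: "?t \<otimes> (z \<otimes> b) = z \<otimes> (?t \<otimes> b)" if "b \<in> carrier G" for b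
    using z tc that by (simp add: m_lcomm)
  have T: "thick z B = {b1, z \<otimes> b1, b2, z \<otimes> b2}"
    using b bc involution_cancel unfolding thick_def by auto
  have "thick z ((\<lambda>b. inv b) ` B) = (\<lambda>w. ?t \<otimes> w) ` thick z B"
    unfolding thick_inv T using bc z by (auto simp: tz t inv_mult inv_involution)
  also have "\<dots> <#> D = (\<lambda>w. ?t \<otimes> w) ` (thick z B <#> D)"
  proof -
    have "?t \<otimes> w \<otimes> d = ?t \<otimes> (w \<otimes> d)" if "w \<in> thick z B" "d \<in> D" for w d
      using that thick_subset[OF BD(1)] BD tc by (intro m_assoc) auto
    then show ?thesis by (simp add: set_mult_def image_UN)
  qed
  finally show ?thesis
    using card_image[OF inj_on_subset[OF inj_on_cmult[OF tc] set_mult_closed[OF thick_subset[OF BD(1)] BD(2)]]] by simp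
qed

text \<open>
  Inversion maps one set onto the other. Together with commutativity this exchanges the roles of
  \<open>B\<close> and \<open>D\<close>.
\<close>

lemma card_thick_mult_inv_swap:
  "card (thick z ((\<lambda>b. inv b) ` B) <#> D) = card (thick z B <#> (\<lambda>d. inv d) ` D)"
proof -
  have iD: "(\<lambda>d. inv d) ` D \<subseteq> carrier G" using BD by auto
  have "(\<lambda>w. inv w) ` (\<lambda>d. inv d) ` D = D" using BD by (force simp: image_image)
  then have "thick z ((\<lambda>b. inv b) ` B) <#> D = (\<lambda>w. inv w) ` (thick z B <#> (\<lambda>d. inv d) ` D)"
    unfolding thick_inv inv_image_set_mult[OF thick_subset[OF BD(1)] iD] by simp
  then show ?thesis
    using card_image[OF inj_on_subset[OF inj_on_inv set_mult_closed[OF thick_subset[OF BD(1)] iD]]] by simp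
qed

lemma thick_mult_commute: "thick z B <#> D = thick z D <#> B"
proof -
  have eq: "{b \<otimes> d, z \<otimes> b \<otimes> d} = {d \<otimes> b, z \<otimes> d \<otimes> b}" if "b \<in> B" "d \<in> D" for b d
    using that BD z by (auto simp: m_ac subset_iff)
  have "(\<Union>b\<in>B. \<Union>d\<in>D. {b \<otimes> d, z \<otimes> b \<otimes> d}) = (\<Union>b\<in>B. \<Union>d\<in>D. {d \<otimes> b, z \<otimes> d \<otimes> b})"
    by (rule SUP_cong[OF HOL.refl], rule SUP_cong[OF HOL.refl], rule eq)
  moreover have "thick z B <#> D = (\<Union>b\<in>B. \<Union>d\<in>D. {b \<otimes> d, z \<otimes> b \<otimes> d})"
    "thick z D <#> B = (\<Union>b\<in>B. \<Union>d\<in>D. {d \<otimes> b, z \<otimes> d \<otimes> b})"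
    by (auto simp: thick_def set_mult_def)
  ultimately show ?thesis by simp
qed

text \<open>
  The pigeonhole principle modulo \<open>Z\<close>: for each \<open>w\<close> the sets \<open>w B^-1\<close> and \<open>D\<close> meet three cosets
  of \<open>Z\<close> each. There are at most five cosets, so some \<open>w b^-1\<close> and \<open>d\<close> lie in the same one.
\<close>

lemma thick_mult_eq_carrier:
  assumes F: "finite F" "card F \<le> 5" "carrier G \<subseteq> thick z F" "F \<subseteq> carrier G"
    and B: "b1 \<in> B" "b2 \<in> B" "b3 \<in> B" "b2 \<notin> {b1, z \<otimes> b1}" "b3 \<notin> {b1, z \<otimes> b1, b2, z \<otimes> b2}"
    and D: "d1 \<in> D" "d2 \<in> D" "d3 \<in> D" "d2 \<notin> {d1, z \<otimes> d1}" "d3 \<notin> {d1, z \<otimes> d1, d2, z \<otimes> d2}"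
  shows "thick z B <#> D = carrier G"
proof (intro subset_antisym set_mult_closed thick_subset BD subsetI)
  fix w assume w: "w \<in> carrier G"
  \<comment> \<open>\<open>\<phi>\<close> selects the representative in \<open>F\<close> of a coset of \<open>{\<one>, z}\<close>\<close>
  have "\<forall>w\<in>carrier G. \<exists>f. f \<in> F \<and> (w = f \<or> w = z \<otimes> f)" using F(3) unfolding thick_def by blast
  then obtain \<phi> where \<phi>: "\<phi> w \<in> F" "w = \<phi> w \<or> w = z \<otimes> \<phi> w" if "w \<in> carrier G" for w
    unfolding bchoice_iff by blast
  have same: "u = v \<or> u = z \<otimes> v" if uv: "u \<in> carrier G" "v \<in> carrier G" "\<phi> u = \<phi> v" for u v
  proof -
    have "\<phi> v \<in> carrier G" using \<phi>(1)[OF uv(2)] F(4) by blast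
    then show ?thesis using \<phi>(2)[OF uv(1)] \<phi>(2)[OF uv(2)] uv(3) involution_cancel[of "\<phi> v"] by auto
  qed
  have bc: "b1 \<in> carrier G" "b2 \<in> carrier G" "b3 \<in> carrier G" and dc: "d1 \<in> carrier G" "d2 \<in> carrier G" "d3 \<in> carrier G"
    using B D BD by auto
  have ne: "\<phi> (w \<otimes> inv b) \<noteq> \<phi> (w \<otimes> inv b')" if "b \<in> carrier G" "b' \<in> carrier G" "b' \<notin> {b, z \<otimes> b}" for b b'
  proof
    assume "\<phi> (w \<otimes> inv b) = \<phi> (w \<otimes> inv b')"
    then have "w \<otimes> inv b = w \<otimes> inv b' \<or> w \<otimes> inv b = w \<otimes> (z \<otimes> inv b')"
      using same[of "w \<otimes> inv b" "w \<otimes> inv b'"] m_lcomm[of z w "inv b'"] w that z by simp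
    then have "inv b = inv b' \<or> inv b = inv (z \<otimes> b')" using w that z by (simp add: inv_mult inv_involution)
    then have "b = b' \<or> b = z \<otimes> b'" using that z by (metis inv_inv m_closed)
    then show False using that involution_cancel by auto
  qed
  have ned: "\<phi> d \<noteq> \<phi> d'" if "d \<in> carrier G" "d' \<in> carrier G" "d' \<notin> {d, z \<otimes> d}" for d d'
    using same[OF that(2,1)] that(3) by (metis insertCI)
  let ?S = "set [\<phi> (w \<otimes> inv b1), \<phi> (w \<otimes> inv b2), \<phi> (w \<otimes> inv b3)]" and ?T = "set [\<phi> d1, \<phi> d2, \<phi> d3]"
  have S: "card ?S = 3" using ne[OF bc(1,2)] ne[OF bc(1,3)] ne[OF bc(2,3)] B by simp
  have T: "card ?T = 3" using ned[OF dc(1,2)] ned[OF dc(1,3)] ned[OF dc(2,3)] D by simp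
  have nonempty: "?S \<inter> ?T \<noteq> {}"
  proof
    assume "?S \<inter> ?T = {}"
    then have "card (?S \<union> ?T) = 6" using S T card_Un_disjoint[of ?S ?T] by (simp only: List.finite_set simp_thms)
    moreover have "?S \<union> ?T \<subseteq> F" using \<phi>(1) w bc dc by auto
    ultimately show False using F(1,2) card_mono[of F "?S \<union> ?T"] by simp
  qed
  have ST: "?S = (\<lambda>b. \<phi> (w \<otimes> inv b)) ` {b1, b2, b3}" "?T = \<phi> ` {d1, d2, d3}" by simp_all
  obtain b d where bd: "b \<in> {b1, b2, b3}" "d \<in> {d1, d2, d3}" "\<phi> (w \<otimes> inv b) = \<phi> d"
    using nonempty unfolding ST by blast
  have c: "b \<in> carrier G" "d \<in> carrier G" "b \<in> B" "d \<in> D" using bd bc dc B D by auto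
  have "w \<otimes> inv b = d \<or> w \<otimes> inv b = z \<otimes> d" using same[OF _ c(2) bd(3)] w c by simp
  then have "w = d \<otimes> b \<or> w = z \<otimes> d \<otimes> b" using w c z by (metis inv_solve_right m_closed)
  then have "w \<in> thick z D <#> B" unfolding thick_def set_mult_def using c(3,4) by blast
  then show "w \<in> thick z B <#> D" unfolding thick_mult_commute .
qed

end

text \<open>
  A set that meets at most two cosets of \<open>Z\<close> can be inverted by a translation, modulo \<open>Z\<close>. If
  neither \<open>B\<close> nor \<open>D\<close> is such a set, then both products are the whole group.
\<close>

lemma card_thick_mult_inv:
  assumes z: "z \<in> carrier G" "z \<otimes> z = \<one>" and BD: "B \<subseteq> carrier G" "D \<subseteq> carrier G"
    and F: "finite F" "card F \<le> 5" "carrier G \<subseteq> thick z F" "F \<subseteq> carrier G"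
  shows "card (thick z ((\<lambda>b. inv b) ` B) <#> D) = card (thick z B <#> D)"
proof -
  define small where "small X \<longleftrightarrow> (X = {} \<or> (\<exists>b1\<in>X. \<exists>b2\<in>X. \<forall>b\<in>X. b \<in> {b1, z \<otimes> b1, b2, z \<otimes> b2}))" for X
  have sm: "card (thick z ((\<lambda>b. inv b) ` X) <#> Y) = card (thick z X <#> Y)"
    if "small X" "X \<subseteq> carrier G" "Y \<subseteq> carrier G" for X Y
    using that(1) card_thick_mult_inv_two_cosets[OF z that(2,3)] unfolding small_def
    by (elim disjE bexE) (simp_all add: thick_def set_mult_def)
  have big: "\<exists>b1\<in>X. \<exists>b2\<in>X. \<exists>b3\<in>X. b2 \<notin> {b1, z \<otimes> b1} \<and> b3 \<notin> {b1, z \<otimes> b1, b2, z \<otimes> b2}" if ns: "\<not> small X" for X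
  proof -
    obtain b1 where b1: "b1 \<in> X" using ns unfolding small_def by blast
    then obtain b2 where "b2 \<in> X" "b2 \<notin> {b1, z \<otimes> b1}" using ns unfolding small_def by blast
    then show ?thesis using ns b1 unfolding small_def by blast
  qed
  consider "small B" | "small D" | "\<not> small B" "\<not> small D" by blast
  then show ?thesis
  proof cases
    case 1 then show ?thesis using sm BD by blast
  next
    case 2
    have "(\<lambda>d. inv d) ` D \<subseteq> carrier G" using BD by auto
    then show ?thesis
      using card_thick_mult_inv_swap[OF z BD] sm[OF 2 BD(2,1)] thick_mult_commute[OF z BD]
        thick_mult_commute[OF z BD(1), of "(\<lambda>d. inv d) ` D"] by simp
  next
    case 3
    obtain d1 d2 d3 where d: "d1 \<in> D" "d2 \<in> D" "d3 \<in> D" "d2 \<notin> {d1, z \<otimes> d1}" "d3 \<notin> {d1, z \<otimes> d1, d2, z \<otimes> d2}"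
      using big[OF 3(2)] by blast
    obtain b1 b2 b3 where b: "b1 \<in> B" "b2 \<in> B" "b3 \<in> B" "b2 \<notin> {b1, z \<otimes> b1}" "b3 \<notin> {b1, z \<otimes> b1, b2, z \<otimes> b2}"
      using big[OF 3(1)] by blast
    have ne: "inv y \<notin> {inv x, z \<otimes> inv x}" if "x \<in> B" "y \<in> B" "y \<notin> {x, z \<otimes> x}" for x y
    proof
      have c: "x \<in> carrier G" "y \<in> carrier G" using that BD by auto
      assume "inv y \<in> {inv x, z \<otimes> inv x}"
      then have "inv y = inv x \<or> inv y = inv (z \<otimes> x)" using c z by (auto simp: inv_mult inv_involution[OF z BD])
      then have "y = x \<or> y = z \<otimes> x" using c z by (metis inv_inv m_closed)
      then show False using that by blast
    qed
    have iB: "(\<lambda>b. inv b) ` B \<subseteq> carrier G" using BD by auto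
    have ib: "inv b1 \<in> (\<lambda>b. inv b) ` B" "inv b2 \<in> (\<lambda>b. inv b) ` B" "inv b3 \<in> (\<lambda>b. inv b) ` B"
      "inv b2 \<notin> {inv b1, z \<otimes> inv b1}" "inv b3 \<notin> {inv b1, z \<otimes> inv b1, inv b2, z \<otimes> inv b2}"
      using b(1-3) ne[OF b(1,2,4)] ne[OF b(1,3)] ne[OF b(2,3)] b(5) by auto
    show ?thesis
      using thick_mult_eq_carrier[OF z BD F b d] thick_mult_eq_carrier[OF z iB BD(2) F ib d] by simp
  qed
qed

end

text \<open>
  The two alternatives of the last hypothesis are the reasons why \<open>Z B D\<close> and \<open>Z B^-1 D\<close> have the
  same size: the squares of \<open>C\<close> lie in \<open>Z\<close>, or \<open>Z\<close> has at most five cosets in \<open>C\<close>.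
\<close>

lemma (in group) balanced_if_inverted_abelian:
  assumes fin: "finite (carrier G)" and C: "subgroup C G" and comm: "\<And>c d. c \<in> C \<Longrightarrow> d \<in> C \<Longrightarrow> c \<otimes> d = d \<otimes> c"
    and x: "x \<in> carrier G" "x \<otimes> x \<in> C" and inv: "\<And>c. c \<in> C \<Longrightarrow> x \<otimes> c = inv c \<otimes> x"
    and cov: "\<And>g. g \<in> carrier G \<Longrightarrow> g \<in> C \<or> (\<exists>c\<in>C. g = c \<otimes> x)"
    and small: "(\<forall>c\<in>C. c \<otimes> c \<in> {\<one>, x \<otimes> x}) \<or>
      (\<exists>F\<subseteq>C. finite F \<and> card F \<le> 5 \<and> C \<subseteq> thick (x \<otimes> x) F)"
  shows "balanced G"
proof (cases "x \<in> C")
  interpret C: subgroup C G by fact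
  case True
  have "carrier G \<subseteq> C" using cov True C.m_closed by blast
  then have "comm_group G" using comm by (intro group_comm_groupI) blast
  then show ?thesis using fin by (rule comm_group.balanced_if_finite)
next
  case xC: False
  interpret C: subgroup C G by fact
  let ?H = "G\<lparr>carrier := C\<rparr>"
  have "group ?H" by (rule C.subgroup_is_group) (rule is_group)
  then interpret H: comm_group ?H
    by (rule group.group_comm_groupI) (use comm in simp)
  define z where "z = x \<otimes> x"
  have zC: "z \<in> C" using x by (simp add: z_def)
  have zz: "z \<otimes> z = \<one>"
  proof -
    have "inv z \<otimes> x = z \<otimes> x" using inv[OF zC] x(1) by (simp add: z_def m_assoc)
    then show ?thesis using x(1) zC by (metis C.mem_carrier inv_closed r_inv right_cancel)
  qed
  have fC: "finite C" using C.subset fin finite_subset by blast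
  show ?thesis unfolding balanced_def
  proof (intro conjI allI impI fin is_group)
    fix A assume A: "A \<subseteq> carrier G"
    define B where "B = A \<inter> C"
    define D where "D = {d \<in> C. d \<otimes> x \<in> A}"
    have BD: "B \<subseteq> C" "D \<subseteq> C" by (auto simp: B_def D_def)
    have AB: "A = B \<union> (\<lambda>d. d \<otimes> x) ` D" using cov A by (auto simp: B_def D_def)
    have Hc: "H.thick z X <#>\<^bsub>?H\<^esub> Y = thick z X <#> Y" for X Y by (simp add: H.thick_def thick_def set_mult_def)
    have "inv\<^bsub>?H\<^esub> b = inv b" if "b \<in> B" for b using that BD(1) C by (intro m_inv_consistent) auto
    then have iB: "(\<lambda>b. inv\<^bsub>?H\<^esub> b) ` B = (\<lambda>b. inv b) ` B" by simp
    have "card (thick z ((\<lambda>b. inv b) ` B) <#> D) = card (thick z B <#> D)"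
      using small
    proof
      assume sq: "\<forall>c\<in>C. c \<otimes> c \<in> {\<one>, x \<otimes> x}"
      have "H.thick z ((\<lambda>b. inv\<^bsub>?H\<^esub> b) ` B) = H.thick z B"
        by (rule H.thick_inv_eq_if_squares) (use zC zz BD sq in \<open>auto simp: z_def\<close>)
      then show ?thesis unfolding iB by (simp add: H.thick_def thick_def)
    next
      assume "\<exists>F\<subseteq>C. finite F \<and> card F \<le> 5 \<and> C \<subseteq> thick (x \<otimes> x) F"
      then obtain F where F: "F \<subseteq> C" "finite F" "card F \<le> 5" "C \<subseteq> thick z F"
        unfolding z_def by blast
      have "card (H.thick z ((\<lambda>b. inv\<^bsub>?H\<^esub> b) ` B) <#>\<^bsub>?H\<^esub> D) = card (H.thick z B <#>\<^bsub>?H\<^esub> D)"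
        by (rule H.card_thick_mult_inv[of z B D F]) (use zC zz BD F in \<open>simp_all add: H.thick_def thick_def\<close>)
      then show ?thesis unfolding Hc iB .
    qed
    then show "card {a \<otimes> inv b | a b. a \<in> A \<and> b \<in> A} = card {inv a \<otimes> b | a b. a \<in> A \<and> b \<in> A}"
      using card_quotients_inverted_abelian[OF C fC comm x(1) xC x(2) inv BD] unfolding AB z_def by linarith
  qed
qed

section \<open>Abelian subgroups inverted by an involution\<close>

context group begin

lemma invertsD:
  assumes "x \<otimes> y = inv y \<otimes> x" "x \<in> carrier G" "y \<in> carrier G"
  shows "x \<otimes> inv y = y \<otimes> x" "inv x \<otimes> y = inv y \<otimes> inv x" "inv x \<otimes> inv y = y \<otimes> inv x"
proof -
  have "y \<otimes> (x \<otimes> y) \<otimes> inv y = y \<otimes> (inv y \<otimes> x) \<otimes> inv y" using assms(1) by simp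
  then show 1: "x \<otimes> inv y = y \<otimes> x" using assms(2,3) by (simp add: word_simps)
  have "inv x \<otimes> (x \<otimes> y) \<otimes> inv x = inv x \<otimes> (inv y \<otimes> x) \<otimes> inv x" using assms(1) by simp
  then show "inv x \<otimes> inv y = y \<otimes> inv x" using assms(2,3) by (simp add: word_simps)
  have "inv x \<otimes> (x \<otimes> inv y) \<otimes> inv x = inv x \<otimes> (y \<otimes> x) \<otimes> inv x" using 1 by simp
  then show "inv x \<otimes> y = inv y \<otimes> inv x" using assms(2,3) by (simp add: word_simps)
qed

end

context balanced_group begin

text \<open>
  Conjugation by \<open>a\<close> is an automorphism of \<open>C\<close>, and inversion is one only if \<open>C\<close> is abelian.
\<close>

lemma inverted_subgroup_is_abelian:
  assumes "C \<subseteq> carrier G" "subgroup C G" "a \<in> carrier G" "a \<otimes> a = \<one>"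
    and inv: "\<And>c. c \<in> C \<Longrightarrow> a \<otimes> c \<otimes> a = inv c" and "x \<in> C" "y \<in> C"
  shows "x \<otimes> y = y \<otimes> x"
proof -
  interpret C: subgroup C G by fact
  have c: "x \<in> carrier G" "y \<in> carrier G" using assms by auto
  have ia: "inv a = a" using assms by (simp add: inv_equality)
  have "inv (x \<otimes> y) = a \<otimes> (x \<otimes> y) \<otimes> a" using inv assms by simp
  also have "\<dots> = (a \<otimes> x \<otimes> a) \<otimes> (a \<otimes> y \<otimes> a)" using conj_mult[of a x y] c assms(3) ia by simp
  also have "\<dots> = inv x \<otimes> inv y" using inv assms by simp
  also have "\<dots> = inv (y \<otimes> x)" using c by (simp add: inv_mult_group)
  finally show ?thesis using c by (metis inv_inv m_closed)
qed

text \<open>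
  For the subset \<open>S \<union> Sa\<close> the formula of \<open>card_quotients_inverted_abelian\<close> has \<open>z = \<one>\<close>, so
  it compares \<open>S S\<close> with \<open>S^-1 S\<close>.
\<close>

lemma card_products_eq_card_quotients:
  assumes C: "subgroup C G" and a: "a \<in> carrier G" "a \<notin> C" "a \<otimes> a = \<one>"
    and inv: "\<And>c. c \<in> C \<Longrightarrow> a \<otimes> c \<otimes> a = inv c" and S: "S \<subseteq> C"
  shows "card {x \<otimes> y | x y. x \<in> S \<and> y \<in> S} = card {x \<otimes> inv y | x y. x \<in> S \<and> y \<in> S}"
proof -
  interpret C: subgroup C G by fact
  have comm: "x \<otimes> y = y \<otimes> x" if "x \<in> C" "y \<in> C" for x y
    using inverted_subgroup_is_abelian[OF C.subset C a(1,3) inv that] .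
  let ?A = "S \<union> (\<lambda>x. x \<otimes> a) ` S"
  have ia: "inv a = a" using a by (simp add: inv_equality)
  have swap: "a \<otimes> c = inv c \<otimes> a" if "c \<in> C" for c
    using inv[OF that] conj_eq_iff[of a c "inv c"] that a(1) ia by simp
  have A: "?A \<subseteq> carrier G" using S C.subset a(1) by auto
  have aa: "a \<otimes> a \<in> C" using a(3) by simp
  have t: "thick (a \<otimes> a) X = X" if "X \<subseteq> C" for X unfolding thick_def a(3) using that by force
  have iS: "(\<lambda>x. inv x) ` S \<subseteq> C" using S by auto
  have "(\<lambda>x. inv x) ` S <#> S = {inv x \<otimes> y | x y. x \<in> S \<and> y \<in> S}" by (auto simp: set_mult_def)
  also have "\<dots> = {x \<otimes> inv y | x y. x \<in> S \<and> y \<in> S}"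
  proof -
    have "inv x \<otimes> y = y \<otimes> inv x" if "x \<in> S" "y \<in> S" for x y using that S by (intro comm) auto
    then show ?thesis by (intro Collect_cong) metis
  qed
  moreover have "S <#> S = {x \<otimes> y | x y. x \<in> S \<and> y \<in> S}" by (auto simp: set_mult_def)
  ultimately show ?thesis
    using card_quotients_inverted_abelian[OF C finite_subset_carrier[OF C.subset] comm a(1,2) aa swap S S]
      card_quotients_eq[OF A] unfolding t[OF S] t[OF iS] by simp
qed

lemma inverted_subgroup_small:
  assumes C: "subgroup C G" and a: "a \<in> carrier G" "a \<notin> C" "a \<otimes> a = \<one>"
    and inv: "\<And>c. c \<in> C \<Longrightarrow> a \<otimes> c \<otimes> a = inv c" and b: "b \<in> C" "b \<otimes> b \<noteq> \<one>"
  shows "C \<subseteq> {\<one>, b, b \<otimes> b, inv b, inv (b \<otimes> b)}"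
    and "b \<otimes> b \<otimes> b = \<one> \<or> b \<otimes> b \<otimes> b \<otimes> b = \<one> \<or> b \<otimes> b \<otimes> b \<otimes> b \<otimes> b = \<one>"
proof -
  interpret C: subgroup C G by fact
  let ?H = "G\<lparr>carrier := C\<rparr>"
  have "group ?H" by (rule C.subgroup_is_group) (rule is_group)
  then interpret H: comm_group ?H
  proof (rule group.group_comm_groupI)
    fix x y assume "x \<in> carrier ?H" "y \<in> carrier ?H"
    then show "x \<otimes>\<^bsub>?H\<^esub> y = y \<otimes>\<^bsub>?H\<^esub> x"
      using inverted_subgroup_is_abelian[OF C.subset C a(1,3) inv] by simp
  qed
  have iH: "inv\<^bsub>?H\<^esub> x = inv x" if "x \<in> C" for x using that C by simp
  have "card {x \<otimes>\<^bsub>?H\<^esub> y | x y. x \<in> S \<and> y \<in> S} = card {x \<otimes>\<^bsub>?H\<^esub> inv\<^bsub>?H\<^esub> y | x y. x \<in> S \<and> y \<in> S}"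
    if "S \<subseteq> carrier ?H" for S
  proof -
    have iS: "inv\<^bsub>?H\<^esub> y = inv y" if "y \<in> S" for y using iH \<open>S \<subseteq> carrier ?H\<close> that by auto
    have "{x \<otimes>\<^bsub>?H\<^esub> inv\<^bsub>?H\<^esub> y | x y. x \<in> S \<and> y \<in> S} = {x \<otimes> inv y | x y. x \<in> S \<and> y \<in> S}"
      by (rule Collect_cong, rule ex_cong1, rule ex_cong1) (use iS in auto)
    then show ?thesis using card_products_eq_card_quotients[OF C a inv, of S] that by simp
  qed
  from H.small_of_product_quotient_cards[OF this, of b] b iH
  show "C \<subseteq> {\<one>, b, b \<otimes> b, inv b, inv (b \<otimes> b)}"
    and "b \<otimes> b \<otimes> b = \<one> \<or> b \<otimes> b \<otimes> b \<otimes> b = \<one> \<or> b \<otimes> b \<otimes> b \<otimes> b \<otimes> b = \<one>"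
    by simp_all
qed

text \<open>
  The element \<open>tw\<close> is an involution, and \<open>(ht)^2 = h^2\<close>. So \<open>tw\<close> conjugates \<open>ht\<close> to \<open>ht\<close> or to its
  inverse \<open>h^-1 t\<close>. The conjugate is \<open>h^-1 w^-2 t\<close>. In the first case \<open>w^-2 = h^2\<close>, which turns
  \<open>w h = h^-1 w\<close> into \<open>h w^-1 = w h\<close>; the second case is excluded by \<open>w^2 \<noteq> \<one>\<close>.
\<close>

lemma inverting_is_mutual:
  assumes t: "t \<in> carrier G" "t \<otimes> t = \<one>" and w: "w \<in> carrier G" "w \<otimes> w \<noteq> \<one>" "t \<otimes> w = inv w \<otimes> t"
    and h: "h \<in> carrier G" "h \<otimes> h \<noteq> \<one>" "t \<otimes> h = h \<otimes> t" "w \<otimes> h = inv h \<otimes> w"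
  shows "h \<otimes> inv w = w \<otimes> h"
proof -
  have it: "inv t = t" using t by (simp add: inv_equality)
  note tiw = invertsD(1)[OF w(3) t(1) w(1)] and wh = invertsD[OF h(4) w(1) h(1)]
  have tih: "t \<otimes> inv h = inv h \<otimes> t"
    using t h by (metis inv_mult_group it)
  have rules: "t \<otimes> (w \<otimes> x) = inv w \<otimes> (t \<otimes> x)" "t \<otimes> (inv w \<otimes> x) = w \<otimes> (t \<otimes> x)"
     "t \<otimes> (h \<otimes> x) = h \<otimes> (t \<otimes> x)" "t \<otimes> (inv h \<otimes> x) = inv h \<otimes> (t \<otimes> x)"
     "t \<otimes> (t \<otimes> x) = x" "w \<otimes> (h \<otimes> x) = inv h \<otimes> (w \<otimes> x)"
     "inv w \<otimes> (h \<otimes> x) = inv h \<otimes> (inv w \<otimes> x)" if "x \<in> carrier G" for x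
    using assoc_rewrite[OF w(3)] assoc_rewrite[OF tiw] assoc_rewrite[OF h(3)] assoc_rewrite[OF tih]
      assoc_rewrite[OF t(2)] assoc_rewrite[OF h(4)] assoc_rewrite[OF wh(2)] t w(1) h(1) that by (simp_all add: m_assoc)
  have 1: "(t \<otimes> w) \<otimes> (t \<otimes> w) = \<one>" using t w(1,3) by (simp add: m_assoc rules inv_mult_cancel)
  have 2: "(h \<otimes> t) \<otimes> (h \<otimes> t) = h \<otimes> h" using t h(1,3) by (simp add: m_assoc rules inv_mult_cancel)
  have 3: "(t \<otimes> w) \<otimes> (h \<otimes> t) \<otimes> (t \<otimes> w) = inv h \<otimes> (inv w \<otimes> inv w) \<otimes> t"
    using t w(1,3) h(1,3,4) wh(2) by (simp add: m_assoc rules inv_mult_cancel)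
  have 4: "inv (h \<otimes> t) = inv h \<otimes> t" using t h(1) tih it by (simp add: inv_mult_group)
  have "inv h \<otimes> (inv w \<otimes> inv w) \<otimes> t = h \<otimes> t \<or> inv h \<otimes> (inv w \<otimes> inv w) \<otimes> t = inv h \<otimes> t"
    using involution_acts_by_sign[OF _ 1, of "h \<otimes> t"] 2 3 4 t w(1) h(1,2) by simp
  then have "inv h \<otimes> (inv w \<otimes> inv w) = h \<or> inv h \<otimes> (inv w \<otimes> inv w) = inv h"
    using t w(1) h(1) by simp
  then show ?thesis
  proof
    assume *: "inv h \<otimes> (inv w \<otimes> inv w) = h"
    have "h \<otimes> h = inv w \<otimes> inv w"
    proof -
      have "h \<otimes> (inv h \<otimes> (inv w \<otimes> inv w)) = h \<otimes> h" using * by simp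
      then show ?thesis using w(1) h(1) by (simp add: inv_mult_cancel)
    qed
    have "h \<otimes> inv w = inv w \<otimes> inv h"
      using invertsD(1)[of "inv w" h] wh(2) w(1) h(1) by simp
    also have "inv w \<otimes> inv h = w \<otimes> (inv w \<otimes> inv w) \<otimes> inv h" using w(1) h(1) by (simp add: word_simps)
    also have "\<dots> = w \<otimes> h" unfolding \<open>h \<otimes> h = inv w \<otimes> inv w\<close>[symmetric] using w(1) h(1) by (simp add: word_simps)
    finally show ?thesis .
  next
    assume "inv h \<otimes> (inv w \<otimes> inv w) = inv h"
    then have "inv w \<otimes> inv w = \<one>" using w(1) h(1) by simp
    then have "inv (w \<otimes> w) = \<one>" using w(1) by (simp add: inv_mult_group)
    then show ?thesis using w by simp
  qed
qed

text \<open>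
  If \<open>h^2 = \<one>\<close>, this is \<open>involution_acts_by_sign\<close>. Otherwise \<open>a\<close> and \<open>ab\<close> are involutions, and \<open>b\<close>
  is their product. Each of them sends \<open>h\<close> to \<open>h\<close>
  or \<open>h^-1\<close>, so \<open>b\<close> does as well. If \<open>b\<close> inverts \<open>h\<close>, then one of the two involutions commutes with
  \<open>h\<close>, and \<open>inverting_is_mutual\<close> shows that \<open>h\<close> inverts \<open>b\<close>.
\<close>

lemma inverted_element_normal:
  assumes a: "a \<in> carrier G" "a \<otimes> a = \<one>" and b: "b \<in> carrier G" "b \<otimes> b \<noteq> \<one>" "a \<otimes> b = inv b \<otimes> a"
    and h: "h \<in> carrier G"
  shows "h \<otimes> b = b \<otimes> h \<or> h \<otimes> b = inv b \<otimes> h"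
proof (cases "h \<otimes> h = \<one>")
  case True
  then have "h \<otimes> b \<otimes> h = b \<or> h \<otimes> b \<otimes> h = inv b" using involution_acts_by_sign[OF h True b(1,2)] by simp
  moreover have "inv h = h" using h True by (simp add: inv_equality)
  ultimately show ?thesis using conj_eq_iff[of h b] h b by auto
next
  case hh: False
  have ia: "inv a = a" using a by (simp add: inv_equality)
  have rules: "a \<otimes> (b \<otimes> x) = inv b \<otimes> (a \<otimes> x)" "a \<otimes> (a \<otimes> x) = x" "a \<otimes> (inv b \<otimes> x) = b \<otimes> (a \<otimes> x)" if "x \<in> carrier G" for x
    using assoc_rewrite[OF b(3)] assoc_rewrite[OF invertsD(1)[OF b(3) a(1) b(1)]] assoc_rewrite[OF a(2)] a b(1) that by (simp_all add: m_assoc)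
  have ab: "(a \<otimes> b) \<otimes> (a \<otimes> b) = \<one>" using a b(1,3) by (simp add: m_assoc rules inv_mult_cancel)
  have iab: "inv (a \<otimes> b) = a \<otimes> b" using a b(1) ab by (simp add: inv_equality)
  have s1: "a \<otimes> h \<otimes> a = h \<or> a \<otimes> h \<otimes> a = inv h" using involution_acts_by_sign[OF a h hh] .
  have s2: "(a \<otimes> b) \<otimes> h \<otimes> (a \<otimes> b) = h \<or> (a \<otimes> b) \<otimes> h \<otimes> (a \<otimes> b) = inv h"
    using involution_acts_by_sign[OF _ ab h hh] a b(1) by simp
  have flip: "a \<otimes> inv h \<otimes> a = inv (a \<otimes> h \<otimes> a)" using a h by (simp add: word_simps ia)
  have bh: "b \<otimes> h \<otimes> inv b = a \<otimes> ((a \<otimes> b) \<otimes> h \<otimes> inv (a \<otimes> b)) \<otimes> a"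
    using a b(1) h by (simp add: word_simps ia rules)
  have aa: "a \<otimes> x = y \<otimes> a" if "a \<otimes> x \<otimes> a = y" "x \<in> carrier G" "y \<in> carrier G" for x y
    using conj_eq_iff[of a x y] that a ia by simp
  have aba: "a \<otimes> b \<otimes> x = y \<otimes> (a \<otimes> b)" if "a \<otimes> b \<otimes> x \<otimes> (a \<otimes> b) = y" "x \<in> carrier G" "y \<in> carrier G" for x y
    using conj_eq_iff[of "a \<otimes> b" x y] that a b(1) iab by simp
  consider (c) "b \<otimes> h \<otimes> inv b = h" | (i1) "b \<otimes> h \<otimes> inv b = inv h" "a \<otimes> h \<otimes> a = h"
    | (i2) "b \<otimes> h \<otimes> inv b = inv h" "(a \<otimes> b) \<otimes> h \<otimes> (a \<otimes> b) = h"
    using s1 s2 bh flip h unfolding iab by (metis inv_inv)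
  then show ?thesis
  proof cases
    case c then show ?thesis using conj_eq_iff[of b h h] b h by simp
  next
    case i1
    have "h \<otimes> inv b = b \<otimes> h"
    proof (rule inverting_is_mutual[OF a b h hh])
      show "a \<otimes> h = h \<otimes> a" using aa[OF i1(2) h h] .
      show "b \<otimes> h = inv h \<otimes> b" using i1(1) conj_eq_iff[of b h "inv h"] b h by simp
    qed
    then have "h \<otimes> b = inv b \<otimes> h" using h b(1) by (metis inv_closed inv_solve_left inv_solve_right m_assoc m_closed)
    then show ?thesis by simp
  next
    case i2
    have "h \<otimes> inv (inv b) = inv b \<otimes> h"
    proof (rule inverting_is_mutual[OF _ ab _ _ _ h hh])
      show "inv b \<otimes> inv b \<noteq> \<one>" using b by (metis inv_eq_1_iff inv_mult_group m_closed)
      show "a \<otimes> b \<otimes> inv b = inv (inv b) \<otimes> (a \<otimes> b)" using a b invertsD(1)[OF b(3) a(1) b(1)] by (simp add: word_simps)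
      show "a \<otimes> b \<otimes> h = h \<otimes> (a \<otimes> b)" using aba[OF i2(2) h h] .
      have "b \<otimes> h = inv h \<otimes> b" using i2(1) conj_eq_iff[of b h "inv h"] b h by simp
      then show "inv b \<otimes> h = inv h \<otimes> inv b"
        using h b(1) by (metis inv_closed inv_solve_left inv_solve_right m_assoc m_closed)
    qed (use a b in auto)
    then show ?thesis using b by simp
  qed
qed

end

section \<open>Groups with a noncentral involution\<close>

context balanced_group begin

text \<open>
  Here \<open>a\<close> and \<open>b\<close> generate a dihedral group of order eight, and \<open>ub\<close> is an element of order four
  that commutes with \<open>a\<close> and \<open>b\<close>. The three elements generate a central product of order 16. It is
  excluded by the coset test for \<open>S = {\<one>, b, u}\<close>, the element \<open>a\<close> and the centralizer \<open>K\<close> of \<open>b\<close> and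
  \<open>u\<close>: an element \<open>ka\<close> as produced by the test would need \<open>k\<close>, \<open>k b^-1\<close> and \<open>k u b^2\<close> all in \<open>S\<close>.
\<close>

lemma no_central_product_C4_D8:
  assumes a: "a \<in> carrier G" "a \<otimes> a = \<one>" and b: "b \<in> carrier G" "b \<otimes> b \<noteq> \<one>" "a \<otimes> b = inv b \<otimes> a"
    and b4: "(b \<otimes> b) \<otimes> (b \<otimes> b) = \<one>"
    and u: "u \<in> carrier G" "u \<otimes> u = \<one>" "u \<otimes> b = b \<otimes> u" "a \<otimes> u = u \<otimes> (b \<otimes> b) \<otimes> a"
  shows False
proof -
  have ia: "inv a = a" using a by (simp add: inv_equality)
  define z where "z = b \<otimes> b"
  have zc: "z \<in> carrier G" using b by (simp add: z_def)
  have zz: "z \<otimes> z = \<one>" using b4 by (simp add: z_def)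
  have z1: "z \<noteq> \<one>" using b by (simp add: z_def)
  have ib: "inv b = z \<otimes> b"
  proof (rule inv_equality)
    show "z \<otimes> b \<otimes> b = \<one>" using b4 b(1) by (simp add: z_def m_assoc)
  qed (use b zc in auto)
  have zb: "z \<otimes> b = b \<otimes> z" using b by (simp add: z_def m_assoc)
  note ab = invertsD(1)[OF b(3) a(1) b(1)]
  have au: "a \<otimes> u = u \<otimes> z \<otimes> a" using u(4) by (simp add: z_def)
  have ub: "u \<noteq> b" using u(2) b(2) by metis
  have uz': "u \<noteq> z"
  proof
    assume "u = z"
    then have "a \<otimes> u = a" using au zz a by simp
    then show False using a u \<open>u = z\<close> z1 by simp
  qed
  have u1: "u \<noteq> \<one>" using au z1 a zc by auto
  have uib: "u \<noteq> inv b"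
  proof
    assume "u = inv b"
    then have "inv (b \<otimes> b) = \<one>" using u(2) b(1) by (simp add: inv_mult_group)
    then show False using b by simp
  qed
  have b1: "b \<noteq> \<one>" using b by auto
  have bib: "b \<noteq> inv b" using b by (metis r_inv)
  have bz: "b \<noteq> z" using b1 b(1) by (auto simp: z_def)
  have ibz: "inv b \<noteq> z" using b1 b(1) zc by (simp add: ib)
  have ib1: "inv b \<noteq> \<one>" using b1 b(1) by simp
  define K where "K = centralizer {b, u}"
  have K: "subgroup K G" unfolding K_def using b u by (intro subgroup_centralizer) auto
  interpret K: subgroup K G by fact
  have Kiff: "k \<in> K \<longleftrightarrow> k \<in> carrier G \<and> k \<otimes> b = b \<otimes> k \<and> k \<otimes> u = u \<otimes> k" for k
    unfolding K_def in_centralizer_iff by blast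
  have mem: "b \<in> K" "u \<in> K" unfolding Kiff using b u by simp_all
  have zK: "z \<in> K" unfolding z_def using mem by (intro K.m_closed)
  have aK: "a \<notin> K"
    unfolding Kiff using b(3) bib a b(1) by (metis right_cancel inv_closed)
  have nrm: "a \<otimes> k \<otimes> inv a \<in> K" if "k \<in> K" for k
  proof -
    have k: "k \<in> carrier G" "k \<otimes> b = b \<otimes> k" "k \<otimes> u = u \<otimes> k" using that unfolding Kiff by simp_all
    have kz: "k \<otimes> z = z \<otimes> k" using k b(1) by (metis m_assoc z_def)
    have "inv a \<otimes> b \<otimes> a = inv b" using b a by (simp add: ia m_assoc)
    moreover have "inv a \<otimes> u \<otimes> a = u \<otimes> z" using a u(1) zc by (simp add: ia au m_assoc)
    moreover have "k \<otimes> inv b = inv b \<otimes> k" by (rule commutes_inv[OF k(1) b(1) k(2)])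
    moreover have "k \<otimes> (u \<otimes> z) = (u \<otimes> z) \<otimes> k" using k kz u(1) zc by (metis m_assoc)
    ultimately have "k \<otimes> (inv a \<otimes> w \<otimes> a) = (inv a \<otimes> w \<otimes> a) \<otimes> k" if "w \<in> {b, u}" for w
      using that by (elim insertE emptyE) simp_all
    then show ?thesis
      using conj_in_centralizer[of "{b, u}" a k] that a(1) b(1) u(1) unfolding K_def by blast
  qed
  \<comment> \<open>\<open>b\<close> and \<open>u\<close> generate eight elements of \<open>K\<close>, and \<open>Sa = Sa^-1\<close> has only three\<close>
  let ?B = "[\<one>, b, z, inv b]"
  have B: "x \<in> carrier G" if "x \<in> set ?B" for x using that b zc by auto
  have dB: "distinct ?B" using b1 z1 bib bz ibz ib1 by auto
  have cross: "u \<otimes> x \<noteq> y" if "x \<in> set ?B" "y \<in> set ?B" for x y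
  proof
    assume "u \<otimes> x = y"
    then have "u = y \<otimes> inv x" using u(1) B that by (metis inv_solve_right)
    moreover have "y \<otimes> inv x \<in> set ?B"
    proof -
      have iz: "inv z = z" using zz zc by (simp add: inv_equality)
      have m: "b \<otimes> z = inv b" "z \<otimes> b = inv b" "b \<otimes> b = z" using ib zb by (simp_all add: z_def)
      have "z \<otimes> inv b = b" using assoc_rewrite[OF zz zc zc b(1)] b(1) by (simp add: ib)
      moreover then have "inv b \<otimes> z = b" using b(1) zc zb by (metis ib m_assoc)
      moreover have "inv b \<otimes> inv b = z" using iz b(1) by (simp add: z_def inv_mult_group)
      ultimately have m2: "z \<otimes> inv b = b" "inv b \<otimes> z = b" "inv b \<otimes> inv b = z" by blast+
      show ?thesis using that b zc by (auto simp: iz m m2 zz)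
    qed
    ultimately show False using u1 ub uz' uib by auto
  qed
  have dU: "distinct (map ((\<otimes>) u) ?B)"
    unfolding distinct_map
  proof (intro conjI inj_onI dB)
    fix x y assume "x \<in> set ?B" "y \<in> set ?B" "u \<otimes> x = u \<otimes> y"
    then show "x = y" using u(1) B by (metis Units_eq Units_l_cancel)
  qed
  have "distinct (?B @ map ((\<otimes>) u) ?B)"
    using dB dU cross by (simp only: distinct_append set_map) blast
  then have "card (set (?B @ map ((\<otimes>) u) ?B)) = 8" by (subst distinct_card) simp_all
  moreover have "set (?B @ map ((\<otimes>) u) ?B) \<subseteq> K"
    using mem zK by (auto intro: K.m_closed K.m_inv_closed)
  moreover have "finite K" using K.subset finite_subset_carrier by blast
  ultimately have cK: "8 \<le> card K" by (metis card_mono)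
  let ?S = "{\<one>, b, u}"
  let ?X = "(\<lambda>s. s \<otimes> a) ` ?S \<union> (\<lambda>s. s \<otimes> inv a) ` ?S"
  have X: "?X \<subseteq> set [a, b \<otimes> a, u \<otimes> a]" using a by (auto simp: ia)
  have "card (?X \<inter> (\<lambda>k. k \<otimes> a) ` K) \<le> card (set [a, b \<otimes> a, u \<otimes> a])"
    using X by (intro card_mono) auto
  also have "\<dots> \<le> 3" by (rule order_trans[OF card_length]) simp
  finally have "2 * card (?X \<inter> (\<lambda>k. k \<otimes> a) ` K) < card K" using cK by linarith
  moreover have "?S \<subseteq> K" using mem by simp
  ultimately have "\<exists>v \<in> (\<lambda>k. k \<otimes> a) ` K. \<forall>s\<in>?S. v \<otimes> s \<in> ?X"
    using coset_test[OF K a(1) aK nrm conj_closed_inv[OF K.subset a(1) nrm], of ?S] by blast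
  then obtain v where v: "v \<in> (\<lambda>k. k \<otimes> a) ` K" and vs: "\<forall>s\<in>?S. v \<otimes> s \<in> ?X" by (rule bexE)
  obtain k where k: "k \<in> K" "v = k \<otimes> a" using v by (rule imageE)
  have kc: "k \<in> carrier G" using k by simp
  have red: "y \<in> {\<one>, b, u}" if "y \<otimes> a \<in> ?X" "y \<in> carrier G" for y
  proof -
    have "y \<otimes> a \<in> set [a, b \<otimes> a, u \<otimes> a]" using that X by blast
    then have "y \<otimes> a = \<one> \<otimes> a \<or> y \<otimes> a = b \<otimes> a \<or> y \<otimes> a = u \<otimes> a" using a by simp
    then show ?thesis using that(2) a b(1) u(1) by simp
  qed
  have "v \<otimes> \<one> = k \<otimes> a" "v \<otimes> b = (k \<otimes> inv b) \<otimes> a" "v \<otimes> u = (k \<otimes> (u \<otimes> z)) \<otimes> a"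
    unfolding k(2) using a b(1,3) u(1) zc kc au by (simp_all add: m_assoc)
  then have "k \<otimes> a \<in> ?X" "(k \<otimes> inv b) \<otimes> a \<in> ?X" "(k \<otimes> (u \<otimes> z)) \<otimes> a \<in> ?X"
    using vs by (metis insertCI)+
  then have r: "k \<in> {\<one>, b, u}" "k \<otimes> inv b \<in> {\<one>, b, u}" "k \<otimes> (u \<otimes> z) \<in> {\<one>, b, u}"
    using red kc b(1) u(1) zc by (metis inv_closed m_closed)+
  consider "k = \<one>" | "k = b" | "k = u" using r(1) by blast
  then show False
  proof cases
    case 1
    then show False using r(2) ib1 bib uib b(1) by auto
  next
    case 2
    have "b \<otimes> (u \<otimes> z) = u \<otimes> inv b" using b(1) u(1) zc u(3) zb by (metis ib m_assoc)
    then have "u \<otimes> inv b \<in> {\<one>, b, u}" using r(3) 2 by simp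
    then show False using cross[of "inv b" \<one>] cross[of "inv b" b] ib1 u(1) b(1) by auto
  next
    case 3
    then show False using r(2) cross[of "inv b" \<one>] cross[of "inv b" b] ib1 u(1) b(1) by auto
  qed
qed

text \<open>
  Suppose that \<open>a\<close> fixes some \<open>c\<close> with \<open>c^2 \<noteq> \<one>\<close> that commutes with \<open>b\<close>. Then \<open>a\<close> neither fixes nor
  inverts \<open>c b\<close> and \<open>c b^-1\<close>, so both are involutions. This gives \<open>c^2 = b^-2\<close> and \<open>b^4 = \<one>\<close>, and \<open>cb\<close>
  contradicts \<open>no_central_product_C4_D8\<close>. If \<open>c^2 = \<one>\<close>, the argument for \<open>cb\<close> gives the claim for
  \<open>c\<close>.
\<close>

lemma inverts_centralizer:
  assumes a: "a \<in> carrier G" "a \<otimes> a = \<one>" and b: "b \<in> carrier G" "b \<otimes> b \<noteq> \<one>" "a \<otimes> b = inv b \<otimes> a"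
    and c: "c \<in> carrier G" "c \<otimes> b = b \<otimes> c"
  shows "a \<otimes> c \<otimes> a = inv c"
proof -
  have ia: "inv a = a" using a by (simp add: inv_equality)
  note ab = invertsD(1)[OF b(3) a(1) b(1)]
  have main: "a \<otimes> c \<otimes> a = inv c" if c: "c \<in> carrier G" "c \<otimes> b = b \<otimes> c" "c \<otimes> c \<noteq> \<one>" for c
  proof (rule ccontr)
    assume neg: "a \<otimes> c \<otimes> a \<noteq> inv c"
    then have ac': "a \<otimes> c \<otimes> a = c" using involution_acts_by_sign[OF a c(1,3)] by blast
    have cic: "c \<noteq> inv c" using c by (metis r_inv)
    have ac: "a \<otimes> c = c \<otimes> a" using ac' conj_eq_iff[of a c c] a c ia by simp
    have sq: "(c \<otimes> d) \<otimes> (c \<otimes> d) = \<one>"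
      if d: "d \<in> carrier G" "d \<noteq> inv d" "c \<otimes> d = d \<otimes> c" "a \<otimes> d = inv d \<otimes> a" for d
    proof (rule ccontr)
      assume n: "(c \<otimes> d) \<otimes> (c \<otimes> d) \<noteq> \<one>"
      have "a \<otimes> (c \<otimes> d) \<otimes> a = c \<otimes> (a \<otimes> d) \<otimes> a" using a c(1) d(1) assoc_rewrite[OF ac a(1) c(1)] by (simp add: m_assoc)
      also have "\<dots> = c \<otimes> inv d" unfolding d(4) using a c(1) d(1) by (simp add: m_assoc)
      finally have e: "a \<otimes> (c \<otimes> d) \<otimes> a = c \<otimes> inv d" .
      have "c \<otimes> inv d = c \<otimes> d \<or> c \<otimes> inv d = inv (c \<otimes> d)"
        using involution_acts_by_sign[OF a _ n] e c(1) d(1) by simp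
      then show False
      proof
        assume "c \<otimes> inv d = c \<otimes> d" then show False using c(1) d(1,2) by simp
      next
        assume "c \<otimes> inv d = inv (c \<otimes> d)"
        also have "\<dots> = inv c \<otimes> inv d" unfolding d(3) using c(1) d(1) by (simp add: inv_mult_group)
        finally show False using c(1) d(1) cic by simp
      qed
    qed
    have bi: "b \<noteq> inv b" using b by (metis r_inv)
    have cib: "c \<otimes> inv b = inv b \<otimes> c" using c(1,2) b(1) by (metis inv_closed inv_solve_left inv_solve_right m_assoc m_closed)
    have s1: "(c \<otimes> b) \<otimes> (c \<otimes> b) = \<one>" using sq[OF b(1) bi c(2) b(3)] .
    have s2: "(c \<otimes> inv b) \<otimes> (c \<otimes> inv b) = \<one>" using sq[of "inv b"] bi cib ab b(1) by simp
    have "(c \<otimes> b) \<otimes> (c \<otimes> b) = (c \<otimes> c) \<otimes> (b \<otimes> b)"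
      using c(1) b(1) assoc_rewrite[OF c(2)[symmetric] b(1) c(1)] by (simp add: m_assoc)
    then have cc: "inv (b \<otimes> b) = c \<otimes> c" using s1 c(1) b(1) by (simp add: inv_equality)
    have "(c \<otimes> inv b) \<otimes> (c \<otimes> inv b) = (c \<otimes> c) \<otimes> inv (b \<otimes> b)"
      using c(1) b(1) assoc_rewrite[OF cib[symmetric] inv_closed[OF b(1)] c(1)] by (simp add: m_assoc inv_mult_group)
    then have "inv (b \<otimes> b) \<otimes> inv (b \<otimes> b) = \<one>" using s2 cc by simp
    then have "inv ((b \<otimes> b) \<otimes> (b \<otimes> b)) = \<one>" using b(1) by (simp only: inv_mult_group m_closed)
    then have b4: "(b \<otimes> b) \<otimes> (b \<otimes> b) = \<one>" using b(1) by simp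
    show False
    proof (rule no_central_product_C4_D8[OF a b b4])
      show "c \<otimes> b \<in> carrier G" using c b by simp
      show "(c \<otimes> b) \<otimes> (c \<otimes> b) = \<one>" by (rule s1)
      show "c \<otimes> b \<otimes> b = b \<otimes> (c \<otimes> b)" using c b(1) by (metis m_assoc)
      have "inv b = b \<otimes> (b \<otimes> b)" using b4 b(1) by (intro inv_equality) (simp_all add: m_assoc)
      then have "c \<otimes> inv b \<otimes> a = c \<otimes> b \<otimes> (b \<otimes> b) \<otimes> a" using a b(1) c(1) by (simp add: m_assoc)
      moreover have "a \<otimes> (c \<otimes> b) = c \<otimes> inv b \<otimes> a"
        using a b(1,3) c(1) assoc_rewrite[OF ac a(1) c(1)] by (simp add: m_assoc)
      ultimately show "a \<otimes> (c \<otimes> b) = c \<otimes> b \<otimes> (b \<otimes> b) \<otimes> a" by simp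
    qed
  qed
  show ?thesis
  proof (cases "c \<otimes> c = \<one>")
    case False then show ?thesis using main c by blast
  next
    case True
    have "(c \<otimes> b) \<otimes> (c \<otimes> b) = (c \<otimes> c) \<otimes> (b \<otimes> b)"
      using c(1) b(1) assoc_rewrite[OF c(2)[symmetric] b(1) c(1)] by (simp add: m_assoc)
    then have n: "(c \<otimes> b) \<otimes> (c \<otimes> b) \<noteq> \<one>" using True b by simp
    have "c \<otimes> b \<otimes> b = b \<otimes> (c \<otimes> b)" using c b(1) by (metis m_assoc)
    then have m: "a \<otimes> (c \<otimes> b) \<otimes> a = inv (c \<otimes> b)" using main[of "c \<otimes> b"] n c b by simp
    have "a \<otimes> (c \<otimes> b) \<otimes> a = (a \<otimes> c \<otimes> a) \<otimes> (a \<otimes> b \<otimes> a)" using conj_mult[of a c b] a b(1) c(1) ia by simp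
    also have "a \<otimes> b \<otimes> a = inv b" unfolding b(3) using a b(1) by (simp add: m_assoc)
    finally have "(a \<otimes> c \<otimes> a) \<otimes> inv b = inv c \<otimes> inv b"
      using m unfolding c(2) using b(1) c(1) by (simp add: inv_mult_group)
    then show ?thesis using a b(1) c(1) by simp
  qed
qed

text \<open>
  The involution \<open>a\<close> inverts some \<open>b\<close> with \<open>b^2 \<noteq> \<one>\<close>, namely \<open>g\<close> or, if \<open>g\<close> is an involution, \<open>ag\<close>.
  Its centralizer \<open>C\<close> is inverted by \<open>a\<close>, and every element of the group either fixes or inverts \<open>b\<close>,
  so \<open>C\<close> and \<open>Ca\<close> cover the group. Finally \<open>C\<close> is small by \<open>inverted_subgroup_small\<close>.
\<close>

theorem noncentral_involution_dihedral:
  assumes a: "a \<in> carrier G" "a \<otimes> a = \<one>" and g: "g \<in> carrier G" "a \<otimes> g \<noteq> g \<otimes> a"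
  obtains b where "b \<in> carrier G" "b \<otimes> b \<noteq> \<one>" "a \<otimes> b = inv b \<otimes> a"
    "b \<otimes> b \<otimes> b = \<one> \<or> b \<otimes> b \<otimes> b \<otimes> b = \<one> \<or> b \<otimes> b \<otimes> b \<otimes> b \<otimes> b = \<one>"
    "\<And>x. x \<in> carrier G \<Longrightarrow> x \<in> {\<one>, b, b \<otimes> b, inv b, inv (b \<otimes> b)} \<or>
      x \<otimes> a \<in> {\<one>, b, b \<otimes> b, inv b, inv (b \<otimes> b)}"
proof -
  have ia: "inv a = a" using a by (simp add: inv_equality)
  have "\<exists>b\<in>carrier G. b \<otimes> b \<noteq> \<one> \<and> a \<otimes> b = inv b \<otimes> a"
  proof (cases "g \<otimes> g = \<one>")
    case True
    then have ig: "inv g = g" using g by (simp add: inv_equality)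
    have "(a \<otimes> g) \<otimes> (a \<otimes> g) \<noteq> \<one>"
    proof
      assume "(a \<otimes> g) \<otimes> (a \<otimes> g) = \<one>"
      then have "inv (a \<otimes> g) = a \<otimes> g" using a g by (simp add: inv_equality)
      then show False using a g by (simp add: inv_mult_group ia ig)
    qed
    moreover have "a \<otimes> (a \<otimes> g) = inv (a \<otimes> g) \<otimes> a"
      using a g assoc_rewrite[OF a(2) a(1) a(1)] by (simp add: word_simps ia ig flip: m_assoc) (simp add: m_assoc a)
    ultimately show ?thesis using a g by blast
  next
    case False
    have "a \<otimes> g \<otimes> a \<noteq> g" using conj_eq_iff[of a g g] a g ia by simp
    then have "a \<otimes> g \<otimes> a = inv g" using involution_acts_by_sign[OF a g(1) False] by blast
    then have "a \<otimes> g = inv g \<otimes> a" using conj_eq_iff[of a g "inv g"] a g ia by simp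
    then show ?thesis using g False by blast
  qed
  then obtain b where b: "b \<in> carrier G" "b \<otimes> b \<noteq> \<one>" "a \<otimes> b = inv b \<otimes> a" by blast
  note ab = invertsD(1)[OF b(3) a(1) b(1)]
  have bi: "b \<noteq> inv b" using b by (metis r_inv)
  define C where "C = centralizer {b}"
  have C: "subgroup C G" unfolding C_def using b by (intro subgroup_centralizer) auto
  have Ciff: "x \<in> C \<longleftrightarrow> x \<in> carrier G \<and> x \<otimes> b = b \<otimes> x" for x
    unfolding C_def in_centralizer_iff by simp
  have aC: "a \<notin> C" unfolding Ciff using a b(1,3) bi by (metis right_cancel inv_closed)
  have bC: "b \<in> C" unfolding Ciff using b by simp
  have inv: "a \<otimes> c \<otimes> a = inv c" if "c \<in> C" for c
    using inverts_centralizer[OF a b] that unfolding Ciff by blast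
  have cov: "x \<in> C \<or> x \<otimes> a \<in> C" if x: "x \<in> carrier G" for x
  proof -
    have "x \<otimes> a \<otimes> b = b \<otimes> (x \<otimes> a)" if h: "x \<otimes> b = inv b \<otimes> x"
      using invertsD(1)[OF h x b(1)] assoc_rewrite[OF invertsD(1)[OF h x b(1)]] x a(1) b(1,3)
      by (simp add: m_assoc)
    then show ?thesis using inverted_element_normal[OF a b x] x a(1) unfolding Ciff by auto
  qed
  note small = inverted_subgroup_small[OF C a(1) aC a(2) inv bC b(2)]
  show thesis
  proof (rule that[OF b small(2)])
    fix x assume "x \<in> carrier G"
    from cov[OF this] show "x \<in> {\<one>, b, b \<otimes> b, inv b, inv (b \<otimes> b)} \<or>
      x \<otimes> a \<in> {\<one>, b, b \<otimes> b, inv b, inv (b \<otimes> b)}"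
      using subsetD[OF small(1)] by blast
  qed
qed

end

section \<open>Quotients, and non-normal cyclic subgroups of order four\<close>

context group begin

lemma FactGroup_inv_mult_mem:
  assumes N: "N \<lhd> G" and X: "X \<in> carrier (G Mod N)" and Y: "Y \<in> carrier (G Mod N)"
  shows "X \<otimes>\<^bsub>G Mod N\<^esub> inv\<^bsub>G Mod N\<^esub> Y = {x \<otimes> inv y | x y. x \<in> X \<and> y \<in> Y}"
    and "inv\<^bsub>G Mod N\<^esub> X \<otimes>\<^bsub>G Mod N\<^esub> Y = {inv x \<otimes> y | x y. x \<in> X \<and> y \<in> Y}"
proof -
  interpret normal N G by fact
  show "X \<otimes>\<^bsub>G Mod N\<^esub> inv\<^bsub>G Mod N\<^esub> Y = {x \<otimes> inv y | x y. x \<in> X \<and> y \<in> Y}"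
    using inv_FactGroup[OF Y] by (simp add: set_mult_def SET_INV_def) blast
  show "inv\<^bsub>G Mod N\<^esub> X \<otimes>\<^bsub>G Mod N\<^esub> Y = {inv x \<otimes> y | x y. x \<in> X \<and> y \<in> Y}"
    using inv_FactGroup[OF X] by (simp add: set_mult_def SET_INV_def) blast
qed

end

context balanced_group begin

lemma card_Union_rcosets:
  assumes N: "subgroup N G" and X: "X \<subseteq> rcosets N"
  shows "card (\<Union>X) = card N * card X"
proof -
  have U: "\<Union>X \<subseteq> carrier G" using X rcosets_part_G[OF N] by blast
  have fX: "finite X" using X U finite_subset_carrier
    by (meson finite_UnionD)
  have "card N * card X = card (\<Union>X)"
  proof (rule card_partition[OF fX])
    show "finite (\<Union>X)" using U by (rule finite_subset_carrier)
    show "card c = card N" if "c \<in> X" for c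
      using card_cosets_equal[of c N] X that subgroup.subset[OF N] by (metis subsetD card_rcosets_equal)
    show "c \<inter> d = {}" if "c \<in> X" "d \<in> X" "c \<noteq> d" for c d
      using rcos_disjoint[OF N] X that by (auto simp: pairwise_def disjnt_def subset_iff)
  qed
  then show ?thesis by simp
qed

text \<open>
  The preimages of the quotient sets of \<open>A\<close> are the quotient sets of the preimage of \<open>A\<close>, and taking
  preimages multiplies cardinalities by the order of \<open>N\<close>.
\<close>

lemma balanced_FactGroup:
  assumes N: "N \<lhd> G"
  shows "balanced (G Mod N)"
  unfolding balanced_def
proof (intro conjI allI impI)
  interpret N: normal N G by fact
  let ?F = "G Mod N"
  show gF: "group ?F" by (rule N.factorgroup_is_group)
  interpret F: group ?F by fact
  show "finite (carrier ?F)" by (simp add: carrier_FactGroup)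
  fix A assume A: "A \<subseteq> carrier ?F"
  have cF: "carrier ?F = rcosets N" by (simp add: FactGroup_def)
  have sub: "subgroup N G" by (rule N.subgroup_axioms)
  have UA: "\<Union>A \<subseteq> carrier G" using A rcosets_part_G[OF sub] cF by blast
  define P where "P = {a \<otimes>\<^bsub>?F\<^esub> inv\<^bsub>?F\<^esub> b | a b. a \<in> A \<and> b \<in> A}"
  define Q where "Q = {inv\<^bsub>?F\<^esub> a \<otimes>\<^bsub>?F\<^esub> b | a b. a \<in> A \<and> b \<in> A}"
  have PQ: "P \<subseteq> rcosets N" "Q \<subseteq> rcosets N"
    using A unfolding P_def Q_def cF[symmetric] by (auto simp del: mult_FactGroup intro!: F.m_closed F.inv_closed)
  have "\<Union>P = {x \<otimes> inv y | x y. x \<in> \<Union>A \<and> y \<in> \<Union>A}"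
  proof (intro subset_antisym subsetI)
    fix p assume "p \<in> \<Union>P"
    then obtain X Y where "X \<in> A" "Y \<in> A" "p \<in> X \<otimes>\<^bsub>?F\<^esub> inv\<^bsub>?F\<^esub> Y" unfolding P_def by blast
    then show "p \<in> {x \<otimes> inv y | x y. x \<in> \<Union>A \<and> y \<in> \<Union>A}"
      using FactGroup_inv_mult_mem(1)[OF N, of X Y] A by blast
  next
    fix p assume "p \<in> {x \<otimes> inv y | x y. x \<in> \<Union>A \<and> y \<in> \<Union>A}"
    then obtain X Y x y where XY: "X \<in> A" "Y \<in> A" "x \<in> X" "y \<in> Y" "p = x \<otimes> inv y" by blast
    then have "p \<in> X \<otimes>\<^bsub>?F\<^esub> inv\<^bsub>?F\<^esub> Y" using FactGroup_inv_mult_mem(1)[OF N, of X Y] A by blast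
    then show "p \<in> \<Union>P" unfolding P_def using XY by blast
  qed
  moreover have "\<Union>Q = {inv x \<otimes> y | x y. x \<in> \<Union>A \<and> y \<in> \<Union>A}"
  proof (intro subset_antisym subsetI)
    fix p assume "p \<in> \<Union>Q"
    then obtain X Y where "X \<in> A" "Y \<in> A" "p \<in> inv\<^bsub>?F\<^esub> X \<otimes>\<^bsub>?F\<^esub> Y" unfolding Q_def by blast
    then show "p \<in> {inv x \<otimes> y | x y. x \<in> \<Union>A \<and> y \<in> \<Union>A}"
      using FactGroup_inv_mult_mem(2)[OF N, of X Y] A by blast
  next
    fix p assume "p \<in> {inv x \<otimes> y | x y. x \<in> \<Union>A \<and> y \<in> \<Union>A}"
    then obtain X Y x y where XY: "X \<in> A" "Y \<in> A" "x \<in> X" "y \<in> Y" "p = inv x \<otimes> y" by blast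
    then have "p \<in> inv\<^bsub>?F\<^esub> X \<otimes>\<^bsub>?F\<^esub> Y" using FactGroup_inv_mult_mem(2)[OF N, of X Y] A by blast
    then show "p \<in> \<Union>Q" unfolding Q_def using XY by blast
  qed
  ultimately have "card (\<Union>P) = card (\<Union>Q)" using card_quotients_eq[OF UA] by simp
  then have "card N * card P = card N * card Q" using card_Union_rcosets[OF sub] PQ by simp
  moreover have "card N \<noteq> 0" using N.one_closed N.subset finite_subset_carrier by (metis card_0_eq empty_iff)
  ultimately show "card {a \<otimes>\<^bsub>?F\<^esub> inv\<^bsub>?F\<^esub> b | a b. a \<in> A \<and> b \<in> A} = card {inv\<^bsub>?F\<^esub> a \<otimes>\<^bsub>?F\<^esub> b | a b. a \<in> A \<and> b \<in> A}"
    unfolding P_def[symmetric] Q_def[symmetric] by simp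
qed

text \<open>
  Modulo \<open>z = x^2\<close> the element \<open>x\<close> is a noncentral involution, so the quotient is dihedral. Let \<open>c\<close>
  be a lift of the element that generates its rotations. Then \<open>x\<close> inverts \<open>c\<close> up to a factor \<open>z\<close>. If
  the factor were \<open>z\<close>, then \<open>(cx)^2 = z^2 = \<one>\<close>, so \<open>cx\<close> would be a central involution; it would commute
  with \<open>x\<close>, and \<open>c^2 = z\<close> would follow.
\<close>

lemma nonnormal_order_four:
  assumes central: "\<And>t g. t \<in> carrier G \<Longrightarrow> t \<otimes> t = \<one> \<Longrightarrow> g \<in> carrier G \<Longrightarrow> t \<otimes> g = g \<otimes> t"
    and x: "x \<in> carrier G" "x \<otimes> x = z" "z \<noteq> \<one>" "z \<otimes> z = \<one>"
    and g: "g \<in> carrier G" "x \<otimes> g \<noteq> g \<otimes> x" "x \<otimes> g \<noteq> g \<otimes> inv x"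
  obtains c where "c \<in> carrier G" "x \<otimes> c = inv c \<otimes> x" "c \<otimes> c \<noteq> \<one>" "c \<otimes> c \<noteq> z"
    "c \<otimes> c \<otimes> c \<in> {\<one>, z} \<or> c \<otimes> c \<otimes> c \<otimes> c \<in> {\<one>, z} \<or> c \<otimes> c \<otimes> c \<otimes> c \<otimes> c \<in> {\<one>, z}"
    "\<And>y. y \<in> carrier G \<Longrightarrow> \<exists>w\<in>{\<one>, c, c \<otimes> c, inv c, inv (c \<otimes> c)}. \<exists>e\<in>{\<one>, z}. y = e \<otimes> w \<or> y \<otimes> x = e \<otimes> w"
proof -
  have zc: "z \<in> carrier G" using x by auto
  have iz: "inv z = z" using x zc by (simp add: inv_equality)
  have ix: "inv x = z \<otimes> x" using x zc by (intro inv_equality) (simp_all add: m_assoc)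
  define N where "N = {\<one>, z}"
  have Nsub: "subgroup N G"
    by (rule subgroupI) (use zc x iz in \<open>auto simp: N_def\<close>)
  have N: "N \<lhd> G" unfolding normal_inv_iff
  proof (intro conjI ballI Nsub)
    fix y h assume "y \<in> carrier G" "h \<in> N"
    then have "y \<otimes> h \<otimes> inv y = h" using central[OF zc x(4)] zc by (auto simp: N_def m_assoc) (metis inv_closed m_assoc r_inv r_one)
    then show "y \<otimes> h \<otimes> inv y \<in> N" using \<open>h \<in> N\<close> by simp
  qed
  interpret N: normal N G by fact
  let ?F = "G Mod N"
  interpret F: balanced_group ?F
    by (intro balanced_group.intro balanced_group_axioms.intro N.factorgroup_is_group balanced_FactGroup N)
  have mult: "(N #> u) \<otimes>\<^bsub>?F\<^esub> (N #> v) = N #> (u \<otimes> v)" if "u \<in> carrier G" "v \<in> carrier G" for u v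
    using N.rcos_sum that by simp
  have finv: "inv\<^bsub>?F\<^esub> (N #> u) = N #> (inv u)" if "u \<in> carrier G" for u
    using N.inv_FactGroup[of "N #> u"] N.rcos_inv[OF that] that by (auto simp: carrier_FactGroup)
  have clF: "N #> u \<in> carrier ?F" if "u \<in> carrier G" for u using that by (auto simp: carrier_FactGroup)
  have eqF: "N #> u = N #> v \<longleftrightarrow> u = v \<or> u = z \<otimes> v" if "u \<in> carrier G" "v \<in> carrier G" for u v
  proof -
    have "N #> u = N #> v \<longleftrightarrow> u \<in> N #> v"
      using that by (metis Nsub rcos_self repr_independence)
    also have "\<dots> \<longleftrightarrow> u = v \<or> u = z \<otimes> v" using that by (auto simp: N_def r_coset_def)
    finally show ?thesis .
  qed
  have oneF: "\<one>\<^bsub>?F\<^esub> = N #> \<one>" by (simp add: N.subset)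
  let ?a = "N #> x"
  have a1: "?a \<in> carrier ?F" using x clF by simp
  have a2: "?a \<otimes>\<^bsub>?F\<^esub> ?a = \<one>\<^bsub>?F\<^esub>"
    using eqF[OF zc one_closed] zc x by (simp only: mult[OF x(1) x(1)] oneF x(2)) simp
  have a3: "?a \<otimes>\<^bsub>?F\<^esub> (N #> g) \<noteq> (N #> g) \<otimes>\<^bsub>?F\<^esub> ?a"
  proof -
    have "z \<otimes> (g \<otimes> x) = g \<otimes> inv x" using central[OF zc x(4) g(1)] g(1) x(1) zc by (metis ix m_assoc)
    then have "\<not> (x \<otimes> g = g \<otimes> x \<or> x \<otimes> g = z \<otimes> (g \<otimes> x))" using g by simp
    then show ?thesis using eqF[of "x \<otimes> g" "g \<otimes> x"] g(1) x(1) mult by simp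
  qed
  obtain B where B: "B \<in> carrier ?F" "B \<otimes>\<^bsub>?F\<^esub> B \<noteq> \<one>\<^bsub>?F\<^esub>" "?a \<otimes>\<^bsub>?F\<^esub> B = inv\<^bsub>?F\<^esub> B \<otimes>\<^bsub>?F\<^esub> ?a"
    "B \<otimes>\<^bsub>?F\<^esub> B \<otimes>\<^bsub>?F\<^esub> B = \<one>\<^bsub>?F\<^esub> \<or> B \<otimes>\<^bsub>?F\<^esub> B \<otimes>\<^bsub>?F\<^esub> B \<otimes>\<^bsub>?F\<^esub> B = \<one>\<^bsub>?F\<^esub> \<or> B \<otimes>\<^bsub>?F\<^esub> B \<otimes>\<^bsub>?F\<^esub> B \<otimes>\<^bsub>?F\<^esub> B \<otimes>\<^bsub>?F\<^esub> B = \<one>\<^bsub>?F\<^esub>"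
    and cov: "\<And>x. x \<in> carrier ?F \<Longrightarrow> x \<in> {\<one>\<^bsub>?F\<^esub>, B, B \<otimes>\<^bsub>?F\<^esub> B, inv\<^bsub>?F\<^esub> B, inv\<^bsub>?F\<^esub> (B \<otimes>\<^bsub>?F\<^esub> B)} \<or>
      x \<otimes>\<^bsub>?F\<^esub> ?a \<in> {\<one>\<^bsub>?F\<^esub>, B, B \<otimes>\<^bsub>?F\<^esub> B, inv\<^bsub>?F\<^esub> B, inv\<^bsub>?F\<^esub> (B \<otimes>\<^bsub>?F\<^esub> B)}"
    by (rule F.noncentral_involution_dihedral[OF a1 a2 clF[OF g(1)] a3]) (rule that)
  obtain c where c: "c \<in> carrier G" "B = N #> c" using B(1) by (auto simp: carrier_FactGroup)
  have one_iff: "N #> u = \<one>\<^bsub>?F\<^esub> \<longleftrightarrow> u \<in> {\<one>, z}" if "u \<in> carrier G" for u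
    using eqF[OF that one_closed] zc unfolding oneF by simp
  have c2: "c \<otimes> c \<notin> {\<one>, z}" using B(2) one_iff[of "c \<otimes> c"] c mult by simp
  have "N #> (x \<otimes> c) = N #> (inv c \<otimes> x)" using B(3) c x(1) mult finv by (simp del: mult_FactGroup)
  then have xc: "x \<otimes> c = inv c \<otimes> x \<or> x \<otimes> c = z \<otimes> (inv c \<otimes> x)" using eqF[of "x \<otimes> c" "inv c \<otimes> x"] x(1) c by simp
  have inverts: "x \<otimes> c = inv c \<otimes> x"
  proof (rule ccontr)
    assume "\<not> ?thesis"
    then have e: "x \<otimes> c = z \<otimes> (inv c \<otimes> x)" using xc by simp
    have zic: "z \<otimes> inv c = inv c \<otimes> z" using central[OF zc x(4)] c by simp
    have "(c \<otimes> x) \<otimes> (c \<otimes> x) = c \<otimes> (x \<otimes> c) \<otimes> x" using c x(1) by (simp add: m_assoc)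
    also have "\<dots> = c \<otimes> (z \<otimes> inv c) \<otimes> (x \<otimes> x)" unfolding e using c x(1) zc by (simp add: m_assoc)
    also have "\<dots> = z \<otimes> z" unfolding zic x(2) using c zc by (simp add: m_assoc inv_mult_cancel)
    finally have "(c \<otimes> x) \<otimes> (c \<otimes> x) = \<one>" using x by simp
    then have "c \<otimes> x \<otimes> x = x \<otimes> (c \<otimes> x)" using central[of "c \<otimes> x" x] c x(1) by simp
    then have "c \<otimes> x = x \<otimes> c" using c x(1) by (simp flip: m_assoc)
    then have "c \<otimes> x = z \<otimes> inv c \<otimes> x" using e c x(1) zc by (simp add: m_assoc)
    then have "c = z \<otimes> inv c" using c x(1) zc by simp
    then have "c \<otimes> c = z" using c zc by (metis inv_solve_right)
    then show False using c2 by simp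
  qed
  have pows: "c \<otimes> c \<otimes> c \<in> {\<one>, z} \<or> c \<otimes> c \<otimes> c \<otimes> c \<in> {\<one>, z} \<or> c \<otimes> c \<otimes> c \<otimes> c \<otimes> c \<in> {\<one>, z}"
    using B(4) c(1) unfolding c(2) by (simp only: mult m_closed one_iff)
  have "\<exists>w\<in>{\<one>, c, c \<otimes> c, inv c, inv (c \<otimes> c)}. \<exists>e\<in>{\<one>, z}. y = e \<otimes> w \<or> y \<otimes> x = e \<otimes> w"
    if y: "y \<in> carrier G" for y
  proof -
    have W: "w \<in> carrier G" if "w \<in> {\<one>, c, c \<otimes> c, inv c, inv (c \<otimes> c)}" for w using that c by auto
    have "(N #> y) \<in> (\<lambda>w. N #> w) ` {\<one>, c, c \<otimes> c, inv c, inv (c \<otimes> c)} \<or> N #> (y \<otimes> x) \<in> (\<lambda>w. N #> w) ` {\<one>, c, c \<otimes> c, inv c, inv (c \<otimes> c)}"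
      using cov[OF clF[OF y]] c(1) x(1) y unfolding c(2) oneF
      by (simp only: mult finv m_closed image_insert image_empty)
    then obtain w where w: "w \<in> {\<one>, c, c \<otimes> c, inv c, inv (c \<otimes> c)}" "N #> y = N #> w \<or> N #> (y \<otimes> x) = N #> w" by blast
    then have "y = w \<or> y = z \<otimes> w \<or> y \<otimes> x = w \<or> y \<otimes> x = z \<otimes> w" using eqF W y x(1) by (metis m_closed)
    then have "(y = \<one> \<otimes> w \<or> y \<otimes> x = \<one> \<otimes> w) \<or> (y = z \<otimes> w \<or> y \<otimes> x = z \<otimes> w)" using W[OF w(1)] by auto
    then show ?thesis using w(1) by blast
  qed
  then show thesis using c2 by (intro that[OF c(1) inverts _ _ pows]) auto
qed

end

section \<open>Normal forms and presented groups\<close>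

context group begin

lemma pow_mod:
  fixes n i :: nat
  assumes "c \<in> carrier G" "c [^] n = \<one>"
  shows "c [^] (i mod n) = c [^] i"
proof -
  have "c [^] i = c [^] (n * (i div n) + i mod n)" by simp
  also have "\<dots> = (c [^] n) [^] (i div n) \<otimes> c [^] (i mod n)"
    using assms(1) by (simp only: nat_pow_mult nat_pow_pow nat_pow_closed)
  also have "\<dots> = c [^] (i mod n)" using assms by simp
  finally show ?thesis by simp
qed

lemma inv_eq_pow:
  fixes n :: nat
  assumes "c \<in> carrier G" "c [^] n = \<one>" "0 < n"
  shows "inv c = c [^] (n - 1)"
proof (rule inv_equality)
  have "c [^] (n - 1) \<otimes> c = c [^] Suc (n - 1)" by simp
  then show "c [^] (n - 1) \<otimes> c = \<one>" using assms by simp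
qed (use assms in auto)

lemma subgroup_pow_closed:
  fixes n :: nat
  assumes "subgroup K G" "y \<in> K"
  shows "y [^] n \<in> K"
proof -
  interpret subgroup K G by fact
  show ?thesis by (induction n) (use assms(2) in \<open>auto intro: m_closed\<close>)
qed

lemma pow_Suc_mult:
  assumes "c \<in> carrier G" "q \<in> carrier G"
  shows "c [^] Suc i \<otimes> q = c \<otimes> (c [^] i \<otimes> q)"
  using assms by (simp only: nat_pow_Suc2 m_assoc nat_pow_closed)

text \<open>
  In a group generated by \<open>c\<close> and \<open>x\<close> with \<open>x c = c^-1 x\<close>, \<open>c^n = \<one>\<close> and \<open>x^m\<close> a power of \<open>c\<close>, these
  products are all elements. Dihedral groups, dicyclic groups and \<open>C4_sdprod_C4\<close> are of this kind.
\<close>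

definition normal_form :: "'a \<Rightarrow> 'a \<Rightarrow> nat \<Rightarrow> nat \<Rightarrow> 'a set" where
  "normal_form c x n m = {c [^] i \<otimes> x [^] j | i j. i < n \<and> j < m}"

lemma pow_inverted:
  fixes i :: nat
  assumes "c \<in> carrier G" "x \<in> carrier G" "x \<otimes> c = inv c \<otimes> x"
  shows "x \<otimes> c [^] i = inv (c [^] i) \<otimes> x"
proof (induction i)
  case (Suc i)
  have "x \<otimes> c [^] Suc i = (x \<otimes> c [^] i) \<otimes> c" using assms(1,2) by (simp add: m_assoc)
  also have "\<dots> = inv (c [^] i) \<otimes> (x \<otimes> c)" unfolding Suc using assms(1,2) by (simp add: m_assoc)
  also have "\<dots> = inv (c \<otimes> c [^] i) \<otimes> x" unfolding assms(3) using assms(1,2) by (simp add: inv_mult_group m_assoc)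
  also have "c \<otimes> c [^] i = c [^] Suc i" using assms(1) by (metis nat_pow_Suc nat_pow_Suc2)
  finally show ?case .
qed (use assms in simp)

context
  fixes c x and n m k :: nat
  assumes c: "c \<in> carrier G" and x: "x \<in> carrier G" and inverts: "x \<otimes> c = inv c \<otimes> x"
    and n: "c [^] n = \<one>" "0 < n" and m: "x [^] m = c [^] k" "0 < m"
begin

lemma normal_formI: "c [^] (i :: nat) \<otimes> x [^] j \<in> normal_form c x n m" if "j < m"
proof -
  have "c [^] i = c [^] (i mod n)" using pow_mod[OF c n(1)] by simp
  moreover have "i mod n < n" using n by simp
  ultimately show ?thesis
    unfolding normal_form_def using that by (intro CollectI exI[of _ "i mod n"] exI[of _ j]) simp
qed

text \<open>
  Passing \<open>x\<close> to the right inverts the power of \<open>c\<close>, and an overflow of the exponent of \<open>x\<close> is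
  absorbed by \<open>x^m = c^k\<close>.
\<close>

lemma normal_form_mult:
  assumes p: "p \<in> normal_form c x n m"
  shows "c \<otimes> p \<in> normal_form c x n m" "x \<otimes> p \<in> normal_form c x n m"
    "inv c \<otimes> p \<in> normal_form c x n m" "inv x \<otimes> p \<in> normal_form c x n m"
proof -
  have mc: "c \<otimes> p \<in> normal_form c x n m" if pN: "p \<in> normal_form c x n m" for p
  proof -
    obtain i j :: nat where p: "j < m" "p = c [^] i \<otimes> x [^] j" using pN unfolding normal_form_def by blast
    have e: "c \<otimes> p = c [^] Suc i \<otimes> x [^] j"
      unfolding p(2) using x by (intro pow_Suc_mult[OF c, symmetric] nat_pow_closed)
    show ?thesis unfolding e by (rule normal_formI[OF p(1)])
  qed
  have mx: "x \<otimes> p \<in> normal_form c x n m" if pN: "p \<in> normal_form c x n m" for p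
  proof -
    obtain i j :: nat where p: "i < n" "j < m" "p = c [^] i \<otimes> x [^] j" using pN unfolding normal_form_def by blast
    have "c [^] (n - i) \<otimes> c [^] i = \<one>" using c p(1) n(1) by (simp add: nat_pow_mult)
    then have inv: "inv (c [^] i) = c [^] (n - i)" using c by (intro inv_equality) simp_all
    have e: "x \<otimes> p = c [^] (n - i) \<otimes> x [^] Suc j"
    proof -
      have "x \<otimes> p = (x \<otimes> c [^] i) \<otimes> x [^] j" using p(3) c x by (simp add: m_assoc)
      also have "\<dots> = c [^] (n - i) \<otimes> (x \<otimes> x [^] j)"
        unfolding pow_inverted[OF c x inverts] inv using c x by (simp add: m_assoc)
      also have "x \<otimes> x [^] j = x [^] Suc j" using x by (metis nat_pow_Suc nat_pow_Suc2)
      finally show ?thesis .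
    qed
    show ?thesis
    proof (cases "Suc j < m")
      case True then show ?thesis unfolding e by (rule normal_formI)
    next
      case False
      then have "Suc j = m" using p by simp
      then have "x \<otimes> p = c [^] (n - i + k) \<otimes> x [^] (0 :: nat)" using e m(1) c by (simp add: nat_pow_mult)
      then show ?thesis using normal_formI m(2) by metis
    qed
  qed
  have pc: "c [^] (i :: nat) \<otimes> p \<in> normal_form c x n m" if "p \<in> normal_form c x n m" for p i
  proof (induction i)
    case 0
    have "p \<in> carrier G" using that c x unfolding normal_form_def by auto
    then show ?case using that by simp
  next
    case (Suc i)
    have "p \<in> carrier G" using that c x unfolding normal_form_def by auto
    then have "c [^] Suc i \<otimes> p = c \<otimes> (c [^] i \<otimes> p)"
      by (rule pow_Suc_mult[OF c])
    then show ?case using mc[OF Suc] by simp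
  qed
  have px: "x [^] (i :: nat) \<otimes> p \<in> normal_form c x n m" if "p \<in> normal_form c x n m" for p i
  proof (induction i)
    case 0
    have "p \<in> carrier G" using that c x unfolding normal_form_def by auto
    then show ?case using that by simp
  next
    case (Suc i)
    have "p \<in> carrier G" using that c x unfolding normal_form_def by auto
    then have "x [^] Suc i \<otimes> p = x \<otimes> (x [^] i \<otimes> p)"
      by (rule pow_Suc_mult[OF x])
    then show ?case using mx[OF Suc] by simp
  qed
  have "x [^] (m * n) = (c [^] n) [^] k" using m(1) c x by (metis mult.commute nat_pow_pow)
  then have xo: "x [^] (m * n) = \<one>" "0 < m * n" using n m by simp_all
  show "c \<otimes> p \<in> normal_form c x n m" "x \<otimes> p \<in> normal_form c x n m" using mc mx p by blast+
  show "inv c \<otimes> p \<in> normal_form c x n m" unfolding inv_eq_pow[OF c n] by (rule pc[OF p])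
  show "inv x \<otimes> p \<in> normal_form c x n m" unfolding inv_eq_pow[OF x xo] by (rule px[OF p])
qed

lemma one_in_normal_form: "\<one> \<in> normal_form c x n m"
  using normal_formI[of 0 0] m by simp

end

end

lemma presented_class_closed: "pres_rel R `` {w} \<in> carrier (presented_group R)"
  by (simp add: presented_group_def quotientI)

lemma presented_class_Nil: "pres_rel R `` {[]} = \<one>\<^bsub>presented_group R\<^esub>"
  by (simp add: presented_group_def)

lemma presented_class_winv:
  "pres_rel R `` {winv w} = inv\<^bsub>presented_group R\<^esub> (pres_rel R `` {w})"
proof -
  interpret P: group "presented_group R" by (rule group_presented_group)
  have "pres_rel R `` {winv w} \<otimes>\<^bsub>presented_group R\<^esub> pres_rel R `` {w} = \<one>\<^bsub>presented_group R\<^esub>"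
    by (simp add: presented_group_mult pres_class_eq_iff winv_left flip: presented_class_Nil)
  then show ?thesis using P.inv_equality presented_class_closed by metis
qed

lemma presented_class_wpow:
  "pres_rel R `` {wpow w n} = (pres_rel R `` {w}) [^]\<^bsub>presented_group R\<^esub> n"
proof (induction n)
  case 0
  then show ?case by (simp add: wpow_def presented_class_Nil)
next
  case (Suc n)
  interpret P: group "presented_group R" by (rule group_presented_group)
  have "wpow w (Suc n) = w @ wpow w n" by (simp add: wpow_def)
  then show ?case using Suc P.nat_pow_Suc2[OF presented_class_closed]
    by (simp add: presented_group_mult[symmetric])
qed

lemma presented_class_relation:
  "(u, v) \<in> R \<Longrightarrow> pres_rel R `` {u} = pres_rel R `` {v}"
  by (simp add: pres_class_eq_iff pres_eq.relation)

lemma presented_carrier_subset: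
  assumes "\<one>\<^bsub>presented_group R\<^esub> \<in> S"
    and "\<And>g p. p \<in> S \<Longrightarrow> (pres_rel R `` {wgen g}) \<otimes>\<^bsub>presented_group R\<^esub> p \<in> S"
    and "\<And>g p. p \<in> S \<Longrightarrow> inv\<^bsub>presented_group R\<^esub> (pres_rel R `` {wgen g}) \<otimes>\<^bsub>presented_group R\<^esub> p \<in> S"
  shows "carrier (presented_group R) \<subseteq> S"
proof
  fix X assume "X \<in> carrier (presented_group R)"
  then obtain w where w: "X = pres_rel R `` {w}" by (auto simp: presented_group_def quotient_def)
  have "pres_rel R `` {w} \<in> S"
  proof (induction w)
    case Nil then show ?case using assms(1) presented_class_Nil[of R] by simp
  next
    case (Cons l w)
    obtain g e where l: "l = (g, e)" by (cases l)
    have eq: "l # w = (if e then wgen g else winv (wgen g)) @ w" by (simp add: l wgen_def winv_def)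
    have "pres_rel R `` {l # w} = (if e then pres_rel R `` {wgen g} else inv\<^bsub>presented_group R\<^esub> (pres_rel R `` {wgen g}))
        \<otimes>\<^bsub>presented_group R\<^esub> pres_rel R `` {w}"
      unfolding eq by (simp add: presented_group_mult flip: presented_class_winv)
    then show ?case using assms(2,3)[OF Cons] by (cases e) simp_all
  qed
  then show "X \<in> S" using w by simp
qed

text \<open>
  Relations of this form bound the order of the presented group by \<open>n m\<close>.
\<close>

lemma presented_carrier_normal_form:
  fixes R :: "('g word \<times> 'g word) set" and n m k :: nat
  defines "P \<equiv> presented_group R"
  assumes gens: "\<And>g :: 'g. g = g1 \<or> g = g2"
    and c: "c = pres_rel R `` {wgen g1}" and x: "x = pres_rel R `` {wgen g2}"
    and rel: "x \<otimes>\<^bsub>P\<^esub> c = inv\<^bsub>P\<^esub> c \<otimes>\<^bsub>P\<^esub> x"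
    "c [^]\<^bsub>P\<^esub> n = \<one>\<^bsub>P\<^esub>" "0 < n" "x [^]\<^bsub>P\<^esub> m = c [^]\<^bsub>P\<^esub> k" "0 < m"
  shows "carrier P \<subseteq> group.normal_form P c x n m"
proof -
  interpret P: group P unfolding P_def by (rule group_presented_group)
  have cl: "c \<in> carrier P" "x \<in> carrier P"
    by (simp_all add: P_def c x presented_class_closed)
  note nf = P.normal_form_mult[OF cl rel]
  show ?thesis unfolding P_def
  proof (rule presented_carrier_subset)
    show "\<one>\<^bsub>presented_group R\<^esub> \<in> group.normal_form (presented_group R) c x n m"
      using P.one_in_normal_form[OF cl rel] by (simp add: P_def)
    fix g p assume p: "p \<in> group.normal_form (presented_group R) c x n m"
    show "(pres_rel R `` {wgen g}) \<otimes>\<^bsub>presented_group R\<^esub> p \<in> group.normal_form (presented_group R) c x n m"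
      "inv\<^bsub>presented_group R\<^esub> (pres_rel R `` {wgen g}) \<otimes>\<^bsub>presented_group R\<^esub> p \<in> group.normal_form (presented_group R) c x n m"
      using nf[of p] p gens[of g] by (auto simp: P_def c x)
  qed
qed

lemma word_val_simps:
  assumes "group H" "\<And>x. f x \<in> carrier H"
  shows "word_val H f [] = \<one>\<^bsub>H\<^esub>" "word_val H f (wgen g) = f g"
    "word_val H f (u @ v) = word_val H f u \<otimes>\<^bsub>H\<^esub> word_val H f v"
    "word_val H f (winv u) = inv\<^bsub>H\<^esub> (word_val H f u)"
    "word_val H f (wpow u n) = word_val H f u [^]\<^bsub>H\<^esub> n"
    "word_val H f u \<in> carrier H"
proof -
  interpret H: group H by fact
  have Nil: "word_val H f [] = \<one>\<^bsub>H\<^esub>"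
    and Cons: "word_val H f ((x, e) # w) = (if e then f x else inv\<^bsub>H\<^esub> f x) \<otimes>\<^bsub>H\<^esub> word_val H f w" for x e w
    by (simp_all add: word_val_def)
  have closed: "word_val H f w \<in> carrier H" for w
    by (induction w) (auto simp: Nil Cons assms(2))
  have append: "word_val H f (u @ v) = word_val H f u \<otimes>\<^bsub>H\<^esub> word_val H f v" for u v
    by (induction u) (auto simp: Nil Cons assms(2) closed H.m_assoc)
  show "word_val H f [] = \<one>\<^bsub>H\<^esub>" "word_val H f (wgen g) = f g"
    by (simp_all add: Nil Cons wgen_def assms(2))
  show "word_val H f (u @ v) = word_val H f u \<otimes>\<^bsub>H\<^esub> word_val H f v" by (rule append)
  show "word_val H f (winv u) = inv\<^bsub>H\<^esub> (word_val H f u)"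
    by (induction u) (auto simp: Nil Cons winv_def append[unfolded winv_def] assms(2) closed H.inv_mult_group)
  show "word_val H f (wpow u n) = word_val H f u [^]\<^bsub>H\<^esub> n"
  proof (induction n)
    case (Suc n)
    have "wpow u (Suc n) = u @ wpow u n" by (simp add: wpow_def)
    then show ?case using Suc H.nat_pow_Suc2[OF closed] by (simp add: append)
  qed (simp add: wpow_def Nil)
  show "word_val H f u \<in> carrier H" by (rule closed)
qed

lemma gen2_cases: "g = Gen1 \<or> g = Gen2" "g = Gen2 \<or> g = Gen1"
  by (cases g; simp)+

context group begin

text \<open>
  Every element of the presented group has a normal form, so a homomorphism is injective as soon as
  no nontrivial normal form in \<open>c\<close> and \<open>x\<close> is the identity of the target.
\<close>

lemma presented_group_embedding:
  fixes R :: "('g word \<times> 'g word) set" and n m :: nat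
  assumes f: "\<And>g. f g \<in> carrier G"
    and R: "\<And>u v. (u, v) \<in> R \<Longrightarrow> word_val G f u = word_val G f v"
    and P: "carrier (presented_group R) \<subseteq>
      group.normal_form (presented_group R) (pres_rel R `` {wgen g1}) (pres_rel R `` {wgen g2}) n m"
    and inj: "\<And>(i :: nat) (j :: nat). i < n \<Longrightarrow> j < m \<Longrightarrow> f g1 [^] i \<otimes> f g2 [^] j = \<one> \<Longrightarrow> i = 0 \<and> j = 0"
  obtains h where "h \<in> hom (presented_group R) G" "inj_on h (carrier (presented_group R))"
    "f g1 \<in> h ` carrier (presented_group R)" "f g2 \<in> h ` carrier (presented_group R)"
proof -
  let ?P = "presented_group R"
  let ?c = "pres_rel R `` {wgen g1}" and ?x = "pres_rel R `` {wgen g2}"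
  interpret P: group ?P by (rule group_presented_group)
  obtain h where h: "h \<in> hom ?P G" "\<And>g. h (pres_rel R `` {wgen g}) = f g"
    using presented_group_universal[OF is_group f R] by blast
  interpret h: group_hom ?P G h
    using h(1) by (simp add: group_hom_def group_hom_axioms_def P.is_group)
  have cl: "?c \<in> carrier ?P" "?x \<in> carrier ?P" by (simp_all add: presented_class_closed)
  have "inj_on h (carrier ?P)" unfolding h.inj_on_one_iff
  proof (intro allI impI)
    fix p assume p: "p \<in> carrier ?P" "h p = \<one>"
    then obtain i j :: nat where ij: "p = ?c [^]\<^bsub>?P\<^esub> i \<otimes>\<^bsub>?P\<^esub> ?x [^]\<^bsub>?P\<^esub> j" "i < n" "j < m"
      using P unfolding P.normal_form_def by blast
    have "h p = f g1 [^] i \<otimes> f g2 [^] j" unfolding ij(1) using cl h(2) by (simp add: h.hom_nat_pow)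
    then have "i = 0 \<and> j = 0" using inj[OF ij(2,3)] p(2) by metis
    then show "p = \<one>\<^bsub>?P\<^esub>" using ij(1) by simp
  qed
  then show thesis using that[OF h(1)] h(2) cl by (metis imageI)
qed

lemma iso_presented_groupI:
  fixes R :: "('g word \<times> 'g word) set" and n m :: nat
  assumes f: "\<And>g. f g \<in> carrier G"
    and R: "\<And>u v. (u, v) \<in> R \<Longrightarrow> word_val G f u = word_val G f v"
    and P: "carrier (presented_group R) \<subseteq>
      group.normal_form (presented_group R) (pres_rel R `` {wgen g1}) (pres_rel R `` {wgen g2}) n m"
    and G: "carrier G \<subseteq> normal_form (f g1) (f g2) n m"
    and inj: "\<And>(i :: nat) (j :: nat). i < n \<Longrightarrow> j < m \<Longrightarrow> f g1 [^] i \<otimes> f g2 [^] j = \<one> \<Longrightarrow> i = 0 \<and> j = 0"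
  shows "G \<cong> presented_group R"
proof -
  let ?P = "presented_group R"
  interpret P: group ?P by (rule group_presented_group)
  obtain h where h: "h \<in> hom ?P G" "inj_on h (carrier ?P)" "f g1 \<in> h ` carrier ?P" "f g2 \<in> h ` carrier ?P"
    using presented_group_embedding[OF f R P inj] by blast
  interpret h: group_hom ?P G h
    using h(1) by (simp add: group_hom_def group_hom_axioms_def P.is_group)
  have img: "subgroup (h ` carrier ?P) G" by (rule h.img_is_subgroup)
  have "carrier G \<subseteq> h ` carrier ?P"
    using G subgroup.m_closed[OF img subgroup_pow_closed[OF img h(3)] subgroup_pow_closed[OF img h(4)]]
    unfolding normal_form_def by blast
  then have "h \<in> iso ?P G" using h(2) subgroup.subset[OF img] by (auto simp: iso_def bij_betw_def h(1))
  then show ?thesis using P.iso_sym is_isoI by blast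
qed

end

lemma dihedral_structure:
  fixes n :: nat assumes "0 < n"
  defines "R \<equiv> {(wpow (wgen Gen1) n, []), (wpow (wgen Gen2) 2, []), (wgen Gen2 @ wgen Gen1, winv (wgen Gen1) @ wgen Gen2)}"
  defines "c \<equiv> pres_rel R `` {wgen Gen1}" and "x \<equiv> pres_rel R `` {wgen Gen2}"
  shows "dihedral n = presented_group R"
    and "x \<otimes>\<^bsub>dihedral n\<^esub> c = inv\<^bsub>dihedral n\<^esub> c \<otimes>\<^bsub>dihedral n\<^esub> x"
    and "c [^]\<^bsub>dihedral n\<^esub> n = \<one>\<^bsub>dihedral n\<^esub>" "x [^]\<^bsub>dihedral n\<^esub> (2::nat) = \<one>\<^bsub>dihedral n\<^esub>"
    and "c \<in> carrier (dihedral n)" "x \<in> carrier (dihedral n)"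
    and "carrier (dihedral n) \<subseteq> group.normal_form (dihedral n) c x n 2"
proof -
  show eq: "dihedral n = presented_group R" by (simp add: dihedral_def R_def Let_def)
  have r: "(wpow (wgen Gen1) n, []) \<in> R" "(wpow (wgen Gen2) 2, []) \<in> R"
    "(wgen Gen2 @ wgen Gen1, winv (wgen Gen1) @ wgen Gen2) \<in> R" by (simp_all add: R_def)
  show 1: "x \<otimes>\<^bsub>dihedral n\<^esub> c = inv\<^bsub>dihedral n\<^esub> c \<otimes>\<^bsub>dihedral n\<^esub> x"
    using presented_class_relation[OF r(3)]
    unfolding eq c_def x_def presented_class_winv[symmetric] presented_group_mult .
  show 2: "c [^]\<^bsub>dihedral n\<^esub> n = \<one>\<^bsub>dihedral n\<^esub>" and 3: "x [^]\<^bsub>dihedral n\<^esub> (2::nat) = \<one>\<^bsub>dihedral n\<^esub>"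
    using presented_class_relation[OF r(1)] presented_class_relation[OF r(2)]
    unfolding eq c_def x_def presented_class_wpow presented_class_Nil .
  show "c \<in> carrier (dihedral n)" "x \<in> carrier (dihedral n)"
    unfolding eq c_def x_def by (rule presented_class_closed)+
  have 3: "x [^]\<^bsub>dihedral n\<^esub> (2::nat) = c [^]\<^bsub>dihedral n\<^esub> (0::nat)" using 3 by simp
  show "carrier (dihedral n) \<subseteq> group.normal_form (dihedral n) c x n 2"
    using presented_carrier_normal_form[of Gen1 Gen2 c R x n 2 0, OF gen2_cases(1)] 1 2 3 assms(1)
    by (simp add: eq c_def x_def)
qed

lemma dicyclic_structure:
  fixes n :: nat assumes "0 < n"
  defines "R \<equiv> {(wpow (wgen Gen1) (2 * n), []), (wpow (wgen Gen2) 2, wpow (wgen Gen1) n),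
    (wgen Gen2 @ wgen Gen1 @ winv (wgen Gen2), winv (wgen Gen1))}"
  defines "c \<equiv> pres_rel R `` {wgen Gen1}" and "x \<equiv> pres_rel R `` {wgen Gen2}"
  shows "dicyclic n = presented_group R"
    and "x \<otimes>\<^bsub>dicyclic n\<^esub> c = inv\<^bsub>dicyclic n\<^esub> c \<otimes>\<^bsub>dicyclic n\<^esub> x"
    and "c [^]\<^bsub>dicyclic n\<^esub> (2 * n) = \<one>\<^bsub>dicyclic n\<^esub>" "x [^]\<^bsub>dicyclic n\<^esub> (2::nat) = c [^]\<^bsub>dicyclic n\<^esub> n"
    and "c \<in> carrier (dicyclic n)" "x \<in> carrier (dicyclic n)"
    and "carrier (dicyclic n) \<subseteq> group.normal_form (dicyclic n) c x (2 * n) 2"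
proof -
  show eq: "dicyclic n = presented_group R" by (simp add: dicyclic_def R_def Let_def)
  interpret P: group "presented_group R" by (rule group_presented_group)
  have r: "(wpow (wgen Gen1) (2 * n), []) \<in> R" "(wpow (wgen Gen2) 2, wpow (wgen Gen1) n) \<in> R"
    "(wgen Gen2 @ wgen Gen1 @ winv (wgen Gen2), winv (wgen Gen1)) \<in> R" by (simp_all add: R_def)
  show cl: "c \<in> carrier (dicyclic n)" "x \<in> carrier (dicyclic n)"
    unfolding eq c_def x_def by (rule presented_class_closed)+
  have "x \<otimes>\<^bsub>presented_group R\<^esub> (c \<otimes>\<^bsub>presented_group R\<^esub> inv\<^bsub>presented_group R\<^esub> x) = inv\<^bsub>presented_group R\<^esub> c"
    using presented_class_relation[OF r(3)]
    unfolding eq c_def x_def presented_class_winv[symmetric] presented_group_mult .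
  then show 1: "x \<otimes>\<^bsub>dicyclic n\<^esub> c = inv\<^bsub>dicyclic n\<^esub> c \<otimes>\<^bsub>dicyclic n\<^esub> x"
    using P.conj_eq_iff[of x c "inv\<^bsub>presented_group R\<^esub> c"] cl unfolding eq by (simp add: P.m_assoc)
  show 2: "c [^]\<^bsub>dicyclic n\<^esub> (2 * n) = \<one>\<^bsub>dicyclic n\<^esub>" and 3: "x [^]\<^bsub>dicyclic n\<^esub> (2::nat) = c [^]\<^bsub>dicyclic n\<^esub> n"
    using presented_class_relation[OF r(1)] presented_class_relation[OF r(2)]
    unfolding eq c_def x_def presented_class_wpow presented_class_Nil .
  show "carrier (dicyclic n) \<subseteq> group.normal_form (dicyclic n) c x (2 * n) 2"
    using presented_carrier_normal_form[of Gen1 Gen2 c R x "2 * n" 2 n, OF gen2_cases(1)] 1 2 3 assms(1)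
    by (simp add: eq c_def x_def)
qed

lemma C4_sdprod_C4_structure:
  defines "R \<equiv> {(wpow (wgen Gen1) 4, []), (wpow (wgen Gen2) 4, []),
    (wgen Gen1 @ wgen Gen2 @ winv (wgen Gen1), winv (wgen Gen2))}"
  defines "c \<equiv> pres_rel R `` {wgen Gen2}" and "x \<equiv> pres_rel R `` {wgen Gen1}"
  shows "C4_sdprod_C4 = presented_group R"
    and "x \<otimes>\<^bsub>C4_sdprod_C4\<^esub> c = inv\<^bsub>C4_sdprod_C4\<^esub> c \<otimes>\<^bsub>C4_sdprod_C4\<^esub> x"
    and "c [^]\<^bsub>C4_sdprod_C4\<^esub> (4::nat) = \<one>\<^bsub>C4_sdprod_C4\<^esub>" "x [^]\<^bsub>C4_sdprod_C4\<^esub> (4::nat) = \<one>\<^bsub>C4_sdprod_C4\<^esub>"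
    and "c \<in> carrier C4_sdprod_C4" "x \<in> carrier C4_sdprod_C4"
    and "carrier C4_sdprod_C4 \<subseteq> group.normal_form C4_sdprod_C4 c x 4 4"
proof -
  show eq: "C4_sdprod_C4 = presented_group R" by (simp add: C4_sdprod_C4_def R_def Let_def)
  interpret P: group "presented_group R" by (rule group_presented_group)
  have r: "(wpow (wgen Gen1) 4, []) \<in> R" "(wpow (wgen Gen2) 4, []) \<in> R"
    "(wgen Gen1 @ wgen Gen2 @ winv (wgen Gen1), winv (wgen Gen2)) \<in> R" by (simp_all add: R_def)
  show cl: "c \<in> carrier C4_sdprod_C4" "x \<in> carrier C4_sdprod_C4"
    unfolding eq c_def x_def by (rule presented_class_closed)+
  have "x \<otimes>\<^bsub>presented_group R\<^esub> (c \<otimes>\<^bsub>presented_group R\<^esub> inv\<^bsub>presented_group R\<^esub> x) = inv\<^bsub>presented_group R\<^esub> c"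
    using presented_class_relation[OF r(3)]
    unfolding eq c_def x_def presented_class_winv[symmetric] presented_group_mult .
  then show 1: "x \<otimes>\<^bsub>C4_sdprod_C4\<^esub> c = inv\<^bsub>C4_sdprod_C4\<^esub> c \<otimes>\<^bsub>C4_sdprod_C4\<^esub> x"
    using P.conj_eq_iff[of x c "inv\<^bsub>presented_group R\<^esub> c"] cl unfolding eq by (simp add: P.m_assoc)
  show 2: "c [^]\<^bsub>C4_sdprod_C4\<^esub> (4::nat) = \<one>\<^bsub>C4_sdprod_C4\<^esub>" and 3: "x [^]\<^bsub>C4_sdprod_C4\<^esub> (4::nat) = \<one>\<^bsub>C4_sdprod_C4\<^esub>"
    using presented_class_relation[OF r(2)] presented_class_relation[OF r(1)]
    unfolding eq c_def x_def presented_class_wpow presented_class_Nil .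
  have 3: "x [^]\<^bsub>C4_sdprod_C4\<^esub> (4::nat) = c [^]\<^bsub>C4_sdprod_C4\<^esub> (0::nat)" using 3 by simp
  show "carrier C4_sdprod_C4 \<subseteq> group.normal_form C4_sdprod_C4 c x 4 4"
    using presented_carrier_normal_form[of Gen2 Gen1 c R x 4 4 0, OF gen2_cases(2)] 1 2 3
    by (simp add: eq c_def x_def)
qed

context group begin

lemma iso_dihedralI:
  fixes n :: nat
  assumes c: "c \<in> carrier G" and x: "x \<in> carrier G" and inv: "x \<otimes> c = inv c \<otimes> x"
    and n: "c [^] n = \<one>" "0 < n" and xx: "x \<otimes> x = \<one>"
    and cov: "carrier G \<subseteq> normal_form c x n 2"
    and inj: "\<And>(i :: nat) (j :: nat). i < n \<Longrightarrow> j < 2 \<Longrightarrow> c [^] i \<otimes> x [^] j = \<one> \<Longrightarrow> i = 0 \<and> j = 0"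
  shows "G \<cong> dihedral n"
proof -
  let ?f = "\<lambda>g. case g of Gen1 \<Rightarrow> c | Gen2 \<Rightarrow> x"
  have f: "?f g \<in> carrier G" for g using c x by (cases g) simp_all
  note wv = word_val_simps[OF is_group, of ?f, OF f]
  show ?thesis unfolding dihedral_structure(1)[OF n(2)]
    by (rule iso_presented_groupI[where f = ?f and ?g1.0 = Gen1 and ?g2.0 = Gen2, OF f _ dihedral_structure(7)[OF n(2), unfolded dihedral_structure(1)[OF n(2)]]])
      (use cov inj inv n xx x in \<open>auto simp: wv numeral_2_eq_2\<close>)
qed

lemma iso_dicyclicI:
  fixes n :: nat
  assumes c: "c \<in> carrier G" and x: "x \<in> carrier G" and inv: "x \<otimes> c = inv c \<otimes> x"
    and n: "c [^] (2 * n) = \<one>" "0 < n" and xx: "x \<otimes> x = c [^] n"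
    and cov: "carrier G \<subseteq> normal_form c x (2 * n) 2"
    and inj: "\<And>(i :: nat) (j :: nat). i < 2 * n \<Longrightarrow> j < 2 \<Longrightarrow> c [^] i \<otimes> x [^] j = \<one> \<Longrightarrow> i = 0 \<and> j = 0"
  shows "G \<cong> dicyclic n"
proof -
  let ?f = "\<lambda>g. case g of Gen1 \<Rightarrow> c | Gen2 \<Rightarrow> x"
  have f: "?f g \<in> carrier G" for g using c x by (cases g) simp_all
  note wv = word_val_simps[OF is_group, of ?f, OF f]
  have inv': "x \<otimes> (c \<otimes> inv x) = inv c" using inv c x by (metis conj_eq_iff inv_closed m_assoc)
  show ?thesis unfolding dicyclic_structure(1)[OF n(2)]
    by (rule iso_presented_groupI[where f = ?f and ?g1.0 = Gen1 and ?g2.0 = Gen2, OF f _ dicyclic_structure(7)[OF n(2), unfolded dicyclic_structure(1)[OF n(2)]]])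
      (use cov inj inv' n xx x in \<open>auto simp: wv numeral_2_eq_2\<close>)
qed

lemma iso_C4_sdprod_C4I:
  assumes c: "c \<in> carrier G" and x: "x \<in> carrier G" and inv: "x \<otimes> c = inv c \<otimes> x"
    and n: "c [^] (4::nat) = \<one>" and xx: "x [^] (4::nat) = \<one>"
    and cov: "carrier G \<subseteq> normal_form c x 4 4"
    and inj: "\<And>(i :: nat) (j :: nat). i < 4 \<Longrightarrow> j < 4 \<Longrightarrow> c [^] i \<otimes> x [^] j = \<one> \<Longrightarrow> i = 0 \<and> j = 0"
  shows "G \<cong> C4_sdprod_C4"
proof -
  let ?f = "\<lambda>g. case g of Gen1 \<Rightarrow> x | Gen2 \<Rightarrow> c"
  have f: "?f g \<in> carrier G" for g using c x by (cases g) simp_all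
  note wv = word_val_simps[OF is_group, of ?f, OF f]
  have inv': "x \<otimes> (c \<otimes> inv x) = inv c" using inv c x by (metis conj_eq_iff inv_closed m_assoc)
  show ?thesis unfolding C4_sdprod_C4_structure(1)
    by (rule iso_presented_groupI[where f = ?f and ?g1.0 = Gen2 and ?g2.0 = Gen1, OF f _ C4_sdprod_C4_structure(7)[unfolded C4_sdprod_C4_structure(1)]])
      (use cov inj inv' n xx x in \<open>auto simp: wv\<close>)
qed

end

section \<open>The listed nonabelian groups are balanced\<close>

context group begin

lemma pow_two: "x \<in> carrier G \<Longrightarrow> x [^] (2::nat) = x \<otimes> x"
  by (simp add: numeral_2_eq_2)

lemma pow_four: "x \<in> carrier G \<Longrightarrow> x [^] (4::nat) = (x \<otimes> x) \<otimes> (x \<otimes> x)"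
  by (simp add: eval_nat_numeral m_assoc)

context
  fixes c x and n :: nat
  assumes c: "c \<in> carrier G" and x: "x \<in> carrier G" and inverts: "x \<otimes> c = inv c \<otimes> x"
    and n: "0 < n" "c [^] n = \<one>" and yy: "(x \<otimes> x) \<otimes> (x \<otimes> x) = \<one>"
begin

text \<open>
  The subgroup generated by \<open>c\<close> and \<open>x^2\<close>. It is abelian and inverted by \<open>x\<close>, so it is the \<open>C\<close> of
  \<open>balanced_if_inverted_abelian\<close>. For the dihedral and dicyclic groups it is generated by \<open>c\<close>; for
  \<open>C4_sdprod_C4\<close> it is larger.
\<close>

definition core :: "'a set" where
  "core = {e \<otimes> c [^] (i :: nat) | e i. e \<in> {\<one>, x \<otimes> x}}"

lemma xx_commutes: "(x \<otimes> x) \<otimes> c [^] (i :: nat) = c [^] i \<otimes> (x \<otimes> x)"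
proof -
  have "(x \<otimes> x) \<otimes> c [^] i = x \<otimes> (x \<otimes> c [^] i)" using x c by (simp add: m_assoc)
  also have "\<dots> = x \<otimes> inv (c [^] i) \<otimes> x" unfolding pow_inverted[OF c x inverts] using x c by (simp add: m_assoc)
  also have "x \<otimes> inv (c [^] i) = c [^] i \<otimes> x"
    using invertsD(1)[OF pow_inverted[OF c x inverts] x] c by simp
  finally show ?thesis using x c by (simp add: m_assoc)
qed

lemma core_mult:
  assumes "e \<in> {\<one>, x \<otimes> x}" "e' \<in> {\<one>, x \<otimes> x}"
  shows "(e \<otimes> c [^] (i :: nat)) \<otimes> (e' \<otimes> c [^] (j :: nat)) = (e \<otimes> e') \<otimes> c [^] (i + j)"
    "e \<otimes> e' \<in> {\<one>, x \<otimes> x}" "e \<otimes> e' = e' \<otimes> e"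
proof -
  have ec: "e \<in> carrier G" "e' \<in> carrier G" using assms x by auto
  have "c [^] i \<otimes> e' = e' \<otimes> c [^] i" using assms(2) xx_commutes[of i] c by auto
  then have "(e \<otimes> c [^] i) \<otimes> (e' \<otimes> c [^] j) = (e \<otimes> e') \<otimes> (c [^] i \<otimes> c [^] j)"
    using ec c by (metis m_assoc m_closed nat_pow_closed)
  then show "(e \<otimes> c [^] i) \<otimes> (e' \<otimes> c [^] j) = (e \<otimes> e') \<otimes> c [^] (i + j)" using c by (simp add: nat_pow_mult)
  show "e \<otimes> e' \<in> {\<one>, x \<otimes> x}" "e \<otimes> e' = e' \<otimes> e" using assms x yy by auto
qed

lemma core_carrier: "w \<in> core \<Longrightarrow> w \<in> carrier G"
  unfolding core_def using c x by auto

lemma core_commutes: "u \<in> core \<Longrightarrow> v \<in> core \<Longrightarrow> u \<otimes> v = v \<otimes> u"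
proof -
  assume "u \<in> core" "v \<in> core"
  then obtain e e' and i j :: nat where uv: "u = e \<otimes> c [^] i" "v = e' \<otimes> c [^] j" "e \<in> {\<one>, x \<otimes> x}" "e' \<in> {\<one>, x \<otimes> x}"
    unfolding core_def by blast
  show ?thesis unfolding uv(1,2) core_mult(1)[OF uv(3,4)] core_mult(1)[OF uv(4,3)] core_mult(3)[OF uv(3,4)]
    by (simp add: add.commute)
qed

lemma subgroup_core: "subgroup core G"
proof (rule subgroupI)
  show "core \<subseteq> carrier G" using core_carrier by blast
  show "core \<noteq> {}" unfolding core_def by blast
next
  fix u v assume "u \<in> core" "v \<in> core"
  then obtain e e' and i j :: nat where uv: "u = e \<otimes> c [^] i" "v = e' \<otimes> c [^] j" "e \<in> {\<one>, x \<otimes> x}" "e' \<in> {\<one>, x \<otimes> x}"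
    unfolding core_def by blast
  show "u \<otimes> v \<in> core" unfolding uv(1,2) core_mult(1)[OF uv(3,4)] core_def using core_mult(2)[OF uv(3,4)] by blast
next
  fix u assume "u \<in> core"
  then obtain e and i :: nat where u: "u = e \<otimes> c [^] i" "e \<in> {\<one>, x \<otimes> x}" unfolding core_def by blast
  let ?v = "e \<otimes> c [^] ((n - 1) * i)"
  have ec: "e \<in> carrier G" using u(2) x by auto
  have ee: "e \<otimes> e = \<one>" using u(2) yy by auto
  have "?v \<otimes> u = c [^] ((n - 1) * i + i)" unfolding u(1) core_mult(1)[OF u(2,2)] ee using c by simp
  also have "(n - 1) * i + i = n * i" using n by (metis Suc_pred' add.commute mult_Suc One_nat_def)
  also have "c [^] (n * i) = \<one>" using n(2) c by (metis nat_pow_one nat_pow_pow)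
  finally have "inv u = ?v" using ec c u(1) by (intro inv_equality) simp_all
  then show "inv u \<in> core" unfolding core_def using u(2) by blast
qed

lemma core_inverted: "w \<in> core \<Longrightarrow> x \<otimes> w = inv w \<otimes> x"
proof -
  assume "w \<in> core"
  then obtain e and i :: nat where w: "w = e \<otimes> c [^] i" "e \<in> {\<one>, x \<otimes> x}" unfolding core_def by blast
  have ec: "e \<in> carrier G" using w(2) x by auto
  have ie: "inv e = e" using w(2) yy x by (auto simp: inv_equality)
  have xe: "x \<otimes> e = e \<otimes> x" using w(2) x by (auto simp: m_assoc)
  have "e \<otimes> c [^] i = c [^] i \<otimes> e" using w(2) xx_commutes[of i] c by auto
  then have "inv w = e \<otimes> inv (c [^] i)" unfolding w(1) using ec c by (simp add: inv_mult_group ie)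
  moreover have "x \<otimes> w = e \<otimes> (x \<otimes> c [^] i)" unfolding w(1) using ec c x xe by (metis m_assoc nat_pow_closed)
  ultimately show ?thesis unfolding pow_inverted[OF c x inverts] using ec c x by (simp add: m_assoc)
qed

lemma core_cover:
  assumes g: "g = c [^] (i :: nat) \<otimes> x [^] (j :: nat)"
  shows "g \<in> core \<or> (\<exists>w\<in>core. g = w \<otimes> x)"
proof -
  have pow: "x [^] (2 * q) \<in> {\<one>, x \<otimes> x}" for q :: nat
    unfolding square_pow[OF x, symmetric] by (induction q) (use x yy in auto)
  have comm: "c [^] i \<otimes> e = e \<otimes> c [^] i" if "e \<in> {\<one>, x \<otimes> x}" for e using that xx_commutes[of i] c by auto
  consider q where "j = 2 * q" | q where "j = Suc (2 * q)"
    by (cases "even j") (auto elim!: evenE oddE)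
  then show ?thesis
  proof cases
    case 1
    then have "g = x [^] (2 * q) \<otimes> c [^] i" using g comm[OF pow] by simp
    then show ?thesis unfolding core_def using pow by blast
  next
    case 2
    have "g = (c [^] i \<otimes> x [^] (2 * q)) \<otimes> x" using g 2 c x by (simp add: m_assoc)
    then have "g = (x [^] (2 * q) \<otimes> c [^] i) \<otimes> x" using comm[OF pow] by simp
    then show ?thesis unfolding core_def using pow by blast
  qed
qed

lemma core_square:
  assumes cc: "c \<otimes> c = x \<otimes> x" and w: "w \<in> core"
  shows "w \<otimes> w \<in> {\<one>, x \<otimes> x}"
proof -
  obtain e and i :: nat where e: "w = e \<otimes> c [^] i" "e \<in> {\<one>, x \<otimes> x}" using w unfolding core_def by blast
  have ee: "e \<otimes> e = \<one>" using e(2) yy by auto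
  have "w \<otimes> w = c [^] (2 * i)" unfolding e(1) core_mult(1)[OF e(2,2)] ee using c by (simp add: mult_2)
  also have "\<dots> = (x \<otimes> x) [^] i" unfolding square_pow[OF c, symmetric] cc ..
  also have "\<dots> \<in> {\<one>, x \<otimes> x}" by (induction i) (use x yy in auto)
  finally show ?thesis .
qed

lemma generator_in_core: "c \<in> core"
  unfolding core_def by (rule CollectI, rule exI[of _ \<one>], rule exI[of _ 1]) (use c in simp)

text \<open>
  Modulo \<open>{\<one>, x^2}\<close> the subgroup \<open>core\<close> consists of the powers \<open>c^i\<close> with \<open>i < r \<le> 5\<close>.
\<close>

lemma balanced_if_small_core:
  assumes fin: "finite (carrier G)" and r: "0 < r" "r \<le> 5" "c [^] (r :: nat) \<in> {\<one>, x \<otimes> x}"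
    and cov: "carrier G \<subseteq> normal_form c x k m"
  shows "balanced G"
proof (rule balanced_if_inverted_abelian[OF fin subgroup_core core_commutes x _ core_inverted])
  show "x \<otimes> x \<in> core" unfolding core_def
    by (rule CollectI, rule exI[of _ "x \<otimes> x"], rule exI[of _ 0]) (use x in simp)
  show "g \<in> core \<or> (\<exists>w\<in>core. g = w \<otimes> x)" if "g \<in> carrier G" for g
    using core_cover[of g] that cov unfolding normal_form_def by blast
  have "w \<in> thick (x \<otimes> x) ((\<lambda>i. c [^] i) ` {..<r})" if w: "w \<in> core" for w
  proof -
    obtain e and i :: nat where e: "w = e \<otimes> c [^] i" "e \<in> {\<one>, x \<otimes> x}" using w unfolding core_def by blast
    have p: "(c [^] r) [^] (q :: nat) \<in> {\<one>, x \<otimes> x}" for q by (induction q) (use r(3) x yy in auto)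
    define e' where "e' = (c [^] r) [^] (i div r)"
    have e'1: "e' \<in> {\<one>, x \<otimes> x}" unfolding e'_def by (rule p)
    have "c [^] i = c [^] (r * (i div r) + i mod r)" by simp
    also have "\<dots> = e' \<otimes> c [^] (i mod r)" unfolding e'_def using c by (simp only: nat_pow_mult nat_pow_pow nat_pow_closed)
    finally have "w = (e \<otimes> e') \<otimes> c [^] (i mod r)" using e e'1 c x by (metis insertE m_assoc m_closed nat_pow_closed one_closed singletonD)
    moreover have "i mod r \<in> {..<r}" using r by simp
    ultimately show ?thesis using core_mult(2)[OF e(2) e'1] c by (auto simp: thick_def)
  qed
  then have "core \<subseteq> thick (x \<otimes> x) ((\<lambda>i. c [^] i) ` {..<r})" by blast
  moreover have "(\<lambda>i. c [^] i) ` {..<r} \<subseteq> core"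
  proof (rule image_subsetI)
    fix i :: nat
    show "c [^] i \<in> core" unfolding core_def
      by (rule CollectI, rule exI[of _ \<one>], rule exI[of _ i]) (use c in simp)
  qed
  moreover have "card ((\<lambda>i. c [^] i) ` {..<r}) \<le> 5" using r card_image_le[of "{..<r}" "\<lambda>i. c [^] i"] by simp
  ultimately show "(\<forall>c\<in>core. c \<otimes> c \<in> {\<one>, x \<otimes> x}) \<or>
      (\<exists>F\<subseteq>core. finite F \<and> card F \<le> 5 \<and> core \<subseteq> thick (x \<otimes> x) F)"
    by (intro disjI2 exI[of _ "(\<lambda>i. c [^] i) ` {..<r}"]) simp
qed

end

lemma finite_normal_form: "finite (normal_form c x n m)"
proof -
  have "normal_form c x n m = (\<lambda>(i, j). c [^] i \<otimes> x [^] j) ` ({..<n} \<times> {..<m})"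
    unfolding normal_form_def by auto
  then show ?thesis by simp
qed

end

lemma balanced_dihedral:
  assumes n: "0 < n" "n \<le> 5"
  shows "group (dihedral n)" "balanced (dihedral n)"
proof -
  note s = dihedral_structure[OF n(1)]
  show "group (dihedral n)" unfolding s(1) by (rule group_presented_group)
  then interpret group "dihedral n" .
  note f = s(2-7)
  obtain c x where cx: "c \<in> carrier (dihedral n)" "x \<in> carrier (dihedral n)" "x \<otimes>\<^bsub>dihedral n\<^esub> c = inv\<^bsub>dihedral n\<^esub> c \<otimes>\<^bsub>dihedral n\<^esub> x"
    "c [^]\<^bsub>dihedral n\<^esub> n = \<one>\<^bsub>dihedral n\<^esub>" "x [^]\<^bsub>dihedral n\<^esub> (2::nat) = \<one>\<^bsub>dihedral n\<^esub>" "carrier (dihedral n) \<subseteq> normal_form c x n 2"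
    using f by blast
  have xx: "x \<otimes>\<^bsub>dihedral n\<^esub> x = \<one>\<^bsub>dihedral n\<^esub>" using cx(2,5) by (simp add: numeral_2_eq_2)
  show "balanced (dihedral n)"
    by (rule balanced_if_small_core[OF cx(1-3) n(1) cx(4) _ _ n _ cx(6)])
      (use xx cx(4) finite_subset[OF cx(6) finite_normal_form] in simp_all)
qed

lemma balanced_dicyclic:
  assumes n: "0 < n" "n \<le> 5"
  shows "group (dicyclic n)" "balanced (dicyclic n)"
proof -
  note s = dicyclic_structure[OF n(1)]
  show "group (dicyclic n)" unfolding s(1) by (rule group_presented_group)
  then interpret group "dicyclic n" .
  note f = s(2-7)
  obtain c x where cx: "c \<in> carrier (dicyclic n)" "x \<in> carrier (dicyclic n)" "x \<otimes>\<^bsub>dicyclic n\<^esub> c = inv\<^bsub>dicyclic n\<^esub> c \<otimes>\<^bsub>dicyclic n\<^esub> x"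
    "c [^]\<^bsub>dicyclic n\<^esub> (2 * n) = \<one>\<^bsub>dicyclic n\<^esub>" "x [^]\<^bsub>dicyclic n\<^esub> (2::nat) = c [^]\<^bsub>dicyclic n\<^esub> n" "carrier (dicyclic n) \<subseteq> normal_form c x (2 * n) 2"
    using f by blast
  have xx: "x \<otimes>\<^bsub>dicyclic n\<^esub> x = c [^]\<^bsub>dicyclic n\<^esub> n" using cx(2,5) by (simp add: numeral_2_eq_2)
  have "0 < 2 * n" using n by simp
  show "balanced (dicyclic n)"
    by (rule balanced_if_small_core[OF cx(1-3) \<open>0 < 2 * n\<close> cx(4) _ _ n _ cx(6)])
      (use xx cx(1,4) finite_subset[OF cx(6) finite_normal_form] in \<open>simp_all add: nat_pow_mult mult_2\<close>)
qed

lemma balanced_C4_sdprod_C4: "group C4_sdprod_C4" "balanced C4_sdprod_C4"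
proof -
  note s = C4_sdprod_C4_structure
  show "group C4_sdprod_C4" unfolding s(1) by (rule group_presented_group)
  then interpret group C4_sdprod_C4 .
  note f = s(2-7)
  obtain c x where cx: "c \<in> carrier C4_sdprod_C4" "x \<in> carrier C4_sdprod_C4" "x \<otimes>\<^bsub>C4_sdprod_C4\<^esub> c = inv\<^bsub>C4_sdprod_C4\<^esub> c \<otimes>\<^bsub>C4_sdprod_C4\<^esub> x"
    "c [^]\<^bsub>C4_sdprod_C4\<^esub> (4::nat) = \<one>\<^bsub>C4_sdprod_C4\<^esub>" "x [^]\<^bsub>C4_sdprod_C4\<^esub> (4::nat) = \<one>\<^bsub>C4_sdprod_C4\<^esub>" "carrier C4_sdprod_C4 \<subseteq> normal_form c x 4 4"
    using f by blast
  have xx: "(x \<otimes>\<^bsub>C4_sdprod_C4\<^esub> x) \<otimes>\<^bsub>C4_sdprod_C4\<^esub> (x \<otimes>\<^bsub>C4_sdprod_C4\<^esub> x) = \<one>\<^bsub>C4_sdprod_C4\<^esub>"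
    using cx(2,5) by (simp add: eval_nat_numeral m_assoc)
  show "balanced C4_sdprod_C4"
    by (rule balanced_if_small_core[OF cx(1-3) _ cx(4) xx _ _ _ _ cx(6), of 4])
      (use xx cx(1,4) finite_subset[OF cx(6) finite_normal_form] in simp_all)
qed

lemma elementary_two_group:
  fixes n :: nat
  defines "E \<equiv> product_group {..<n} (\<lambda>_. integer_mod_group 2)"
  shows "group E" "finite (carrier E)" "\<And>u v. u \<in> carrier E \<Longrightarrow> v \<in> carrier E \<Longrightarrow> u \<otimes>\<^bsub>E\<^esub> v = v \<otimes>\<^bsub>E\<^esub> u"
    "\<And>u. u \<in> carrier E \<Longrightarrow> u \<otimes>\<^bsub>E\<^esub> u = \<one>\<^bsub>E\<^esub>"
proof -
  show "group E" unfolding E_def by simp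
  show "finite (carrier E)" unfolding E_def by (simp add: finite_PiE carrier_integer_mod_group)
  show "u \<otimes>\<^bsub>E\<^esub> v = v \<otimes>\<^bsub>E\<^esub> u" for u v unfolding E_def by (simp add: add.commute)
  show "u \<otimes>\<^bsub>E\<^esub> u = \<one>\<^bsub>E\<^esub>" for u unfolding E_def by (auto simp: restrict_def)
qed

text \<open>
  The squares of the abelian subgroup \<open>core \<times> E\<close> are trivial or equal to the square of \<open>(x, \<one>)\<close>.
\<close>

lemma balanced_dicyclic_times_elementary:
  fixes n :: nat
  defines "E \<equiv> product_group {..<n} (\<lambda>_. integer_mod_group 2)"
  shows "group (dicyclic 2 \<times>\<times> E)" "balanced (dicyclic 2 \<times>\<times> E)"
proof -
  note E = elementary_two_group[where n = n, folded E_def]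
  have gQ: "group (dicyclic 2)" by (rule balanced_dicyclic(1)) simp_all
  interpret E: group E by (rule E)
  interpret Q: group "dicyclic 2" by (rule gQ)
  interpret G: group "dicyclic 2 \<times>\<times> E" by (intro DirProd_group E(1) gQ)
  let ?Q = "dicyclic 2"
  show "group (dicyclic 2 \<times>\<times> E)" by (rule G.is_group)
  have s0: "0 < (2::nat)" by simp
  note s = dicyclic_structure[OF s0]
  obtain c x where cx: "c \<in> carrier ?Q" "x \<in> carrier ?Q" "x \<otimes>\<^bsub>?Q\<^esub> c = inv\<^bsub>?Q\<^esub> c \<otimes>\<^bsub>?Q\<^esub> x"
    "c [^]\<^bsub>?Q\<^esub> (2 * 2 :: nat) = \<one>\<^bsub>?Q\<^esub>" "x [^]\<^bsub>?Q\<^esub> (2::nat) = c [^]\<^bsub>?Q\<^esub> (2 :: nat)" "carrier ?Q \<subseteq> Q.normal_form c x (2 * 2) 2"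
    using s(2-7) by blast
  have n4: "0 < (2 * 2 :: nat)" by simp
  have xx: "x \<otimes>\<^bsub>?Q\<^esub> x = c \<otimes>\<^bsub>?Q\<^esub> c" using cx(5) unfolding Q.pow_two[OF cx(1)] Q.pow_two[OF cx(2)] .
  have cc: "(c \<otimes>\<^bsub>?Q\<^esub> c) \<otimes>\<^bsub>?Q\<^esub> (c \<otimes>\<^bsub>?Q\<^esub> c) = \<one>\<^bsub>?Q\<^esub>" using cx(4) Q.pow_four[OF cx(1)] by simp
  have yy: "(x \<otimes>\<^bsub>?Q\<^esub> x) \<otimes>\<^bsub>?Q\<^esub> (x \<otimes>\<^bsub>?Q\<^esub> x) = \<one>\<^bsub>?Q\<^esub>" using cc xx by simp
  define C where "C = Q.core c x"
  have C: "subgroup C ?Q" "\<And>u v. u \<in> C \<Longrightarrow> v \<in> C \<Longrightarrow> u \<otimes>\<^bsub>?Q\<^esub> v = v \<otimes>\<^bsub>?Q\<^esub> u"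
    "\<And>w. w \<in> C \<Longrightarrow> x \<otimes>\<^bsub>?Q\<^esub> w = inv\<^bsub>?Q\<^esub> w \<otimes>\<^bsub>?Q\<^esub> x"
    unfolding C_def using Q.subgroup_core[OF cx(1-3) n4 cx(4) yy] Q.core_commutes[OF cx(1-3) n4 cx(4) yy]
      Q.core_inverted[OF cx(1-3) n4 cx(4) yy] by blast+
  have Ccov: "g \<in> C \<or> (\<exists>w\<in>C. g = w \<otimes>\<^bsub>?Q\<^esub> x)" if gQ': "g \<in> carrier ?Q" for g
  proof -
    have "g \<in> Q.normal_form c x (2 * 2) 2" using cx(6) gQ' by (rule subsetD)
    then obtain i j :: nat where g: "g = c [^]\<^bsub>?Q\<^esub> i \<otimes>\<^bsub>?Q\<^esub> x [^]\<^bsub>?Q\<^esub> j" unfolding Q.normal_form_def by blast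
    show ?thesis unfolding C_def by (rule Q.core_cover[OF cx(1-3) n4 cx(4) yy g])
  qed
  interpret C: subgroup C ?Q by (rule C)
  have xxC: "x \<otimes>\<^bsub>?Q\<^esub> x \<in> C"
  proof -
    have "c \<in> C" unfolding C_def by (rule Q.generator_in_core[OF cx(1-3) n4 cx(4) yy])
    then show ?thesis unfolding xx by (intro C.m_closed)
  qed
  have Csq: "w \<otimes>\<^bsub>?Q\<^esub> w \<in> {\<one>\<^bsub>?Q\<^esub>, x \<otimes>\<^bsub>?Q\<^esub> x}" if "w \<in> C" for w
    using Q.core_square[OF cx(1-3) n4 cx(4) yy xx[symmetric]] that unfolding C_def .
  let ?x = "(x, \<one>\<^bsub>E\<^esub>)"
  show "balanced (dicyclic 2 \<times>\<times> E)"
  proof (rule G.balanced_if_inverted_abelian[of "C \<times> carrier E" ?x])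
    have "finite (carrier ?Q)" using cx(6) Q.finite_normal_form finite_subset by blast
    then show "finite (carrier (dicyclic 2 \<times>\<times> E))" using E(2) by simp
    show "subgroup (C \<times> carrier E) (dicyclic 2 \<times>\<times> E)"
      by (rule DirProd_subgroups[OF gQ C(1) E(1) E.subgroup_self])
    show "?x \<in> carrier (dicyclic 2 \<times>\<times> E)" using cx by simp
    show "?x \<otimes>\<^bsub>dicyclic 2 \<times>\<times> E\<^esub> ?x \<in> C \<times> carrier E" using xxC by simp
    show "u \<otimes>\<^bsub>dicyclic 2 \<times>\<times> E\<^esub> v = v \<otimes>\<^bsub>dicyclic 2 \<times>\<times> E\<^esub> u" if "u \<in> C \<times> carrier E" "v \<in> C \<times> carrier E" for u v
      using that C(2) E(3) by (cases u; cases v) (simp add: mult_DirProd)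
    show "?x \<otimes>\<^bsub>dicyclic 2 \<times>\<times> E\<^esub> w = inv\<^bsub>dicyclic 2 \<times>\<times> E\<^esub> w \<otimes>\<^bsub>dicyclic 2 \<times>\<times> E\<^esub> ?x" if wC: "w \<in> C \<times> carrier E" for w
    proof (cases w)
      case (Pair u v)
      have uv: "u \<in> C" "v \<in> carrier E" using wC Pair by simp_all
      have "inv\<^bsub>E\<^esub> v = v" using E.inv_equality[OF E(4)[OF uv(2)] uv(2) uv(2)] .
      then show ?thesis using Pair uv C(3)[OF uv(1)] inv_DirProd[OF gQ E(1), of u v] by simp
    qed
    show "g \<in> C \<times> carrier E \<or> (\<exists>w\<in>C \<times> carrier E. g = w \<otimes>\<^bsub>dicyclic 2 \<times>\<times> E\<^esub> ?x)"
      if gG: "g \<in> carrier (dicyclic 2 \<times>\<times> E)" for g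
    proof (cases g)
      case (Pair u v)
      have uv: "u \<in> carrier ?Q" "v \<in> carrier E" using gG Pair by simp_all
      from Ccov[OF uv(1)] show ?thesis
      proof
        assume "\<exists>w\<in>C. u = w \<otimes>\<^bsub>?Q\<^esub> x"
        then obtain w where "w \<in> C" "u = w \<otimes>\<^bsub>?Q\<^esub> x" by blast
        then have "g = (w, v) \<otimes>\<^bsub>dicyclic 2 \<times>\<times> E\<^esub> ?x" "(w, v) \<in> C \<times> carrier E" using Pair uv by simp_all
        then show ?thesis by blast
      qed (use Pair uv in simp)
    qed
    have "w \<otimes>\<^bsub>dicyclic 2 \<times>\<times> E\<^esub> w \<in> {\<one>\<^bsub>dicyclic 2 \<times>\<times> E\<^esub>, ?x \<otimes>\<^bsub>dicyclic 2 \<times>\<times> E\<^esub> ?x}" if "w \<in> C \<times> carrier E" for w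
      using that Csq E(4) by (cases w) auto
    then show "(\<forall>w\<in>C \<times> carrier E. w \<otimes>\<^bsub>dicyclic 2 \<times>\<times> E\<^esub> w \<in> {\<one>\<^bsub>dicyclic 2 \<times>\<times> E\<^esub>, ?x \<otimes>\<^bsub>dicyclic 2 \<times>\<times> E\<^esub> ?x}) \<or>
      (\<exists>F\<subseteq>C \<times> carrier E. finite F \<and> card F \<le> 5 \<and> C \<times> carrier E \<subseteq> G.thick (?x \<otimes>\<^bsub>dicyclic 2 \<times>\<times> E\<^esub> ?x) F)"
      by blast
  qed
qed

section \<open>Recognizing the groups with a small inverted subgroup\<close>

context group begin

lemma cover_normal_form:
  fixes n m k :: nat
  assumes c: "c \<in> carrier G" and x: "x \<in> carrier G" and inv: "x \<otimes> c = inv c \<otimes> x"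
    and n: "c [^] n = \<one>" "0 < n" and m: "x [^] m = c [^] k" "0 < m"
    and cov: "\<And>y. y \<in> carrier G \<Longrightarrow> \<exists>w\<in>{\<one>, c, c \<otimes> c, inv c, inv (c \<otimes> c)}. \<exists>e\<in>{\<one>, x \<otimes> x}. y = e \<otimes> w \<or> y \<otimes> x = e \<otimes> w"
  shows "carrier G \<subseteq> normal_form c x n m"
proof
  fix y assume y: "y \<in> carrier G"
  note mul = normal_form_mult[OF c x inv n m]
  have one: "\<one> \<in> normal_form c x n m" by (rule one_in_normal_form[OF c x inv n m])
  have ix: "inv x \<in> normal_form c x n m" using mul(4)[OF one] x by simp
  have W: "w \<otimes> p \<in> normal_form c x n m"
    if w: "w \<in> {\<one>, c, c \<otimes> c, inv c, inv (c \<otimes> c)}" and p: "p \<in> normal_form c x n m" "p \<in> carrier G" for w p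
  proof -
    have "c \<otimes> (c \<otimes> p) \<in> normal_form c x n m" "inv c \<otimes> (inv c \<otimes> p) \<in> normal_form c x n m"
      "\<one> \<otimes> p \<in> normal_form c x n m" "c \<otimes> p \<in> normal_form c x n m" "inv c \<otimes> p \<in> normal_form c x n m"
      using mul p by simp_all
    then have "c \<otimes> c \<otimes> p \<in> normal_form c x n m" "inv (c \<otimes> c) \<otimes> p \<in> normal_form c x n m"
      using c p by (simp_all add: m_assoc inv_mult_group)
    then show ?thesis using w mul p \<open>\<one> \<otimes> p \<in> _\<close> by blast
  qed
  have E: "e \<otimes> p \<in> normal_form c x n m"
    if e: "e \<in> {\<one>, x \<otimes> x}" and p: "p \<in> normal_form c x n m" "p \<in> carrier G" for e p
  proof -
    have "x \<otimes> (x \<otimes> p) \<in> normal_form c x n m" using mul p by simp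
    then have "x \<otimes> x \<otimes> p \<in> normal_form c x n m" using x p by (simp add: m_assoc)
    then show ?thesis using e p by auto
  qed
  obtain w e where w: "w \<in> {\<one>, c, c \<otimes> c, inv c, inv (c \<otimes> c)}" and e: "e \<in> {\<one>, x \<otimes> x}"
    and ye: "y = e \<otimes> w \<or> y \<otimes> x = e \<otimes> w" using cov[OF y] by blast
  have wc: "w \<in> carrier G" "e \<in> carrier G" using w e c x by auto
  from ye show "y \<in> normal_form c x n m"
  proof
    assume "y = e \<otimes> w"
    then show ?thesis using E[OF e W[OF w one one_closed]] wc by simp
  next
    assume "y \<otimes> x = e \<otimes> w"
    then have "y = e \<otimes> (w \<otimes> inv x)" using wc x y by (metis inv_solve_right m_assoc inv_closed m_closed)
    then show ?thesis using E[OF e W[OF w ix]] wc x by simp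
  qed
qed

lemma not_pow_of_inverted:
  fixes i :: nat
  assumes c: "c \<in> carrier G" and x: "x \<in> carrier G" and inv: "x \<otimes> c = inv c \<otimes> x" and cc: "c \<otimes> c \<noteq> \<one>"
  shows "c [^] i \<otimes> x \<noteq> \<one>"
proof
  assume "c [^] i \<otimes> x = \<one>"
  then have xi: "x = inv (c [^] i)" using c x by (metis inv_equality inv_inv nat_pow_closed)
  have "c [^] i \<otimes> c = c \<otimes> c [^] i" using c by (metis nat_pow_Suc nat_pow_Suc2)
  then have "inv (c [^] i) \<otimes> c = c \<otimes> inv (c [^] i)"
    using c by (metis inv_closed inv_solve_left inv_solve_right m_assoc m_closed nat_pow_closed)
  then have "inv c \<otimes> x = c \<otimes> x" using inv xi by simp
  then have "inv c = c" using c x by simp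
  then show False using cc c by (metis r_inv)
qed

text \<open>
  A power of \<open>c\<close> commutes with \<open>c\<close>, but \<open>x\<close> does not, because it inverts \<open>c\<close> and \<open>c^2 \<noteq> \<one>\<close>.
\<close>

lemma normal_form_unique:
  fixes i j :: nat
  assumes c: "c \<in> carrier G" "c \<otimes> c \<noteq> \<one>" and x: "x \<in> carrier G" "x \<otimes> c = inv c \<otimes> x"
    and ij: "i < ord c" "j < 2" "c [^] i \<otimes> x [^] j = \<one>"
  shows "i = 0 \<and> j = 0"
proof -
  have "j \<noteq> 1" using not_pow_of_inverted[OF c(1) x c(2)] ij x by auto
  then have j: "j = 0" using ij by simp
  then have "ord c dvd i" using ij c(1) pow_eq_id[OF c(1), of i] by simp
  then show ?thesis using j ij(1) by (auto dest: dvd_imp_le)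
qed

lemma ord_eqI:
  assumes c: "c \<in> carrier G" "c \<otimes> c \<noteq> \<one>" and n: "n \<in> {3, 4, 5}" "c [^] n = \<one>"
  shows "ord c = n"
proof -
  have d: "ord c dvd n" using pow_eq_id[OF c(1)] n by simp
  have nd: "\<not> ord c dvd 2" using pow_eq_id[OF c(1), of 2] c pow_two[OF c(1)] by simp
  have "ord c \<le> n" using d n by (intro dvd_imp_le) auto
  then have "ord c \<in> {0, 1, 2, 3, 4, 5}" using n by auto
  then show ?thesis using d nd n(1) by auto
qed

lemma ord_eq_doubleI:
  assumes c: "c \<in> carrier G" "c \<otimes> c \<noteq> \<one>" and n: "n \<in> {3, 4, 5}" "c [^] n \<noteq> \<one>" "c [^] (2 * n) = \<one>"
  shows "ord c = 2 * n"
proof -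
  have d: "ord c dvd 2 * n" "\<not> ord c dvd n" using pow_eq_id[OF c(1)] n by simp_all
  have nd: "\<not> ord c dvd 2" using pow_eq_id[OF c(1), of 2] c pow_two[OF c(1)] by simp
  have "ord c \<le> 2 * n" using d n by (intro dvd_imp_le) auto
  also have "\<dots> \<le> 10" using n(1) by auto
  finally have "ord c \<in> {0, 1, 2, 3, 4, 5, 6, 7, 8, 9, 10}"
    by (simp add: numeral_eq_Suc le_Suc_eq)
  then show ?thesis using n(1) d nd by (elim insertE emptyE) simp_all
qed

lemma pow_three: "x \<in> carrier G \<Longrightarrow> x [^] (3::nat) = x \<otimes> x \<otimes> x"
  by (simp add: eval_nat_numeral)

lemma pow_five: "x \<in> carrier G \<Longrightarrow> x [^] (5::nat) = x \<otimes> x \<otimes> x \<otimes> x \<otimes> x"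
  by (simp add: eval_nat_numeral)

lemma iso_dicyclic_of_cover:
  assumes a: "a \<in> carrier G" and x: "x \<in> carrier G" and inv: "x \<otimes> a = inv a \<otimes> x"
    and z: "x \<otimes> x \<noteq> \<one>" "(x \<otimes> x) \<otimes> (x \<otimes> x) = \<one>" and aa: "a \<otimes> a \<noteq> \<one>"
    and n: "n \<in> {3, 4, 5}" "a [^] n = x \<otimes> x"
    and cov: "\<And>y. y \<in> carrier G \<Longrightarrow> \<exists>w\<in>{\<one>, a, a \<otimes> a, inv a, inv (a \<otimes> a)}. \<exists>e\<in>{\<one>, x \<otimes> x}. y = e \<otimes> w \<or> y \<otimes> x = e \<otimes> w"
  shows "G \<cong> dicyclic n"
proof -
  have a2n: "a [^] (2 * n) = \<one>"
  proof -
    have "a [^] (2 * n) = a [^] n \<otimes> a [^] n" using a by (simp add: nat_pow_mult mult_2)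
    then show ?thesis using n z by simp
  qed
  have n0: "0 < 2 * n" "0 < n" using n by auto
  have o: "ord a = 2 * n" using ord_eq_doubleI[OF a aa n(1) _ a2n] n z by simp
  have x2: "x [^] (2::nat) = a [^] n" using n x by (simp add: pow_two)
  show ?thesis
  proof (rule iso_dicyclicI[OF a x inv a2n n0(2) n(2)[symmetric] cover_normal_form[OF a x inv a2n n0(1) x2 _ cov]])
    fix i j :: nat assume ij: "i < 2 * n" "j < 2" "a [^] i \<otimes> x [^] j = \<one>"
    then show "i = 0 \<and> j = 0" using normal_form_unique[OF a aa x inv] o by simp
  qed simp_all
qed

end

context balanced_group begin

theorem noncentral_involution_iso:
  assumes a: "a \<in> carrier G" "a \<otimes> a = \<one>" and g: "g \<in> carrier G" "a \<otimes> g \<noteq> g \<otimes> a"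
  shows "G \<cong> dihedral 3 \<or> G \<cong> dihedral 4 \<or> G \<cong> dihedral 5"
proof -
  obtain b where b: "b \<in> carrier G" "b \<otimes> b \<noteq> \<one>" "a \<otimes> b = inv b \<otimes> a"
    "b \<otimes> b \<otimes> b = \<one> \<or> b \<otimes> b \<otimes> b \<otimes> b = \<one> \<or> b \<otimes> b \<otimes> b \<otimes> b \<otimes> b = \<one>"
    and cov: "\<And>x. x \<in> carrier G \<Longrightarrow> x \<in> {\<one>, b, b \<otimes> b, inv b, inv (b \<otimes> b)} \<or>
      x \<otimes> a \<in> {\<one>, b, b \<otimes> b, inv b, inv (b \<otimes> b)}"
    by (rule noncentral_involution_dihedral[OF a g]) (rule that)
  have "b [^] (3::nat) = \<one> \<or> b [^] (4::nat) = \<one> \<or> b [^] (5::nat) = \<one>"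
    using b(4) pow_three[OF b(1)] pow_four[OF b(1)] pow_five[OF b(1)] b(1) by (simp add: m_assoc)
  then obtain n :: nat where n: "n \<in> {3, 4, 5}" "b [^] n = \<one>" by blast
  have o: "ord b = n" by (rule ord_eqI[OF b(1,2) n])
  have n0: "0 < n" using n by auto
  have cov': "\<exists>w\<in>{\<one>, b, b \<otimes> b, inv b, inv (b \<otimes> b)}. \<exists>e\<in>{\<one>, a \<otimes> a}. y = e \<otimes> w \<or> y \<otimes> a = e \<otimes> w"
    if y: "y \<in> carrier G" for y
  proof -
    obtain w where w: "w \<in> {\<one>, b, b \<otimes> b, inv b, inv (b \<otimes> b)}" "y = w \<or> y \<otimes> a = w" using cov[OF y] by blast
    then have "w \<in> carrier G" using b(1) by auto
    then have "y = \<one> \<otimes> w \<or> y \<otimes> a = \<one> \<otimes> w" using w(2) by simp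
    then show ?thesis using w(1) by blast
  qed
  have a2: "a [^] (2::nat) = b [^] (0::nat)" using a by (simp add: pow_two)
  have "G \<cong> dihedral n"
  proof (rule iso_dihedralI[OF b(1) a(1) b(3) n(2) n0 a(2) cover_normal_form[OF b(1) a(1) b(3) n(2) n0 a2 _ cov']])
    fix i j :: nat assume ij: "i < n" "j < 2" "b [^] i \<otimes> a [^] j = \<one>"
    then show "i = 0 \<and> j = 0" using normal_form_unique[OF b(1,2) a(1) b(3)] o by simp
  qed simp_all
  then show ?thesis using n(1) by auto
qed

text \<open>
  The element \<open>c\<close> of \<open>nonnormal_order_four\<close> satisfies \<open>c^n \<in> {\<one>, z}\<close> for some \<open>n \<in> {3, 4, 5}\<close>. If
  \<open>c^n = z\<close>, then \<open>c\<close> and \<open>x\<close> satisfy the dicyclic relations. If \<open>c^n = \<one>\<close> and \<open>n\<close> is odd, then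
  \<open>(zc)^n = z\<close>, and \<open>zc\<close> replaces \<open>c\<close>. If \<open>c^4 = \<one>\<close>, the group is \<open>C4_sdprod_C4\<close>.
\<close>

theorem nonnormal_order_four_iso:
  assumes central: "\<And>t g. t \<in> carrier G \<Longrightarrow> t \<otimes> t = \<one> \<Longrightarrow> g \<in> carrier G \<Longrightarrow> t \<otimes> g = g \<otimes> t"
    and x: "x \<in> carrier G" "x \<otimes> x \<noteq> \<one>" "(x \<otimes> x) \<otimes> (x \<otimes> x) = \<one>"
    and g: "g \<in> carrier G" "x \<otimes> g \<noteq> g \<otimes> x" "x \<otimes> g \<noteq> g \<otimes> inv x"
  shows "G \<cong> dicyclic 3 \<or> G \<cong> dicyclic 4 \<or> G \<cong> dicyclic 5 \<or> G \<cong> C4_sdprod_C4"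
proof -
  define z where "z = x \<otimes> x"
  have zc: "z \<in> carrier G" using x by (simp add: z_def)
  have z: "z \<noteq> \<one>" "z \<otimes> z = \<one>" using x by (simp_all add: z_def)
  have iz: "inv z = z" using z zc by (simp add: inv_equality)
  have zcom: "z \<otimes> w = w \<otimes> z" if "w \<in> carrier G" for w using central[OF zc z(2) that] .
  obtain c where c: "c \<in> carrier G" "x \<otimes> c = inv c \<otimes> x" "c \<otimes> c \<noteq> \<one>" "c \<otimes> c \<noteq> z"
    "c \<otimes> c \<otimes> c \<in> {\<one>, z} \<or> c \<otimes> c \<otimes> c \<otimes> c \<in> {\<one>, z} \<or> c \<otimes> c \<otimes> c \<otimes> c \<otimes> c \<in> {\<one>, z}"
    and cov: "\<And>y. y \<in> carrier G \<Longrightarrow> \<exists>w\<in>{\<one>, c, c \<otimes> c, inv c, inv (c \<otimes> c)}. \<exists>e\<in>{\<one>, z}. y = e \<otimes> w \<or> y \<otimes> x = e \<otimes> w"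
    by (rule nonnormal_order_four[OF central x(1) z_def[symmetric] z g]) (auto intro: that)
  have "c [^] (3::nat) \<in> {\<one>, z} \<or> c [^] (4::nat) \<in> {\<one>, z} \<or> c [^] (5::nat) \<in> {\<one>, z}"
    using c(5) pow_three[OF c(1)] pow_four[OF c(1)] pow_five[OF c(1)] c(1) by (simp add: m_assoc)
  then obtain n :: nat where n: "n \<in> {3, 4, 5}" "c [^] n \<in> {\<one>, z}" by blast
  consider "c [^] n = z" | "c [^] n = \<one>" "n \<noteq> 4" | "c [^] (4::nat) = \<one>" using n by auto
  then show ?thesis
  proof cases
    case 1
    have "G \<cong> dicyclic n"
      by (rule iso_dicyclic_of_cover[OF c(1) x(1) c(2) x(2,3) c(3) n(1)]) (use 1 cov in \<open>simp_all only: z_def\<close>)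
    then show ?thesis using n(1) by auto
  next
    case 2
    \<comment> \<open>\<open>c\<close> has odd order \<open>n\<close>, so \<open>z c\<close> has order \<open>2n\<close> and its \<open>n\<close>-th power is \<open>z\<close>\<close>
    define a where "a = z \<otimes> c"
    have ac: "a \<in> carrier G" using zc c by (simp add: a_def)
    have za: "z \<otimes> a = c" using assoc_rewrite[OF z(2) zc zc c(1)] c(1) by (simp add: a_def)
    have ia: "inv a = z \<otimes> inv c" unfolding a_def using zc c(1) zcom[of "inv c"] by (simp add: inv_mult_group iz)
    have zia: "z \<otimes> inv a = inv c" unfolding ia using assoc_rewrite[OF z(2) zc zc, of "inv c"] c(1) by simp
    have aa: "a \<otimes> a = c \<otimes> c"
    proof -
      have "a \<otimes> a = z \<otimes> (c \<otimes> z) \<otimes> c" using zc c(1) by (simp add: a_def m_assoc)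
      also have "\<dots> = (z \<otimes> z) \<otimes> (c \<otimes> c)" unfolding zcom[OF c(1), symmetric] using zc c(1) by (simp add: m_assoc)
      finally show ?thesis using z c(1) by simp
    qed
    have xa: "x \<otimes> a = inv a \<otimes> x"
    proof -
      have "x \<otimes> a = z \<otimes> (x \<otimes> c)" unfolding a_def using zcom[OF x(1)] zc x(1) c(1) by (metis m_assoc)
      then show ?thesis unfolding c(2) ia using zc x(1) c(1) by (simp add: m_assoc)
    qed
    have zpow: "z [^] n = z"
      using 2 n(1) z zc pow_three[OF zc] pow_five[OF zc] by (auto simp: m_assoc)
    have "a [^] n = z [^] n \<otimes> c [^] n" unfolding a_def by (rule pow_mult_distrib[OF zcom[OF c(1)] zc c(1)])
    then have an: "a [^] n = z" using zpow 2 zc by simp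
    have "G \<cong> dicyclic n"
    proof (rule iso_dicyclic_of_cover[OF ac x(1) xa x(2,3) _ n(1)])
      show "a \<otimes> a \<noteq> \<one>" unfolding aa by (rule c(3))
      show "a [^] n = x \<otimes> x" using an by (simp add: z_def)
      fix y assume y: "y \<in> carrier G"
      obtain w e where w: "w \<in> {\<one>, c, c \<otimes> c, inv c, inv (c \<otimes> c)}" "e \<in> {\<one>, z}" "y = e \<otimes> w \<or> y \<otimes> x = e \<otimes> w"
        using cov[OF y] by blast
      have ec: "e \<in> carrier G" using w(2) zc by auto
      have "\<exists>w'\<in>{\<one>, a, a \<otimes> a, inv a, inv (a \<otimes> a)}. \<exists>e'\<in>{\<one>, z}. w = e' \<otimes> w'"
      proof -
        have "\<one> = \<one> \<otimes> \<one>" "c = z \<otimes> a" "c \<otimes> c = \<one> \<otimes> (a \<otimes> a)" "inv c = z \<otimes> inv a" "inv (c \<otimes> c) = \<one> \<otimes> inv (a \<otimes> a)"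
          using za zia aa ac c(1) by simp_all
        then show ?thesis using w(1) by (elim insertE emptyE) blast+
      qed
      then obtain w' e' where w': "w' \<in> {\<one>, a, a \<otimes> a, inv a, inv (a \<otimes> a)}" "e' \<in> {\<one>, z}" "w = e' \<otimes> w'" by blast
      have "w' \<in> carrier G" "e' \<in> carrier G" using w' ac zc by auto
      then have "e \<otimes> w = (e \<otimes> e') \<otimes> w'" using w'(3) ec by (simp add: m_assoc)
      moreover have "e \<otimes> e' \<in> {\<one>, z}" using w(2) w'(2) z zc by auto
      ultimately have "\<exists>w\<in>{\<one>, a, a \<otimes> a, inv a, inv (a \<otimes> a)}. \<exists>e\<in>{\<one>, z}. y = e \<otimes> w \<or> y \<otimes> x = e \<otimes> w"
        using w(3) w'(1) by metis
      then show "\<exists>w\<in>{\<one>, a, a \<otimes> a, inv a, inv (a \<otimes> a)}. \<exists>e\<in>{\<one>, x \<otimes> x}. y = e \<otimes> w \<or> y \<otimes> x = e \<otimes> w"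
        unfolding z_def .
    qed
    then show ?thesis using n(1) by auto
  next
    case 3
    have x4: "x [^] (4::nat) = \<one>" using pow_four[OF x(1)] x(3) by simp
    then have x4c: "x [^] (4::nat) = c [^] (0::nat)" by simp
    have oc: "ord c = 4" by (rule ord_eqI[OF c(1,3) _ 3]) simp
    have "G \<cong> C4_sdprod_C4"
    proof (rule iso_C4_sdprod_C4I[OF c(1) x(1) c(2) 3 x4 cover_normal_form[OF c(1) x(1) c(2) 3 _ x4c _ cov[unfolded z_def]]])
      fix i j :: nat assume ij: "i < 4" "j < 4" "c [^] i \<otimes> x [^] j = \<one>"
      have "j \<noteq> 1" using not_pow_of_inverted[OF c(1) x(1) c(2,3)] ij x by auto
      moreover have "j \<noteq> 3"
      proof
        assume "j = 3"
        then have "c [^] i \<otimes> (x [^] (3::nat)) = \<one>" using ij by simp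
        moreover have "x [^] (3::nat) = inv x"
          using x4 x(1) by (intro inv_equality[symmetric]) (simp_all add: eval_nat_numeral)
        ultimately have "c [^] i \<otimes> inv x = \<one>" by simp
        moreover have "inv x \<otimes> c = inv c \<otimes> inv x" by (rule invertsD(2)[OF c(2) x(1) c(1)])
        ultimately show False using not_pow_of_inverted[of c "inv x" i] c x(1) by simp
      qed
      moreover have "j \<noteq> 2"
      proof
        assume "j = 2"
        then have "c [^] i \<otimes> z = \<one>" using ij x(1) by (simp add: pow_two z_def)
        then have ci: "c [^] i = z" using c(1) zc iz by (metis inv_equality inv_inv nat_pow_closed)
        have "c [^] (2 * i) = z \<otimes> z" unfolding ci[symmetric] using c(1) by (simp add: nat_pow_mult mult_2)
        then have "4 dvd 2 * i" using z pow_eq_id[OF c(1), of "2 * i"] oc by simp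
        then have "i = 0 \<or> i = 2" using ij(1) by auto
        then show False using ci z c by (auto simp: pow_two)
      qed
      ultimately have j: "j = 0" using ij(2) by linarith
      then have "4 dvd i" using ij c(1) pow_eq_id[OF c(1), of i] oc by simp
      then show "i = 0 \<and> j = 0" using j ij(1) by (auto dest: dvd_imp_le)
    qed simp_all
    then show ?thesis by simp
  qed
qed

end

section \<open>Elements of odd order are central\<close>

lemma nat_two_power_odd_decomp:
  fixes n :: nat
  assumes "0 < n"
  obtains i q where "n = 2 ^ i * q" "odd q"
  using assms
proof (induction n arbitrary: thesis rule: less_induct)
  case (less n)
  show ?case
  proof (cases "even n")
    case True
    then obtain m where m: "n = 2 * m" by (elim evenE)
    then obtain i q where "m = 2 ^ i * q" "odd q" using less.IH[of m] less.prems(2) by auto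
    then show ?thesis using less.prems(1)[of "Suc i" q] m by simp
  next
    case False then show ?thesis using less.prems(1)[of 0 n] by simp
  qed
qed

context group begin

lemma subgroup_mem_if_coprime_pows:
  fixes a b :: nat
  assumes K: "subgroup K G" and y: "y \<in> carrier G" "y [^] a \<in> K" "y [^] b \<in> K" and ab: "coprime a b" "a \<noteq> 0"
  shows "y \<in> K"
proof -
  interpret K: subgroup K G by fact
  obtain u v where uv: "a * u = b * v + 1" using bezout_nat[OF ab(2), of b] ab(1) by auto
  have "y [^] (a * u) = y [^] (b * v) \<otimes> y" using y(1) by (simp add: uv)
  moreover have "y [^] (a * u) \<in> K" "y [^] (b * v) \<in> K"
    using subgroup_pow_closed[OF K y(2), of u] subgroup_pow_closed[OF K y(3), of v] y(1) by (simp_all add: nat_pow_pow)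
  ultimately have "inv (y [^] (b * v)) \<otimes> (y [^] (b * v) \<otimes> y) \<in> K" by (metis K.m_closed K.m_inv_closed)
  then show ?thesis using y(1) by (simp add: inv_mult_cancel)
qed

lemma pow_ne_one_of_two_power:
  fixes n k :: nat
  assumes "w \<in> carrier G" "ord w = 2 ^ k" "3 \<le> k" "0 < n" "n < 8"
  shows "w [^] n \<noteq> \<one>"
proof
  assume "w [^] n = \<one>"
  then have "2 ^ k dvd n" using pow_eq_id assms(1,2) by simp
  then have "2 ^ k \<le> n" using assms(4) by (rule dvd_imp_le)
  moreover have "(2::nat) ^ 3 \<le> 2 ^ k" using assms(3) by (intro power_increasing) simp_all
  ultimately show False using assms(5) by simp
qed

lemma ord_dvd_card_subgroup:
  assumes K: "subgroup K G" and k: "k \<in> K"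
  shows "ord k dvd card K"
proof -
  interpret K: subgroup K G by fact
  interpret H: group "G\<lparr>carrier := K\<rparr>" by (rule K.subgroup_is_group) (rule is_group)
  have "k [^]\<^bsub>G\<lparr>carrier := K\<rparr>\<^esub> order (G\<lparr>carrier := K\<rparr>) = \<one>" using H.pow_order_eq_1[of k] k by simp
  then have "k [^] card K = \<one>" unfolding nat_pow_consistent[symmetric] order_def by simp
  moreover have "k \<in> carrier G" using k by (rule K.mem_carrier)
  ultimately show ?thesis using pow_eq_id by blast
qed

lemma eq_one_if_coprime_pows:
  assumes "e \<in> carrier G" "e [^] (a :: nat) = \<one>" "e [^] (b :: nat) = \<one>" "coprime a b"
  shows "e = \<one>"
proof -
  have "ord e dvd a" "ord e dvd b" using assms pow_eq_id by simp_all
  then have "ord e = 1" using assms(4) by (metis coprime_common_divisor_nat)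
  then show ?thesis using assms(1) ord_eq_1 by blast
qed

lemma generate_elem_pow_ord:
  assumes d: "d \<in> carrier G" and fin: "finite (carrier G)" and e: "e \<in> generate G {d}"
  shows "e [^] ord d = \<one>"
proof -
  obtain k :: nat where k: "e = d [^] k" using e generate_pow_on_finite_carrier[OF fin d] by blast
  have "e [^] ord d = (d [^] ord d) [^] k" using d k by (simp add: nat_pow_pow mult.commute del: pow_ord_eq_1)
  then show ?thesis using d by simp
qed

lemma commutes_with_generate:
  assumes k: "k \<in> carrier G" and d: "d \<in> carrier G" and kd: "k \<otimes> d = d \<otimes> k" and e: "e \<in> generate G {d}"
  shows "k \<otimes> e = e \<otimes> k"
proof -
  interpret subgroup "centralizer {k}" G using k by (intro subgroup_centralizer) simp
  have "d \<in> centralizer {k}" using d kd by (simp add: in_centralizer_iff)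
  then have "generate G {d} \<subseteq> centralizer {k}"
    using generate_subgroup_incl[OF _ subgroup_axioms, of "{d}"] by simp
  then show ?thesis using e by (auto simp: in_centralizer_iff)
qed

lemma odd_ord_square_root:
  assumes d: "d \<in> carrier G" "odd (ord d)" and K: "subgroup K G" "d \<otimes> d \<in> K"
  shows "d \<in> K"
proof -
  obtain k where k: "ord d + 1 = 2 * k" using d(2) by (metis evenE odd_even_add odd_one)
  have "(d \<otimes> d) [^] k = d [^] (ord d + 1)" unfolding k square_pow[OF d(1)] ..
  also have "\<dots> = d" using d by simp
  finally show ?thesis using subgroup_pow_closed[OF K, of k] by simp
qed

end

text \<open>
  The case that remains after noncentral involutions and non-normal cyclic subgroups of order four
  have been treated.
\<close>

locale central_involutions = balanced_group +
  assumes involution_central: "\<And>t g. t \<in> carrier G \<Longrightarrow> t \<otimes> t = \<one> \<Longrightarrow> g \<in> carrier G \<Longrightarrow> t \<otimes> g = g \<otimes> t"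
    and order_four_normal: "\<And>x g. x \<in> carrier G \<Longrightarrow> x \<otimes> x \<noteq> \<one> \<Longrightarrow> (x \<otimes> x) \<otimes> (x \<otimes> x) = \<one> \<Longrightarrow>
      g \<in> carrier G \<Longrightarrow> x \<otimes> g = g \<otimes> x \<or> x \<otimes> g = g \<otimes> inv x"
begin

text \<open>
  Let \<open>K\<close> be the centralizer of \<open>d\<close> and let \<open>y \<notin> K\<close> have least order. Powers of \<open>y\<close> of smaller order
  lie in \<open>K\<close>, so the order of \<open>y\<close> is odd or a power of two.
  If it is odd, then \<open>y^2 \<notin> K\<close>, so \<open>coset_test_sign\<close> shows that \<open>y\<close> inverts \<open>d\<close>, and then \<open>y^2\<close>
  commutes with \<open>d\<close> after all. Orders two and four contradict the hypotheses on
  involutions and cyclic subgroups of order four. If the order is a larger power of two, then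
  \<open>coset_test_square\<close> for \<open>h = d y^2\<close> expresses \<open>y h y^-1\<close> by powers of \<open>h\<close> and \<open>y^2\<close>. The subgroups
  generated by \<open>d\<close> and \<open>y\<close> have coprime orders, so their parts can be compared separately; no
  possibility is left.
\<close>

lemma odd_order_commutes:
  assumes d: "d \<in> carrier G" "odd (ord d)" and y: "y \<in> carrier G"
  shows "y \<otimes> d = d \<otimes> y"
proof (rule ccontr)
  assume "y \<otimes> d \<noteq> d \<otimes> y"
  define K where "K = centralizer {d}"
  have K: "subgroup K G" unfolding K_def using d by (intro subgroup_centralizer) simp
  have Kiff: "k \<in> K \<longleftrightarrow> k \<in> carrier G \<and> k \<otimes> d = d \<otimes> k" for k unfolding K_def in_centralizer_iff by simp
  have "y \<in> carrier G \<and> y \<notin> K" using y \<open>y \<otimes> d \<noteq> d \<otimes> y\<close> Kiff by simp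
  then obtain y where "y \<in> carrier G \<and> y \<notin> K" and
    min: "\<forall>y'. y' \<in> carrier G \<and> y' \<notin> K \<longrightarrow> ord y \<le> ord y'"
    using ex_has_least_nat[of "\<lambda>y. y \<in> carrier G \<and> y \<notin> K" y ord] by blast
  then have y: "y \<in> carrier G" "y \<notin> K" by simp_all
  have small: "w \<in> K" if "w \<in> carrier G" "ord w < ord y" for w using min that by (meson leD)
  have dK: "d \<in> K" using d by (simp add: Kiff)
  have o1: "0 < ord y" using ord_ge_1[OF finite_carrier y(1)] by simp
  define \<sigma> where "\<sigma> = y \<otimes> d \<otimes> inv y"
  have \<sigma>D: "\<sigma> \<in> generate G {d}" unfolding \<sigma>_def by (rule odd_order_normal[OF d y(1)])
  have \<sigma>c: "\<sigma> \<in> carrier G" using y d by (simp add: \<sigma>_def)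
  have \<sigma>d: "\<sigma> \<noteq> d"
  proof
    assume "\<sigma> = d"
    then have "y \<otimes> d = d \<otimes> y" using conj_eq_iff[OF y(1) d(1) d(1)] by (simp add: \<sigma>_def)
    then show False using y Kiff by simp
  qed
  have d1: "d \<noteq> \<one>"
  proof
    assume "d = \<one>"
    then have "y \<in> K" using y(1) Kiff by simp
    then show False using y(2) by simp
  qed
  have od: "3 \<le> ord d"
  proof -
    have "ord d \<noteq> 0" "ord d \<noteq> 2" using d(2) by (metis even_zero, metis even_numeral)
    moreover have "ord d \<noteq> 1" using d1 ord_eq_1[OF d(1)] by metis
    ultimately show ?thesis by linarith
  qed
  have nrm: "y \<otimes> k \<otimes> inv y \<in> K" if "k \<in> K" for k
  proof -
    have k: "k \<in> carrier G" "k \<otimes> d = d \<otimes> k" using that Kiff by simp_all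
    let ?e = "inv y \<otimes> d \<otimes> y"
    have "?e \<in> generate G {d}" using odd_order_normal[OF d, of "inv y"] y by simp
    then have "k \<otimes> ?e = ?e \<otimes> k" by (rule commutes_with_generate[OF k(1) d(1) k(2)])
    then show ?thesis using conj_in_centralizer[of "{d}" y k] that y d unfolding K_def by simp
  qed
  obtain i q where iq: "ord y = 2 ^ i * q" "odd q" using nat_two_power_odd_decomp[OF o1] by blast
  have q0: "0 < q" using iq(2) by (cases q) simp_all
  have "i = 0 \<or> q = 1"
  proof (rule ccontr)
    assume "\<not> ?thesis"
    then have ne: "i \<noteq> 0" "q \<noteq> 1" by auto
    have "ord (y [^] (2 ^ i :: nat)) = q" using ord_pow[OF y(1), of "2 ^ i"] iq by simp
    moreover have "ord (y [^] q) = 2 ^ i" using ord_pow[OF y(1), of q] iq q0 by simp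
    moreover have "q < ord y" "2 ^ i < ord y"
    proof -
      have "(1::nat) < 2 ^ i" using ne by (intro one_less_power) simp_all
      then show "q < ord y" using iq(1) q0 by simp
      have "1 < q" using ne q0 by simp
      then show "2 ^ i < ord y" using iq(1) by simp
    qed
    ultimately have "y [^] (2 ^ i :: nat) \<in> K" "y [^] q \<in> K" using small y(1) by simp_all
    moreover have "coprime (2 ^ i) q" using iq(2) by simp
    ultimately have "y \<in> K" using subgroup_mem_if_coprime_pows[OF K y(1)] by simp
    then show False using y by simp
  qed
  moreover have "i \<noteq> 0"
  proof
    assume "i = 0"
    then have oy: "odd (ord y)" using iq by simp
    then have y2: "y \<otimes> y \<notin> K" using odd_ord_square_root[OF y(1) _ K] y(2) by blast
    \<comment> \<open>for \<open>d\<close> of order three, \<open>K\<close> may be too small for the test, but then \<open>d^-1\<close> is the only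
      other generator\<close>
    have "\<sigma> = inv d"
    proof (cases "ord d = 3")
      case True
      have "\<sigma> \<in> {d [^] k |k. k \<in> (UNIV :: nat set)}" using \<sigma>D generate_pow_on_finite_carrier[OF finite_carrier d(1)] by simp
      then obtain k :: nat where "\<sigma> = d [^] k" by blast
      then have k: "\<sigma> = d [^] (k mod 3)" using pow_mod[OF d(1), of 3 k] True pow_ord_eq_1[OF d(1)] by simp
      have "k mod 3 = 0 \<or> k mod 3 = 1 \<or> k mod 3 = 2" by linarith
      moreover have "k mod 3 \<noteq> 1" using k \<sigma>d d(1) by auto
      moreover have "k mod 3 \<noteq> 0"
      proof
        assume "k mod 3 = 0"
        then have "y \<otimes> d \<otimes> inv y = \<one>" using k by (simp add: \<sigma>_def)
        then show False using d1 conj_eq_iff[OF y(1) d(1) one_closed] y(1) d(1) by simp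
      qed
      ultimately have "\<sigma> = d \<otimes> d" using k pow_two[OF d(1)] by simp
      also have "\<dots> = inv d" using pow_three[OF d(1)] pow_ord_eq_1[OF d(1)] True d(1) by (simp add: inv_equality)
      finally show ?thesis .
    next
      case False
      have "ord d \<noteq> 4" using d by auto
      then have "4 < ord d" using od False by linarith
      also have "ord d \<le> card K"
      proof (rule dvd_imp_le[OF ord_dvd_card_subgroup[OF K dK]])
        show "0 < card K" using subgroup.finite_imp_card_positive[OF K finite_carrier] .
      qed
      finally have "4 < card K" .
      then show ?thesis using coset_test_sign[OF K y(1) y2 nrm _ dK] \<sigma>d by (simp add: \<sigma>_def)
    qed
    then have yd: "y \<otimes> d = inv d \<otimes> y" using conj_eq_iff[OF y(1) d(1), of "inv d"] d by (simp add: \<sigma>_def)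
    have "y \<otimes> (y \<otimes> d) = y \<otimes> inv d \<otimes> y" unfolding yd using y(1) d(1) by (simp add: m_assoc)
    also have "y \<otimes> inv d = d \<otimes> y" by (rule invertsD(1)[OF yd y(1) d(1)])
    finally have "y \<otimes> y \<in> K" unfolding Kiff using y(1) d(1) by (simp add: m_assoc)
    then show False using y2 by simp
  qed
  ultimately have oy: "ord y = 2 ^ i" using iq by simp
  have yp: "y [^] (2 ^ i :: nat) = \<one>" using pow_ord_eq_1[OF y(1)] oy by simp
  have i1: "i \<noteq> 1"
  proof
    assume "i = 1"
    then have "y \<otimes> y = \<one>" using yp pow_two[OF y(1)] by simp
    then have "y \<in> K" unfolding Kiff using involution_central y(1) d(1) by simp
    then show False using y by simp
  qed
  have i2: "i \<noteq> 2"
  proof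
    assume i: "i = 2"
    have "(y \<otimes> y) \<otimes> (y \<otimes> y) = \<one>" using yp pow_four[OF y(1)] i by simp
    moreover have "y \<otimes> y \<noteq> \<one>" using pow_eq_id[OF y(1), of 2] pow_two[OF y(1)] oy i by simp
    ultimately have e: "y \<otimes> d = d \<otimes> inv y" using order_four_normal[OF y(1) _ _ d(1)] y(2) Kiff y(1) by blast
    have "inv d \<otimes> (y \<otimes> d) \<otimes> inv d = inv d \<otimes> (d \<otimes> inv y) \<otimes> inv d" using e by simp
    then have "inv d \<otimes> y = inv y \<otimes> inv d" using y(1) d(1) by (simp add: word_simps)
    then have e': "inv y \<otimes> d = d \<otimes> y" using invertsD(2)[of "inv d" y] y(1) d(1) by simp
    have "y \<otimes> (d \<otimes> d) = d \<otimes> (inv y \<otimes> d)" using e y(1) d(1) by (simp flip: m_assoc)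
    then have "y \<otimes> (d \<otimes> d) = (d \<otimes> d) \<otimes> y" unfolding e' using y(1) d(1) by (simp add: m_assoc)
    then have "d \<otimes> d \<in> centralizer {y}" using d(1) by (simp add: in_centralizer_iff)
    then have "d \<in> centralizer {y}" using odd_ord_square_root[OF d subgroup_centralizer] y(1) by simp
    then show False using y Kiff by (simp add: in_centralizer_iff)
  qed
  have i3: "3 \<le> i" using i1 i2 \<open>i \<noteq> 0\<close> by linarith
  note ne = pow_ne_one_of_two_power[OF y(1) oy i3]
  define z where "z = y \<otimes> y"
  have zc: "z \<in> carrier G" using y by (simp add: z_def)
  have oz: "ord z = 2 ^ (i - 1)"
  proof -
    have "ord (y [^] (2::nat)) = 2 ^ i div 2" using ord_pow[OF y(1), of 2] oy i3 by simp
    also have "\<dots> = 2 ^ (i - 1)" using i3 by (cases i) simp_all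
    finally show ?thesis using pow_two[OF y(1)] by (simp add: z_def)
  qed
  have zK: "z \<in> K"
  proof (rule small[OF zc])
    show "ord z < ord y" using oz oy i3 by (cases i) simp_all
  qed
  have zd: "z \<otimes> d = d \<otimes> z" using zK Kiff by simp
  have cK: "8 < card K"
  proof -
    have "coprime (ord d) (ord z)" using d(2) oz by simp
    then have dv: "ord d * ord z dvd card K" using ord_dvd_card_subgroup[OF K dK] ord_dvd_card_subgroup[OF K zK]
      by (rule divides_mult[rotated 2])
    have "(2::nat) ^ 2 \<le> ord z" unfolding oz using i3 by (intro power_increasing) simp_all
    then have "12 \<le> ord d * ord z" using od mult_le_mono[of 3 "ord d" 4 "ord z"] by simp
    moreover have "0 < card K" using subgroup.finite_imp_card_positive[OF K finite_carrier] .
    ultimately show ?thesis using dvd_imp_le[OF dv] by linarith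
  qed
  define h where "h = d \<otimes> z"
  have hK: "h \<in> K" unfolding h_def by (rule subgroup.m_closed[OF K dK zK])
  have "z \<otimes> h = h \<otimes> z" unfolding h_def using zd zc d(1) by (metis m_assoc)
  then obtain p r where pr: "p \<in> {\<one>, h, inv h}" "r \<in> {\<one>, z, inv z}" "y \<otimes> h \<otimes> inv y = p \<otimes> r"
    using coset_test_square[OF K y nrm cK hK] unfolding z_def by blast
  let ?Y = "generate G {y}" and ?D = "generate G {d}"
  interpret Y: subgroup ?Y G using y by (intro generate_is_subgroup) simp
  interpret D: subgroup ?D G using d by (intro generate_is_subgroup) simp
  have yY: "y \<in> ?Y" and dD: "d \<in> ?D" by (simp_all add: generate.incl)
  have zY: "z \<in> ?Y" "inv z \<in> ?Y" unfolding z_def using yY by (simp_all add: Y.m_closed)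
  have rY: "r \<in> ?Y" using pr(2) zY Y.one_closed by auto
  have rc: "r \<in> carrier G" using rY by simp
  have triv: "e = \<one>" if "e \<in> ?D" "e \<in> ?Y" for e
  proof (rule eq_one_if_coprime_pows)
    show "e \<in> carrier G" using that by simp
    show "e [^] ord d = \<one>" "e [^] ord y = \<one>"
      using generate_elem_pow_ord[OF d(1) finite_carrier that(1)] generate_elem_pow_ord[OF y(1) finite_carrier that(2)] .
    show "coprime (ord d) (ord y)" using d(2) oy by simp
  qed
  have "y \<otimes> h \<otimes> inv y = \<sigma> \<otimes> z" unfolding h_def \<sigma>_def z_def using y(1) d(1) by (simp add: word_simps)
  then have eq: "\<sigma> = p \<otimes> r \<otimes> inv z" using pr(3) \<sigma>c zc by (simp add: m_assoc)
  consider "p = \<one>" | "p = d \<otimes> z" | "p = inv z \<otimes> inv d" using pr(1) d(1) zc by (auto simp: h_def inv_mult_group)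
  then show False
  proof cases
    case 1
    then have "\<sigma> = r \<otimes> inv z" using eq rc by simp
    then have "\<sigma> \<in> ?Y" using rY zY by simp
    then have "\<sigma> = \<one>" using triv \<sigma>D by simp
    then show False using d1 conj_eq_iff[OF y(1) d(1) one_closed] y(1) d(1) by (simp add: \<sigma>_def)
  next
    case 2
    then have e: "inv d \<otimes> \<sigma> = z \<otimes> r \<otimes> inv z" using eq rc zc d(1) by (simp add: m_assoc inv_mult_cancel)
    have "inv d \<otimes> \<sigma> \<in> ?D" using \<sigma>D dD by simp
    moreover have "inv d \<otimes> \<sigma> \<in> ?Y" unfolding e using rY zY by simp
    ultimately have "inv d \<otimes> \<sigma> = \<one>" using triv by blast
    then show False using \<sigma>d \<sigma>c d(1) by (metis inv_equality inv_inv inv_closed inv_comm)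
  next
    case 3
    have zd': "inv z \<otimes> inv d = inv d \<otimes> inv z" using zd zc d(1) by (metis inv_mult_group)
    have e: "d \<otimes> \<sigma> = inv z \<otimes> r \<otimes> inv z" unfolding eq 3 zd' using rc zc d(1) by (simp add: m_assoc inv_mult_cancel)
    have "d \<otimes> \<sigma> \<in> ?D" using \<sigma>D dD by simp
    moreover have "d \<otimes> \<sigma> \<in> ?Y" unfolding e using rY zY by simp
    ultimately have e1: "inv z \<otimes> r \<otimes> inv z = \<one>" using triv e by metis
    have zp: "z [^] n = y [^] (2 * n)" for n :: nat unfolding z_def by (rule square_pow[OF y(1)])
    have "r = z \<otimes> z"
    proof -
      have "z \<otimes> (inv z \<otimes> r \<otimes> inv z) \<otimes> z = z \<otimes> z" unfolding e1 using zc by simp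
      then show ?thesis using zc rc by (simp add: word_simps)
    qed
    then consider "z \<otimes> z = \<one>" | "z \<otimes> z = z" | "z \<otimes> z \<otimes> z = \<one>" using pr(2) zc by (auto simp: m_assoc)
    then show False
    proof cases
      case 1 then show False using ne[of 4] zp[of 2] pow_two[OF zc] by simp
    next
      case 2
      then have "z = \<one>" using zc by simp
      then show False using ne[of 2] pow_two[OF y(1)] by (simp add: z_def)
    next
      case 3 then show False using ne[of 6] zp[of 3] pow_three[OF zc] by simp
    qed
  qed
qed

end

section \<open>Noncommuting elements of two-power order\<close>

context central_involutions begin

text \<open>
  If the order of \<open>x\<close> were not a power of two, then \<open>x\<close> would be a product of powers of itself, one of
  which has odd order and the other a smaller order; both commute with \<open>y\<close>.
\<close>

lemma minimal_noncommuting_two_power: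
  assumes x: "x \<in> carrier G" and y: "y \<in> carrier G" and xy: "x \<otimes> y \<noteq> y \<otimes> x"
    and min: "\<And>w. w \<in> carrier G \<Longrightarrow> w \<otimes> y \<noteq> y \<otimes> w \<Longrightarrow> ord x \<le> ord w"
  obtains i where "ord x = 2 ^ i" "2 \<le> i" "(x \<otimes> x) \<otimes> y = y \<otimes> (x \<otimes> x)"
proof -
  have o1: "0 < ord x" using ord_ge_1[OF finite_carrier x] by simp
  define K where "K = centralizer {y}"
  have K: "subgroup K G" unfolding K_def using y by (intro subgroup_centralizer) simp
  have Kiff: "k \<in> K \<longleftrightarrow> k \<in> carrier G \<and> k \<otimes> y = y \<otimes> k" for k unfolding K_def in_centralizer_iff by simp
  have xK: "x \<notin> K" using xy Kiff by blast
  have small: "w \<in> K" if "w \<in> carrier G" "ord w < ord x" for w using min[OF that(1)] that Kiff by (meson leD)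
  obtain i q where iq: "ord x = 2 ^ i * q" "odd q" using nat_two_power_odd_decomp[OF o1] by blast
  have q0: "0 < q" using iq(2) by (cases q) simp_all
  have "q = 1"
  proof (rule ccontr)
    assume "q \<noteq> 1"
    then have "1 < q" using q0 by simp
    have "ord (x [^] (2 ^ i :: nat)) = q" using ord_pow[OF x, of "2 ^ i"] iq by simp
    then have "x [^] (2 ^ i :: nat) \<in> K" using odd_order_commutes[of "x [^] (2 ^ i :: nat)" y] x y iq(2) Kiff by simp
    moreover have "ord (x [^] q) = 2 ^ i" using ord_pow[OF x, of q] iq q0 by simp
    then have "x [^] q \<in> K" using small x iq(1) \<open>1 < q\<close> by simp
    moreover have "coprime (2 ^ i) q" using iq(2) by simp
    ultimately have "x \<in> K" using subgroup_mem_if_coprime_pows[OF K x] by simp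
    then show False using xK by simp
  qed
  then have ox: "ord x = 2 ^ i" using iq by simp
  have xp: "x [^] (2 ^ i :: nat) = \<one>" using pow_ord_eq_1[OF x] ox by simp
  have "i \<noteq> 0"
  proof
    assume "i = 0"
    then have "x = \<one>" using xp x by simp
    then show False using xy y by simp
  qed
  moreover have "i \<noteq> 1"
  proof
    assume "i = 1"
    then have "x \<otimes> x = \<one>" using xp pow_two[OF x] by simp
    then show False using involution_central[OF x _ y] xy by simp
  qed
  ultimately have i2: "2 \<le> i" by linarith
  have "ord (x [^] (2::nat)) = 2 ^ i div 2" using ord_pow[OF x, of 2] ox i2 by simp
  then have "ord (x \<otimes> x) < ord x" using ox i2 pow_two[OF x] by simp
  then have "x \<otimes> x \<in> K" using small x by simp
  then show thesis using that[OF ox i2] Kiff by blast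
qed

text \<open>
  The element \<open>vx\<close> does not commute with \<open>y\<close>, and its fourth power is trivial. It is no involution
  because involutions are central, so the subgroup it generates is normal, and \<open>y\<close> inverts it. But
  \<open>y\<close> inverts \<open>x\<close> and fixes \<open>v\<close>, so \<open>v = v^-1\<close>.
\<close>

lemma no_order_four_centralizing_pair:
  assumes x: "x \<in> carrier G" "x \<otimes> x \<noteq> \<one>" "(x \<otimes> x) \<otimes> (x \<otimes> x) = \<one>"
    and y: "y \<in> carrier G" and xy: "x \<otimes> y \<noteq> y \<otimes> x"
    and v: "v \<in> carrier G" "v \<otimes> x = x \<otimes> v" "v \<otimes> y = y \<otimes> v" "v \<otimes> v \<noteq> \<one>" "(v \<otimes> v) \<otimes> (v \<otimes> v) = \<one>"
  shows False
proof -
  have xy': "x \<otimes> y = y \<otimes> inv x" using order_four_normal[OF x y] xy by blast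
  have sq: "(v \<otimes> x) \<otimes> (v \<otimes> x) = (v \<otimes> v) \<otimes> (x \<otimes> x)"
    using v(1,2) x(1) by (metis m_assoc m_closed)
  have vvx: "(x \<otimes> x) \<otimes> (v \<otimes> v) = (v \<otimes> v) \<otimes> (x \<otimes> x)"
    using involution_central[OF _ x(3), of "v \<otimes> v"] x(1) v(1) by simp
  have nc: "(v \<otimes> x) \<otimes> y \<noteq> y \<otimes> (v \<otimes> x)"
  proof
    assume "(v \<otimes> x) \<otimes> y = y \<otimes> (v \<otimes> x)"
    then have "v \<otimes> (x \<otimes> y) = v \<otimes> (y \<otimes> x)" using v(1,3) x(1) y by (metis m_assoc)
    then show False using xy v(1) x(1) y by simp
  qed
  have vxc: "v \<otimes> x \<in> carrier G" using v x by simp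
  show False
  proof (cases "(v \<otimes> x) \<otimes> (v \<otimes> x) = \<one>")
    case True
    then show False using involution_central[OF vxc True y] nc by simp
  next
    case False
    have "((v \<otimes> v) \<otimes> (x \<otimes> x)) \<otimes> ((v \<otimes> v) \<otimes> (x \<otimes> x)) = ((v \<otimes> v) \<otimes> (v \<otimes> v)) \<otimes> ((x \<otimes> x) \<otimes> (x \<otimes> x))"
      using vvx v(1) x(1) by (metis m_assoc m_closed)
    then have "((v \<otimes> x) \<otimes> (v \<otimes> x)) \<otimes> ((v \<otimes> x) \<otimes> (v \<otimes> x)) = \<one>" unfolding sq using v x by simp
    then have "(v \<otimes> x) \<otimes> y = y \<otimes> inv (v \<otimes> x)" using order_four_normal[OF vxc False _ y] nc by blast
    moreover have "(v \<otimes> x) \<otimes> y = y \<otimes> (v \<otimes> inv x)" using v(1,3) x(1) y xy' by (metis inv_closed m_assoc)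
    moreover have "inv (v \<otimes> x) = inv v \<otimes> inv x" unfolding v(2) using v(1) x(1) by (simp add: inv_mult_group)
    ultimately have "v = inv v" using v(1) x(1) y by simp
    then show False using v(1,4) by (metis r_inv)
  qed
qed

text \<open>
  The coset test for \<open>b = x\<close>, \<open>h = s = xy\<close> and the centralizer \<open>K\<close> of \<open>x^2\<close>, \<open>y^2\<close> and \<open>s\<close>. Since
  \<open>x s x^-1 = yx\<close>, it gives \<open>yx = pq\<close> with \<open>p \<in> {\<one>, s, s^-1}\<close> and \<open>q\<close> a power of \<open>x^2\<close>. If
  \<open>p\<close> is \<open>\<one>\<close> or \<open>s\<close>, this contradicts that \<open>x\<close> and \<open>y\<close> do not commute or that \<open>x\<close> has order at least
  eight. If \<open>p = s^-1\<close>, then \<open>x^2 y^2 = q\<close>, which leaves the two stated equations.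
\<close>

lemma noncommuting_large_two_powers:
  assumes x: "x \<in> carrier G" "ord x = 2 ^ i" "3 \<le> i" and y: "y \<in> carrier G" "ord y = 2 ^ j" "3 \<le> j"
    and xy: "x \<otimes> y \<noteq> y \<otimes> x"
    and xxy: "(x \<otimes> x) \<otimes> y = y \<otimes> (x \<otimes> x)" and yyx: "(y \<otimes> y) \<otimes> x = x \<otimes> (y \<otimes> y)"
    and min: "\<And>w. w \<in> carrier G \<Longrightarrow> (w \<otimes> w) \<otimes> (w \<otimes> w) = \<one> \<Longrightarrow> w \<otimes> y = y \<otimes> w"
  shows "(x \<otimes> x) \<otimes> (y \<otimes> y) = \<one> \<or> (x \<otimes> x) \<otimes> (x \<otimes> x) \<otimes> (y \<otimes> y) = \<one>"
proof -
  note ne = pow_ne_one_of_two_power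
  define u where "u = x \<otimes> x"
  define v where "v = y \<otimes> y"
  define s where "s = x \<otimes> y"
  have c: "u \<in> carrier G" "v \<in> carrier G" "s \<in> carrier G" using x y by (simp_all add: u_def v_def s_def)
  have u4: "u \<otimes> u \<noteq> \<one>" using ne[OF x, of 4] pow_four[OF x(1)] by (simp add: u_def)
  have v1: "v \<noteq> \<one>" using ne[OF y, of 2] pow_two[OF y(1)] by (simp add: v_def)
  have v4: "v \<otimes> v \<noteq> \<one>" using ne[OF y, of 4] pow_four[OF y(1)] by (simp add: v_def)
  have ux: "u \<otimes> x = x \<otimes> u" using x(1) by (simp add: u_def m_assoc)
  have vy: "v \<otimes> y = y \<otimes> v" using y(1) by (simp add: v_def m_assoc)
  have uy: "u \<otimes> y = y \<otimes> u" using xxy by (simp add: u_def)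
  have vx: "v \<otimes> x = x \<otimes> v" using yyx by (simp add: v_def)
  have us: "u \<otimes> s = s \<otimes> u" unfolding s_def using ux uy c(1) x(1) y(1) by (metis m_assoc)
  have vs: "v \<otimes> s = s \<otimes> v" unfolding s_def using vx vy c(2) x(1) y(1) by (metis m_assoc)
  have uv: "u \<otimes> v = v \<otimes> u" unfolding v_def using uy c(1) y(1) by (metis m_assoc)
  have s_uv: "s \<otimes> (y \<otimes> x) = u \<otimes> v"
  proof -
    have "s \<otimes> (y \<otimes> x) = x \<otimes> (v \<otimes> x)" using x(1) y(1) by (simp add: s_def v_def m_assoc)
    also have "\<dots> = u \<otimes> v" unfolding vx using x(1) c(2) by (simp add: u_def m_assoc)
    finally show ?thesis .
  qed
  then have yx: "y \<otimes> x = inv s \<otimes> (u \<otimes> v)" using c x(1) y(1) by (metis inv_solve_left m_closed)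
  have ncu: False if "x \<otimes> y = y \<otimes> x'" "x' \<otimes> x' = inv u" "x' \<in> carrier G" for x'
  proof -
    have "x \<otimes> (x \<otimes> y) = x \<otimes> (y \<otimes> x')" using that(1) by simp
    also have "\<dots> = x \<otimes> y \<otimes> x'" using x(1) y(1) that(3) by (simp add: m_assoc)
    also have "\<dots> = y \<otimes> (x' \<otimes> x')" unfolding that(1) using y(1) that(3) by (simp add: m_assoc)
    finally have "u \<otimes> y = y \<otimes> inv u" unfolding that(2) using x(1) y(1) by (simp add: u_def m_assoc)
    then have "u = inv u" unfolding uy using c y(1) by simp
    then show False using u4 c by (metis r_inv)
  qed
  define K where "K = centralizer {u, v, s}"
  have K: "subgroup K G" unfolding K_def using c by (intro subgroup_centralizer) simp
  have Kiff: "k \<in> K \<longleftrightarrow> k \<in> carrier G \<and> k \<otimes> u = u \<otimes> k \<and> k \<otimes> v = v \<otimes> k \<and> k \<otimes> s = s \<otimes> k" for k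
    unfolding K_def in_centralizer_iff by blast
  have sK: "s \<in> K" and uK: "u \<in> K" and vK: "v \<in> K" using us vs uv c Kiff by simp_all
  have sx: "s \<otimes> x \<noteq> x \<otimes> s"
  proof
    assume "s \<otimes> x = x \<otimes> s"
    then have "x \<otimes> (y \<otimes> x) = x \<otimes> (x \<otimes> y)" using x(1) y(1) by (simp add: s_def m_assoc)
    then show False using xy x(1) y(1) by simp
  qed
  have sy: "s \<otimes> y \<noteq> y \<otimes> s"
  proof
    assume "s \<otimes> y = y \<otimes> s"
    then have "(x \<otimes> y) \<otimes> y = (y \<otimes> x) \<otimes> y" using x(1) y(1) by (simp add: s_def m_assoc)
    then show False using xy x(1) y(1) by simp
  qed
  have xK: "x \<notin> K" using sx Kiff by metis
  have nrm: "x \<otimes> k \<otimes> inv x \<in> K" if "k \<in> K" for k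
  proof -
    have k: "k \<in> carrier G" "k \<otimes> u = u \<otimes> k" "k \<otimes> v = v \<otimes> k" "k \<otimes> s = s \<otimes> k" using that Kiff by simp_all
    have "inv x \<otimes> u \<otimes> x = u" using ux c x(1) by (simp add: m_assoc inv_mult_cancel)
    moreover have "inv x \<otimes> v \<otimes> x = v" using vx c x(1) by (simp add: m_assoc inv_mult_cancel)
    moreover have "inv x \<otimes> s \<otimes> x = y \<otimes> x" unfolding s_def using x(1) y(1) by (simp add: m_assoc inv_mult_cancel)
    then have "inv x \<otimes> s \<otimes> x = inv s \<otimes> (u \<otimes> v)" unfolding yx .
    moreover have "k \<otimes> (inv s \<otimes> (u \<otimes> v)) = (inv s \<otimes> (u \<otimes> v)) \<otimes> k"
    proof -
      have "subgroup (centralizer {k}) G" using k by (intro subgroup_centralizer) simp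
      moreover have "s \<in> centralizer {k}" "u \<in> centralizer {k}" "v \<in> centralizer {k}"
        using k c by (simp_all add: in_centralizer_iff)
      ultimately have "inv s \<otimes> (u \<otimes> v) \<in> centralizer {k}" by (intro subgroup.m_closed subgroup.m_inv_closed)
      then show ?thesis by (simp add: in_centralizer_iff)
    qed
    ultimately have "k \<otimes> (inv x \<otimes> w \<otimes> x) = (inv x \<otimes> w \<otimes> x) \<otimes> k" if "w \<in> {u, v, s}" for w
      using that k by (elim insertE emptyE) simp_all
    then show ?thesis
      using conj_in_centralizer[of "{u, v, s}" x k] that x(1) c unfolding K_def by blast
  qed
  define U where "U = generate G {u}"
  have U: "subgroup U G" unfolding U_def using c by (intro generate_is_subgroup) simp
  have uU: "u \<in> U" by (simp add: U_def generate.incl)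
  have Ux: "w \<otimes> x = x \<otimes> w" and Uy: "w \<otimes> y = y \<otimes> w" if "w \<in> U" for w
    using commutes_with_generate[OF x(1) c(1) ux[symmetric]] commutes_with_generate[OF y(1) c(1) uy[symmetric]] that
    unfolding U_def by simp_all
  have sU: "s \<notin> U" using Ux sx by blast
  have UK: "U \<subseteq> K" unfolding U_def using generate_subgroup_incl[OF _ K, of "{u}"] uK by simp
  have fK: "finite K" using subgroup.subset[OF K] finite_subset_carrier by blast
  have ou: "ord u = 2 ^ (i - 1)"
  proof -
    have "ord (x [^] (2::nat)) = 2 ^ i div 2" using ord_pow[OF x(1), of 2] x by simp
    also have "\<dots> = 2 ^ (i - 1)" using x(3) by (cases i) simp_all
    finally show ?thesis using pow_two[OF x(1)] by (simp add: u_def)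
  qed
  have cU: "card U = 2 ^ (i - 1)" using generate_pow_card[OF c(1)] ou by (simp add: U_def)
  have cK: "8 < card K"
  proof (rule ccontr)
    assume "\<not> 8 < card K"
    then have le: "card K \<le> 8" by simp
    \<comment> \<open>otherwise \<open>K\<close> is the union of the subgroup \<open>U\<close> of order four generated by \<open>x^2\<close> and its coset
      \<open>sU\<close>, and \<open>s\<close> or \<open>s y^-2\<close> is an element of order at most four that does not commute with \<open>y\<close>\<close>
    define sU' where "sU' = (\<lambda>w. s \<otimes> w) ` U"
    have Uc: "U \<subseteq> carrier G" by (rule subgroup.subset[OF U])
    have fU: "finite U" using fK UK finite_subset by blast
    have csU: "card sU' = card U" unfolding sU'_def
      by (rule card_image) (use inj_on_subset[OF inj_on_cmult[OF c(3)] Uc] in simp)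
    have disj: "U \<inter> sU' = {}"
    proof (rule ccontr)
      assume "U \<inter> sU' \<noteq> {}"
      then obtain w where w: "w \<in> U" "s \<otimes> w \<in> U" unfolding sU'_def by blast
      then have "(s \<otimes> w) \<otimes> inv w \<in> U" using subgroup.m_closed[OF U] subgroup.m_inv_closed[OF U] by blast
      moreover have "(s \<otimes> w) \<otimes> inv w = s" using w Uc c by (simp add: m_assoc subset_iff)
      ultimately show False using sU by simp
    qed
    have sub: "U \<union> sU' \<subseteq> K" unfolding sU'_def using UK sK subgroup.m_closed[OF K] by blast
    have cun: "card (U \<union> sU') = 2 * 2 ^ (i - 1)"
      using card_Un_disjoint[OF fU _ disj] fU csU cU by (simp add: sU'_def)
    have "2 * 2 ^ (i - 1) \<le> (8::nat)" using card_mono[OF fK sub] cun le by simp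
    moreover have "(2::nat) ^ 2 \<le> 2 ^ (i - 1)" using x(3) by (intro power_increasing) simp_all
    ultimately have four: "(2::nat) ^ (i - 1) = 4" by simp
    have KU: "K = U \<union> sU'"
      by (rule card_subset_eq[OF fK sub, symmetric]) (use cun four le card_mono[OF fK sub] in simp)
    have inU: "w \<in> U" if w: "w \<in> K" "w \<otimes> x = x \<otimes> w" for w
    proof (rule ccontr)
      assume "w \<notin> U"
      then obtain t where t: "t \<in> U" "w = s \<otimes> t" using w KU unfolding sU'_def by blast
      have "subgroup (centralizer {x}) G" using x by (intro subgroup_centralizer) simp
      moreover have tc: "t \<in> carrier G" "w \<in> carrier G" using t Uc c by auto
      then have "t \<in> centralizer {x}" "w \<in> centralizer {x}" using Ux[OF t(1)] w(2) by (simp_all add: in_centralizer_iff)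
      ultimately have "w \<otimes> inv t \<in> centralizer {x}" by (intro subgroup.m_closed subgroup.m_inv_closed)
      moreover have "w \<otimes> inv t = s" using t tc c by (simp add: m_assoc)
      ultimately show False using sx by (simp add: in_centralizer_iff)
    qed
    have vU: "v \<in> U" by (rule inU[OF vK vx])
    have ssU: "s \<otimes> s \<in> U"
    proof (rule ccontr)
      assume "s \<otimes> s \<notin> U"
      moreover have "s \<otimes> s \<in> K" using subgroup.m_closed[OF K sK sK] .
      ultimately obtain t where "t \<in> U" "s \<otimes> s = s \<otimes> t" using KU unfolding sU'_def by blast
      then show False using sU c Uc by (simp add: subset_iff)
    qed
    have u_4: "u [^] (4::nat) = \<one>" using pow_ord_eq_1[OF c(1)] ou four by simp
    have vc: "v = u \<or> v = inv u"
    proof -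
      obtain k :: nat where "v = u [^] k" using vU generate_pow_on_finite_carrier[OF finite_carrier c(1)] unfolding U_def by blast
      then have vk: "v = u [^] (k mod 4)" using pow_mod[OF c(1) u_4] by simp
      have iu: "inv u = u [^] (3::nat)" using inv_eq_pow[OF c(1) u_4] by simp
      have "k mod 4 = 0 \<or> k mod 4 = 1 \<or> k mod 4 = 2 \<or> k mod 4 = 3" by linarith
      moreover have "k mod 4 \<noteq> 0" using vk v1 by (metis nat_pow_0)
      moreover have "k mod 4 \<noteq> 2"
      proof
        assume "k mod 4 = 2"
        then have "v = u \<otimes> u" using vk pow_two[OF c(1)] by simp
        then show False using v4 u_4 pow_four[OF c(1)] by simp
      qed
      ultimately have "k mod 4 = 1 \<or> k mod 4 = 3" by blast
      then show ?thesis using vk c(1) unfolding iu by (elim disjE) simp_all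
    qed
    define e where "e = s \<otimes> s \<otimes> inv (u \<otimes> v)"
    have eU: "e \<in> U" unfolding e_def by (rule subgroup.m_closed[OF U ssU subgroup.m_inv_closed[OF U subgroup.m_closed[OF U uU vU]]])
    have ec: "e \<in> carrier G" using eU Uc by blast
    have sse: "s \<otimes> s = e \<otimes> (u \<otimes> v)" unfolding e_def using c by (simp add: m_assoc)
    have "s \<otimes> s = e \<otimes> s \<otimes> (y \<otimes> x)" using sse s_uv[symmetric] ec c x(1) y(1) by (simp add: m_assoc)
    moreover have "e \<otimes> s = s \<otimes> e"
      unfolding s_def using Ux[OF eU] Uy[OF eU] ec x(1) y(1) by (metis m_assoc)
    ultimately have "s \<otimes> s = s \<otimes> (e \<otimes> (y \<otimes> x))" using ec c x(1) y(1) by (simp add: m_assoc)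
    then have xye: "x \<otimes> y = e \<otimes> (y \<otimes> x)" using c(3) ec x(1) y(1) by (simp add: s_def)
    have ee: "e \<otimes> e = \<one>"
    proof -
      have "x \<otimes> (x \<otimes> y) = x \<otimes> (e \<otimes> (y \<otimes> x))" using xye by simp
      also have "\<dots> = e \<otimes> (x \<otimes> y) \<otimes> x" using Ux[OF eU] ec x(1) y(1) by (metis m_assoc m_closed)
      also have "\<dots> = (e \<otimes> e) \<otimes> (y \<otimes> u)" unfolding xye u_def using ec x(1) y(1) by (simp add: m_assoc)
      finally have "u \<otimes> y = (e \<otimes> e) \<otimes> (u \<otimes> y)" unfolding uy using x(1) y(1) by (simp add: u_def m_assoc flip: uy[unfolded u_def])
      then show ?thesis using ec c y(1) by (metis m_closed r_cancel_one')
    qed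
    from vc show False
    proof
      assume vu: "v = u"
      define w where "w = s \<otimes> inv v"
      have wc: "w \<in> carrier G" using c by (simp add: w_def)
      have siv: "inv v \<otimes> s = s \<otimes> inv v" using commutes_inv[OF c(3,2)] vs by simp
      have "w \<otimes> w = s \<otimes> (inv v \<otimes> s) \<otimes> inv v" using c by (simp add: w_def m_assoc)
      also have "\<dots> = (s \<otimes> s) \<otimes> inv v \<otimes> inv v" unfolding siv using c by (simp add: m_assoc)
      also have "\<dots> = e" unfolding sse vu using ec c by (simp add: m_assoc)
      finally have "(w \<otimes> w) \<otimes> (w \<otimes> w) = \<one>" using ee by simp
      then have wy: "w \<otimes> y = y \<otimes> w" using min[OF wc] by simp
      have "subgroup (centralizer {y}) G" using y by (intro subgroup_centralizer) simp
      moreover have "w \<in> centralizer {y}" "v \<in> centralizer {y}" using wy vy wc c by (simp_all add: in_centralizer_iff)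
      ultimately have "w \<otimes> v \<in> centralizer {y}" by (intro subgroup.m_closed)
      moreover have "w \<otimes> v = s" using c by (simp add: w_def m_assoc)
      ultimately show False using sy by (simp add: in_centralizer_iff)
    next
      assume "v = inv u"
      then have "s \<otimes> s = e" using sse ec c by simp
      then have "(s \<otimes> s) \<otimes> (s \<otimes> s) = \<one>" using ee by simp
      then show False using min[OF c(3)] sy by simp
    qed
  qed
  have comm: "x \<otimes> x \<otimes> s = s \<otimes> (x \<otimes> x)" using us by (simp add: u_def)
  obtain p q where pq: "p \<in> {\<one>, s, inv s}" "q \<in> {\<one>, u, inv u}" "x \<otimes> s \<otimes> inv x = p \<otimes> q"
    using coset_test_square[OF K x(1) xK nrm cK sK comm] unfolding u_def by blast
  have qc: "q \<in> carrier G" using pq(2) c by auto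
  have "x \<otimes> s \<otimes> inv x = u \<otimes> y \<otimes> inv x" using x(1) y(1) by (simp add: u_def s_def m_assoc)
  also have "\<dots> = y \<otimes> x" unfolding uy using x(1) y(1) by (simp add: u_def m_assoc)
  finally have yxpq: "y \<otimes> x = p \<otimes> q" using pq(3) by simp
  have qx: "q \<otimes> x = x \<otimes> q"
  proof -
    have "u \<in> U" "inv u \<in> U" "\<one> \<in> U" using uU subgroup.m_inv_closed[OF U uU] subgroup.one_closed[OF U] by simp_all
    then show ?thesis using pq(2) Ux by blast
  qed
  consider "p = \<one>" | "p = s" | "p = inv s" using pq(1) by blast
  then show ?thesis
  proof cases
    case 1
    then have "(y \<otimes> x) \<otimes> x = x \<otimes> (y \<otimes> x)" using yxpq qx qc by simp
    then show ?thesis using xy x(1) y(1) by (simp flip: m_assoc)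
  next
    case 2
    then have e: "y \<otimes> x = x \<otimes> y \<otimes> q" using yxpq by (simp add: s_def)
    then have e2: "x \<otimes> y = y \<otimes> (x \<otimes> inv q)"
      using x(1) y(1) qc by (metis inv_closed inv_solve_right m_assoc m_closed)
    have iq: "inv q \<otimes> x = x \<otimes> inv q" using commutes_inv[OF x(1) qc] qx by simp
    have sq: "(x \<otimes> inv q) \<otimes> (x \<otimes> inv q) = u \<otimes> (inv q \<otimes> inv q)"
      using x(1) qc iq by (simp add: u_def m_assoc) (metis iq inv_closed m_assoc)
    consider "q = \<one>" | "q = u" | "q = inv u" using pq(2) by blast
    then show ?thesis
    proof cases
      case 1 then show ?thesis using e xy x(1) y(1) by simp
    next
      case 2
      have "(x \<otimes> inv q) \<otimes> (x \<otimes> inv q) = inv u" unfolding sq using c by (simp add: 2 inv_mult_cancel)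
      then show ?thesis using ncu[OF e2] x(1) qc by simp
    next
      case 3
      have s3: "(x \<otimes> inv q) \<otimes> (x \<otimes> inv q) = u \<otimes> (u \<otimes> u)" unfolding sq using c by (simp add: 3)
      have "x \<otimes> (x \<otimes> y) = x \<otimes> (y \<otimes> (x \<otimes> inv q))" using e2 by simp
      also have "\<dots> = x \<otimes> y \<otimes> (x \<otimes> inv q)" using x(1) y(1) qc by (simp add: m_assoc)
      also have "\<dots> = y \<otimes> ((x \<otimes> inv q) \<otimes> (x \<otimes> inv q))" unfolding e2 using y(1) x(1) qc by (simp add: m_assoc)
      finally have "u \<otimes> y = y \<otimes> (u \<otimes> (u \<otimes> u))" unfolding s3 using x(1) y(1) by (simp add: u_def m_assoc)
      then have "u \<otimes> u = \<one>" unfolding uy using c y(1) by simp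
      then show ?thesis using u4 by simp
    qed
  next
    case 3
    then have "inv s \<otimes> (u \<otimes> v) = inv s \<otimes> q" using yxpq yx by simp
    then have uvq: "u \<otimes> v = q" using c qc by simp
    consider "q = \<one>" | "q = u" | "q = inv u" using pq(2) by blast
    then show ?thesis
    proof cases
      case 1 then show ?thesis using uvq by (simp add: u_def v_def)
    next
      case 2 then show ?thesis using uvq c v1 by simp
    next
      case 3
      then have "u \<otimes> (u \<otimes> v) = \<one>" using uvq c by simp
      then show ?thesis using x(1) y(1) by (simp add: u_def v_def m_assoc)
    qed
  qed
qed

end

section \<open>Quaternion subgroups and their centralizers\<close>

context group begin

text \<open>
  These relations say that \<open>x\<close> and \<open>y\<close> generate a quaternion group of order eight.
\<close>

definition quaternion_pair :: "'a \<Rightarrow> 'a \<Rightarrow> bool" where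
  "quaternion_pair x y \<longleftrightarrow> x \<in> carrier G \<and> y \<in> carrier G \<and> x \<otimes> x \<noteq> \<one> \<and> (x \<otimes> x) \<otimes> (x \<otimes> x) = \<one> \<and>
    y \<otimes> y = x \<otimes> x \<and> y \<otimes> x = inv x \<otimes> y"

lemma dicyclic_embedding:
  fixes n :: nat
  assumes c: "c \<in> carrier G" and x: "x \<in> carrier G" and inv: "x \<otimes> c = inv c \<otimes> x"
    and n: "c [^] (2 * n) = \<one>" "0 < n" and xx: "x \<otimes> x = c [^] n"
    and inj: "\<And>(i :: nat) (j :: nat). i < 2 * n \<Longrightarrow> j < 2 \<Longrightarrow> c [^] i \<otimes> x [^] j = \<one> \<Longrightarrow> i = 0 \<and> j = 0"
  shows "\<exists>h\<in>hom (dicyclic n) G. inj_on h (carrier (dicyclic n)) \<and> c \<in> h ` carrier (dicyclic n) \<and> x \<in> h ` carrier (dicyclic n)"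
proof -
  let ?f = "\<lambda>g. case g of Gen1 \<Rightarrow> c | Gen2 \<Rightarrow> x"
  have f: "?f g \<in> carrier G" for g using c x by (cases g) simp_all
  note wv = word_val_simps[OF is_group, of ?f, OF f]
  have inv': "x \<otimes> (c \<otimes> inv x) = inv c" using inv c x by (metis conj_eq_iff inv_closed m_assoc)
  show ?thesis unfolding dicyclic_structure(1)[OF n(2)]
    by (rule presented_group_embedding[where f = ?f and ?g1.0 = Gen1 and ?g2.0 = Gen2, OF f _ dicyclic_structure(7)[OF n(2), unfolded dicyclic_structure(1)[OF n(2)]]])
      (use inj inv' n xx x in \<open>auto simp: wv numeral_2_eq_2\<close>)
qed

lemma quaternion_embedding:
  assumes "quaternion_pair x y"
  shows "\<exists>h\<in>hom (dicyclic 2) G. inj_on h (carrier (dicyclic 2)) \<and> x \<in> h ` carrier (dicyclic 2) \<and> y \<in> h ` carrier (dicyclic 2)"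
proof -
  have q: "x \<in> carrier G" "y \<in> carrier G" "x \<otimes> x \<noteq> \<one>" "(x \<otimes> x) \<otimes> (x \<otimes> x) = \<one>" "y \<otimes> y = x \<otimes> x" "y \<otimes> x = inv x \<otimes> y"
    using assms by (simp_all add: quaternion_pair_def)
  have x4: "x [^] (2 * 2 :: nat) = \<one>" using pow_four[OF q(1)] q(4) by simp
  have ox: "ord x = 4" using ord_eqI[OF q(1,3), of 4] x4 by simp
  show ?thesis
  proof (rule dicyclic_embedding[OF q(1,2,6) x4])
    show "y \<otimes> y = x [^] (2::nat)" using q(5) pow_two[OF q(1)] by simp
    fix i j :: nat assume ij: "i < 2 * 2" "j < 2" "x [^] i \<otimes> y [^] j = \<one>"
    then show "i = 0 \<and> j = 0" using normal_form_unique[OF q(1,3,2,6)] ox by simp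
  qed simp
qed

end

context central_involutions begin

text \<open>
  Choose noncommuting \<open>x\<close> and \<open>y\<close> with minimal sum of orders. Both orders are powers of two and at
  least four. If both are at least eight, then \<open>noncommuting_large_two_powers\<close> for the pairs
  \<open>(x, y)\<close> and \<open>(x, y^-1)\<close> yields two alternatives each, and every combination bounds an order by four
  or makes it divide six. If exactly one of them is four,
  then a power of the other element has order four and commutes with both, against
  \<open>no_order_four_centralizing_pair\<close>. So both are four, and normality of the subgroups generated by
  \<open>x\<close> and \<open>y\<close> gives the quaternion relations.
\<close>

theorem quaternion_pair_exists:
  assumes nab: "a \<in> carrier G" "b \<in> carrier G" "a \<otimes> b \<noteq> b \<otimes> a"
  obtains x y where "quaternion_pair x y"
proof -
  define P where "P p \<longleftrightarrow> fst p \<in> carrier G \<and> snd p \<in> carrier G \<and> fst p \<otimes> snd p \<noteq> snd p \<otimes> fst p" for p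
  have "P (a, b)" using nab by (simp add: P_def)
  then have "\<exists>p. P p \<and> (\<forall>p'. P p' \<longrightarrow> ord (fst p) + ord (snd p) \<le> ord (fst p') + ord (snd p'))"
    by (rule ex_has_least_nat)
  then obtain p where p: "P p" "\<And>p'. P p' \<Longrightarrow> ord (fst p) + ord (snd p) \<le> ord (fst p') + ord (snd p')"
    by blast
  obtain x y where xy: "p = (x, y)" by (cases p)
  have x: "x \<in> carrier G" and y: "y \<in> carrier G" and nc: "x \<otimes> y \<noteq> y \<otimes> x" using p(1) xy by (simp_all add: P_def)
  have minx: "ord x \<le> ord w" if "w \<in> carrier G" "w \<otimes> y \<noteq> y \<otimes> w" for w
    using p(2)[of "(w, y)"] that y xy by (simp add: P_def)
  have miny: "ord y \<le> ord w" if "w \<in> carrier G" "w \<otimes> x \<noteq> x \<otimes> w" for w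
    using p(2)[of "(x, w)"] that x xy by (simp add: P_def)
  obtain i where i: "ord x = 2 ^ i" "2 \<le> i" "(x \<otimes> x) \<otimes> y = y \<otimes> (x \<otimes> x)"
    using minimal_noncommuting_two_power[OF x y nc minx] by blast
  obtain j where j: "ord y = 2 ^ j" "2 \<le> j" "(y \<otimes> y) \<otimes> x = x \<otimes> (y \<otimes> y)"
    using minimal_noncommuting_two_power[OF y x nc[symmetric] miny] by blast
  have four: "w \<otimes> w \<noteq> \<one>" "(w \<otimes> w) \<otimes> (w \<otimes> w) = \<one>" if "w \<in> carrier G" "ord w = 4" for w
    using pow_eq_id[OF that(1), of 2] pow_eq_id[OF that(1), of 4] pow_two[OF that(1)] pow_four[OF that(1)] that(2) by simp_all
  have mixed: False if w: "w \<in> carrier G" "ord w = 4" and t: "t \<in> carrier G" "ord t = 2 ^ k" "3 \<le> k" "(t \<otimes> t) \<otimes> w = w \<otimes> (t \<otimes> t)"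
    and wt: "w \<otimes> t \<noteq> t \<otimes> w" for w t k
  proof (rule no_order_four_centralizing_pair[OF w(1) four[OF w] t(1) wt])
    \<comment> \<open>\<open>v\<close> is the power of \<open>t\<close> of order four; as a power of \<open>t^2\<close> it commutes with \<open>w\<close>\<close>
    define v where "v = (t \<otimes> t) [^] (2 ^ (k - 3) :: nat)"
    show vc: "v \<in> carrier G" using t by (simp add: v_def)
    have "t \<otimes> t \<in> centralizer {w}" "t \<otimes> t \<in> centralizer {t}" using t by (simp_all add: in_centralizer_iff m_assoc)
    then have "v \<in> centralizer {w}" "v \<in> centralizer {t}"
      unfolding v_def using w t subgroup_pow_closed[OF subgroup_centralizer] by simp_all
    then show "v \<otimes> w = w \<otimes> v" "v \<otimes> t = t \<otimes> v" by (simp_all add: in_centralizer_iff)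
    have kk: "2 * 2 ^ (k - 3) = (2::nat) ^ (k - 2)" using t(3) by (simp flip: power_Suc add: Suc_diff_le)
    have "v = t [^] (2 ^ (k - 2) :: nat)" unfolding v_def square_pow[OF t(1)] kk ..
    then have "ord v = 2 ^ k div 2 ^ (k - 2)" using ord_pow[OF t(1), of "2 ^ (k - 2)"] t(2) by (simp add: le_imp_power_dvd)
    also have "\<dots> = 2 ^ (k - (k - 2))" by (rule power_diff[symmetric]) simp_all
    also have "k - (k - 2) = 2" using t(3) by simp
    finally have "ord v = 4" by simp
    then show "v \<otimes> v \<noteq> \<one>" "(v \<otimes> v) \<otimes> (v \<otimes> v) = \<one>" using four[OF vc] by simp_all
  qed
  have not33: "\<not> (3 \<le> i \<and> 3 \<le> j)"
  proof
    assume ij': "3 \<le> i \<and> 3 \<le> j"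
    then have ij: "3 \<le> i" "3 \<le> j" by blast+
    note ne = pow_ne_one_of_two_power
    have min: "w \<otimes> y = y \<otimes> w" if w: "w \<in> carrier G" "(w \<otimes> w) \<otimes> (w \<otimes> w) = \<one>" for w
    proof (rule ccontr)
      assume "w \<otimes> y \<noteq> y \<otimes> w"
      then have "ord x \<le> ord w" using minx w by simp
      moreover have "ord w \<le> 4" using pow_eq_id[OF w(1), of 4] pow_four[OF w(1)] w(2) by (auto dest: dvd_imp_le)
      moreover have "(2::nat) ^ 3 \<le> 2 ^ i" using ij by (intro power_increasing) simp_all
      ultimately show False using i(1) by simp
    qed
    note commi = commutes_inv[OF _ y]
    define u where "u = x \<otimes> x"
    define v where "v = y \<otimes> y"
    have c: "u \<in> carrier G" "v \<in> carrier G" using x y by (simp_all add: u_def v_def)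
    have iv: "inv v = inv y \<otimes> inv y" using y by (simp add: v_def inv_mult_group)
    have 1: "u \<otimes> v = \<one> \<or> u \<otimes> u \<otimes> v = \<one>" unfolding u_def v_def
      by (rule noncommuting_large_two_powers[OF x i(1) _ y j(1) _ nc i(3) j(3) min]) (use ij in simp_all)
    have 2: "u \<otimes> inv v = \<one> \<or> u \<otimes> u \<otimes> inv v = \<one>" unfolding u_def iv
    proof (rule noncommuting_large_two_powers[OF x i(1) ij(1) inv_closed[OF y] _ ij(2)])
      show "ord (inv y) = 2 ^ j" using y j by simp
      show "x \<otimes> inv y \<noteq> inv y \<otimes> x"
      proof
        assume "x \<otimes> inv y = inv y \<otimes> x"
        then have "x \<otimes> y = y \<otimes> x" using x y by (metis inv_closed inv_solve_left inv_solve_right m_assoc m_closed)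
        then show False using nc by simp
      qed
      show "x \<otimes> x \<otimes> inv y = inv y \<otimes> (x \<otimes> x)" by (rule commi[OF _ i(3)]) (use x in simp)
      show "inv y \<otimes> inv y \<otimes> x = x \<otimes> (inv y \<otimes> inv y)"
        unfolding iv[symmetric] v_def using j(3) x y by (metis inv_closed inv_solve_left inv_solve_right m_assoc m_closed)
      show "w \<otimes> inv y = inv y \<otimes> w" if "w \<in> carrier G" "w \<otimes> w \<otimes> (w \<otimes> w) = \<one>" for w
        using commi min that by blast
    qed
    have "v = u \<or> v = u \<otimes> u" using 2 c by (metis inv_equality inv_inv inv_closed m_closed)
    then consider "u \<otimes> u = \<one>" | "u \<otimes> u \<otimes> u = \<one>" | "v = u \<otimes> u" "(u \<otimes> u) \<otimes> (u \<otimes> u) = \<one>"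
      using 1 c by (auto simp: m_assoc)
    then show False
    proof cases
      case 1 then show False using ne[OF x i(1), of 4] pow_four[OF x] ij by (simp add: u_def)
    next
      case 2
      have "x [^] (6 :: nat) = u [^] (3 :: nat)" using square_pow[OF x, of 3] by (simp add: u_def)
      then show False using 2 ne[OF x i(1), of 6] pow_three[OF c(1)] ij by simp
    next
      case 3
      then have "v \<otimes> v = \<one>" by simp
      then show False using ne[OF y j(1), of 4] pow_four[OF y] ij by (simp add: v_def)
    qed
  qed
  have "i = 2"
  proof (rule ccontr)
    assume "i \<noteq> 2"
    then have "3 \<le> i" "j = 2" using i(2) j(2) not33 by linarith+
    then show False using mixed[OF y _ x i(1) _ i(3) nc[symmetric]] j(1) by simp
  qed
  have "j = 2"
  proof (rule ccontr)
    assume "j \<noteq> 2"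
    then have "3 \<le> j" using j(2) by linarith
    then show False using mixed[OF x _ y j(1) _ j(3) nc] i(1) \<open>i = 2\<close> by simp
  qed
  have x4: "x \<otimes> x \<noteq> \<one>" "(x \<otimes> x) \<otimes> (x \<otimes> x) = \<one>" using four[OF x] i(1) \<open>i = 2\<close> by simp_all
  have y4: "y \<otimes> y \<noteq> \<one>" "(y \<otimes> y) \<otimes> (y \<otimes> y) = \<one>" using four[OF y] j(1) \<open>j = 2\<close> by simp_all
  have 1: "x \<otimes> y = y \<otimes> inv x" using order_four_normal[OF x x4 y] nc by blast
  have 2: "y \<otimes> x = x \<otimes> inv y" using order_four_normal[OF y y4 x] nc by metis
  have yx: "y \<otimes> x = inv x \<otimes> y"
  proof -
    have "inv x \<otimes> (x \<otimes> y) \<otimes> x = inv x \<otimes> (y \<otimes> inv x) \<otimes> x" using 1 by simp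
    then show ?thesis using x y by (simp add: word_simps)
  qed
  have yy: "y \<otimes> y = x \<otimes> x"
  proof -
    have "x \<otimes> inv y \<otimes> y = inv x \<otimes> y \<otimes> y" using 2 yx by simp
    then have "x = inv x \<otimes> (y \<otimes> y)" using x y by (simp add: m_assoc)
    then have "x \<otimes> x = x \<otimes> (inv x \<otimes> (y \<otimes> y))" by simp
    then show ?thesis using x y by (simp add: inv_mult_cancel)
  qed
  show thesis by (rule that[of x y]) (use x y x4 yy yx in \<open>simp add: quaternion_pair_def\<close>)
qed

text \<open>
  No element of order four commutes with \<open>x\<close> and \<open>y\<close>, so the order of \<open>c\<close> is not divisible by four and
  \<open>d = c^2\<close> has odd order; hence \<open>d\<close> is central. If \<open>d \<noteq> \<one>\<close>, then the centralizer \<open>K\<close> of \<open>x\<close> has at least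
  12 elements, and \<open>coset_test_square\<close> for \<open>yd\<close> and \<open>h = xd\<close> expresses \<open>(yd) h (yd)^-1 = x^-1 d\<close> by
  powers of \<open>h\<close> and of \<open>(yd)^2 = x^2 d^2\<close>. The parts of order dividing four and of odd order disagree in
  every case.
\<close>

lemma quaternion_centralizer_exponent_two:
  assumes q: "quaternion_pair x y" and c: "c \<in> carrier G" "c \<otimes> x = x \<otimes> c" "c \<otimes> y = y \<otimes> c"
  shows "c \<otimes> c = \<one>"
proof (rule ccontr)
  assume cc: "c \<otimes> c \<noteq> \<one>"
  have q: "x \<in> carrier G" "y \<in> carrier G" "x \<otimes> x \<noteq> \<one>" "(x \<otimes> x) \<otimes> (x \<otimes> x) = \<one>" "y \<otimes> y = x \<otimes> x" "y \<otimes> x = inv x \<otimes> y"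
    using q by (simp_all add: quaternion_pair_def)
  have xix: "x \<noteq> inv x" using q(1,3) by (metis r_inv)
  have nc: "x \<otimes> y \<noteq> y \<otimes> x" using q xix by (metis inv_closed right_cancel)
  have no4: False if w: "w \<in> carrier G" "w \<otimes> x = x \<otimes> w" "w \<otimes> y = y \<otimes> w" "ord w = 4" for w
  proof (rule no_order_four_centralizing_pair[OF q(1,3,4,2) nc w(1-3)])
    show "w \<otimes> w \<noteq> \<one>" "(w \<otimes> w) \<otimes> (w \<otimes> w) = \<one>"
      using pow_eq_id[OF w(1), of 2] pow_eq_id[OF w(1), of 4] pow_two[OF w(1)] pow_four[OF w(1)] w(4) by simp_all
  qed
  define C where "C = centralizer {x, y}"
  have C: "subgroup C G" unfolding C_def using q by (intro subgroup_centralizer) simp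
  have Ciff: "k \<in> C \<longleftrightarrow> k \<in> carrier G \<and> k \<otimes> x = x \<otimes> k \<and> k \<otimes> y = y \<otimes> k" for k
    unfolding C_def in_centralizer_iff by blast
  have cC: "c \<in> C" using c Ciff by blast
  have o1: "0 < ord c" using ord_ge_1[OF finite_carrier c(1)] by simp
  have "\<not> 4 dvd ord c"
  proof
    assume "4 dvd ord c"
    then obtain m where m: "ord c = 4 * m" by (elim dvdE)
    have "ord (c [^] m) = 4" using ord_pow[OF c(1), of m] m o1 by simp
    moreover have "c [^] m \<in> C" by (rule subgroup_pow_closed[OF C cC])
    ultimately show False using no4[of "c [^] m"] Ciff by blast
  qed
  define d where "d = c \<otimes> c"
  have dc: "d \<in> carrier G" using c by (simp add: d_def)
  have dC: "d \<in> C" unfolding d_def by (rule subgroup.m_closed[OF C cC cC])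
  have od: "odd (ord d)"
  proof
    assume "even (ord d)"
    have d2: "ord d = ord c div gcd (ord c) 2" using ord_pow_gen[OF c(1), of 2] pow_two[OF c(1)] by (simp add: d_def)
    show False
    proof (cases "even (ord c)")
      case True
      then obtain m where m: "ord c = 2 * m" by (elim evenE)
      then have "ord d = m" using d2 by simp
      then show False using \<open>even (ord d)\<close> m \<open>\<not> 4 dvd ord c\<close> by (auto elim!: evenE)
    next
      case False
      then have "gcd (ord c) 2 = 1" by (simp add: coprime_iff_gcd_eq_1[symmetric])
      then show False using d2 False \<open>even (ord d)\<close> by simp
    qed
  qed
  have d1: "d \<noteq> \<one>" using cc by (simp add: d_def)
  have dcom: "g \<otimes> d = d \<otimes> g" if "g \<in> carrier G" for g using odd_order_commutes[OF dc od that] .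
  let ?D = "generate G {d}"
  have D: "subgroup ?D G" using dc by (intro generate_is_subgroup) simp
  have dD: "d \<in> ?D" by (simp add: generate.incl)
  have ox: "ord x = 4" using ord_eqI[OF q(1,3), of 4] pow_four[OF q(1)] q(4) by simp
  have triv: "e = \<one>" if "e \<in> ?D" "e [^] (4 :: nat) = \<one>" for e
  proof (rule eq_one_if_coprime_pows[of e "ord d" 4])
    show "e \<in> carrier G" using that(1) subgroup.subset[OF D] by blast
    show "e [^] ord d = \<one>" by (rule generate_elem_pow_ord[OF dc finite_carrier that(1)])
    have "coprime (ord d) (2 ^ 2)" using od by (simp only: coprime_power_right_iff coprime_right_2_iff_odd simp_thms)
    then show "coprime (ord d) 4" by simp
  qed (rule that(2))
  define z where "z = x \<otimes> x"
  have zc: "z \<in> carrier G" using q by (simp add: z_def)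
  have z: "z \<noteq> \<one>" "z \<otimes> z = \<one>" using q by (simp_all add: z_def)
  have zD: "z \<notin> ?D" using triv[of z] z pow_four[OF zc] zc by auto
  have xD: "x \<notin> ?D" using triv[of x] q(1,4) pow_four[OF q(1)] q(3) by auto
  have dd: "d \<otimes> d \<noteq> \<one>" using triv[OF dD] d1 pow_four[OF dc] by auto
  have ix: "inv x = z \<otimes> x" using z q(1) by (intro inv_equality) (simp_all add: z_def m_assoc)
  have zx: "z \<otimes> x = x \<otimes> z" using q(1) by (simp add: z_def m_assoc)
  define K where "K = centralizer {x}"
  have K: "subgroup K G" unfolding K_def using q by (intro subgroup_centralizer) simp
  have Kiff: "k \<in> K \<longleftrightarrow> k \<in> carrier G \<and> k \<otimes> x = x \<otimes> k" for k unfolding K_def in_centralizer_iff by simp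
  have xK: "x \<in> K" and dK: "d \<in> K" using q dC Kiff Ciff by simp_all
  define b where "b = y \<otimes> d"
  define h where "h = x \<otimes> d"
  have bc: "b \<in> carrier G" and hc: "h \<in> carrier G" using q dc by (simp_all add: b_def h_def)
  have hK: "h \<in> K" unfolding h_def by (rule subgroup.m_closed[OF K xK dK])
  have dx: "x \<otimes> d = d \<otimes> x" and dy: "y \<otimes> d = d \<otimes> y" using dcom q by simp_all
  have bx: "b \<otimes> x = inv x \<otimes> b"
  proof -
    have "b \<otimes> x = y \<otimes> (d \<otimes> x)" using q(1,2) dc by (simp add: b_def m_assoc)
    also have "\<dots> = (y \<otimes> x) \<otimes> d" unfolding dx[symmetric] using q(1,2) dc by (simp add: m_assoc)
    finally show ?thesis unfolding q(6) b_def using q(1,2) dc by (simp add: m_assoc)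
  qed
  have bb: "b \<otimes> b = z \<otimes> (d \<otimes> d)"
  proof -
    have "b \<otimes> b = y \<otimes> (d \<otimes> y) \<otimes> d" using q(2) dc by (simp add: b_def m_assoc)
    also have "\<dots> = (y \<otimes> y) \<otimes> (d \<otimes> d)" unfolding dy[symmetric] using q(2) dc by (simp add: m_assoc)
    finally show ?thesis unfolding q(5) z_def .
  qed
  have bK: "b \<notin> K"
  proof
    assume "b \<in> K"
    then have "inv x \<otimes> b = x \<otimes> b" using bx Kiff by simp
    then have "inv x = x" using bc q(1) by simp
    then show False using xix by simp
  qed
  have nrm: "b \<otimes> k \<otimes> inv b \<in> K" if "k \<in> K" for k
  proof -
    have k: "k \<in> carrier G" "k \<otimes> x = x \<otimes> k" using that Kiff by simp_all
    have ibx: "inv b \<otimes> x = inv x \<otimes> inv b" by (rule invertsD(2)[OF bx bc q(1)])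
    have "inv b \<otimes> x \<otimes> b = inv x" unfolding ibx using bc q(1) by (simp add: m_assoc)
    then show ?thesis
      using conj_in_centralizer[of "{x}" b k] commutes_inv[OF k(1) q(1) k(2)] that bc q(1) unfolding K_def by simp
  qed
  have cK: "8 < card K"
  proof -
    have "coprime (ord d) (2 ^ 2)" using od by (simp only: coprime_power_right_iff coprime_right_2_iff_odd simp_thms)
    then have "coprime (ord d) (ord x)" using ox by simp
    then have dv: "ord d * ord x dvd card K" using ord_dvd_card_subgroup[OF K dK] ord_dvd_card_subgroup[OF K xK]
      by (rule divides_mult[rotated 2])
    have "ord d \<noteq> 0" "ord d \<noteq> 2" using od by (metis even_zero, metis even_numeral)
    moreover have "ord d \<noteq> 1" using d1 ord_eq_1[OF dc] by metis
    ultimately have "3 \<le> ord d" by linarith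
    moreover have "ord d * 4 \<le> card K"
      using dvd_imp_le[OF dv subgroup.finite_imp_card_positive[OF K finite_carrier]] ox by simp
    ultimately show ?thesis by linarith
  qed
  have comm: "b \<otimes> b \<otimes> h = h \<otimes> (b \<otimes> b)"
  proof -
    have "subgroup (centralizer {h}) G" using hc by (intro subgroup_centralizer) simp
    moreover have "x \<in> centralizer {h}" "d \<in> centralizer {h}"
    proof -
      have "x \<otimes> (x \<otimes> d) = (x \<otimes> d) \<otimes> x" using q(1) dc dx by (metis m_assoc)
      then show "x \<in> centralizer {h}" using q(1) by (simp add: in_centralizer_iff h_def)
      show "d \<in> centralizer {h}" using dc dcom[OF hc] by (simp add: in_centralizer_iff)
    qed
    ultimately have "x \<otimes> x \<otimes> (d \<otimes> d) \<in> centralizer {h}" by (intro subgroup.m_closed)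
    then show ?thesis unfolding bb z_def in_centralizer_iff by simp
  qed
  obtain p r where pr: "p \<in> {\<one>, h, inv h}" "r \<in> {\<one>, b \<otimes> b, inv (b \<otimes> b)}" "b \<otimes> h \<otimes> inv b = p \<otimes> r"
    using coset_test_square[OF K bc bK nrm cK hK comm] by blast
  \<comment> \<open>from here on the factors of order dividing four and of odd order are separated\<close>
  have bh: "b \<otimes> h \<otimes> inv b = inv x \<otimes> d"
  proof -
    have "b \<otimes> h = (b \<otimes> x) \<otimes> d" unfolding h_def using bc q(1) dc by (simp add: m_assoc)
    also have "\<dots> = inv x \<otimes> (b \<otimes> d)" unfolding bx using bc q(1) dc by (simp add: m_assoc)
    also have "\<dots> = (inv x \<otimes> d) \<otimes> b" unfolding dcom[OF bc] using bc q(1) dc by (simp add: m_assoc)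
    finally show ?thesis using bc q(1) dc by (simp add: m_assoc)
  qed
  have iz: "inv z = z" using z zc by (simp add: inv_equality)
  obtain w f where wf: "w \<in> {\<one>, z}" "f \<in> {\<one>, d \<otimes> d, inv (d \<otimes> d)}" "r = w \<otimes> f" "w = \<one> \<longleftrightarrow> f = \<one>"
  proof -
    have zd: "z \<otimes> (d \<otimes> d) = d \<otimes> d \<otimes> z" using dcom[OF zc] zc dc by (metis m_assoc)
    have i: "inv (b \<otimes> b) = z \<otimes> inv (d \<otimes> d)" unfolding bb zd using zc dc by (simp add: inv_mult_group iz)
    have ddi: "inv (d \<otimes> d) \<noteq> \<one>" using dd dc by simp
    have "r = \<one> \<or> r = b \<otimes> b \<or> r = inv (b \<otimes> b)" using pr(2) by blast
    then have "r = \<one> \<otimes> \<one> \<or> r = z \<otimes> (d \<otimes> d) \<or> r = z \<otimes> inv (d \<otimes> d)" using i bb by (metis l_one one_closed)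
    then show thesis using that[of \<one> \<one>] that[of z "d \<otimes> d"] that[of z "inv (d \<otimes> d)"] z dd ddi by blast
  qed
  have fD: "f \<in> ?D"
  proof -
    have "d \<otimes> d \<in> ?D" by (rule subgroup.m_closed[OF D dD dD])
    moreover have "inv (d \<otimes> d) \<in> ?D" by (rule subgroup.m_inv_closed[OF D calculation])
    ultimately show ?thesis using wf(2) subgroup.one_closed[OF D] by blast
  qed
  have wc: "w \<in> carrier G" and fc: "f \<in> carrier G" using wf zc dc by auto
  have eq: "inv x \<otimes> d = p \<otimes> (w \<otimes> f)" using pr(3) bh wf(3) by simp
  have iD: "inv d \<in> ?D" by (rule subgroup.m_inv_closed[OF D dD])
  consider "p = \<one>" | "p = h" | "p = inv h" using pr(1) by blast
  then show False
  proof cases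
    case 1
    then have "inv x \<otimes> d = w \<otimes> f" using eq wc fc by simp
    then have "inv x = w \<otimes> f \<otimes> inv d" using q(1) dc wc fc by (metis inv_closed inv_solve_right m_closed)
    then have "inv w \<otimes> inv x = f \<otimes> inv d" using q(1) dc wc fc by (simp add: m_assoc inv_mult_cancel)
    moreover have "f \<otimes> inv d \<in> ?D" by (rule subgroup.m_closed[OF D fD iD])
    ultimately have "inv w \<otimes> inv x \<in> ?D" by simp
    moreover have "inv w \<otimes> inv x = x \<or> inv w \<otimes> inv x = inv x"
      using wf(1) q(1) zc z assoc_rewrite[OF z(2) zc zc q(1)] by (auto simp: iz ix)
    ultimately have "x \<in> ?D" using subgroup.m_inv_closed[OF D, of "inv x"] q(1) by auto
    then show False using xD by simp
  next
    case 2
    then have "inv x \<otimes> d = x \<otimes> d \<otimes> (w \<otimes> f)" using eq by (simp add: h_def)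
    also have "\<dots> = (x \<otimes> (w \<otimes> f)) \<otimes> d" using dcom[of "w \<otimes> f"] q(1) dc wc fc by (simp add: m_assoc)
    finally have "inv x = x \<otimes> (w \<otimes> f)" using q(1) dc wc fc by simp
    then have "x \<otimes> z = x \<otimes> (w \<otimes> f)" unfolding ix zx .
    then have zwf: "z = w \<otimes> f" using q(1) zc wc fc by simp
    show False
    proof (cases "w = \<one>")
      case True then show False using zwf wf(4) z by simp
    next
      case False
      then have "w = z" using wf(1) by blast
      then have "f = \<one>" using zwf zc fc by simp
      then show False using wf(4) False by simp
    qed
  next
    case 3
    then have "inv x \<otimes> d = inv d \<otimes> inv x \<otimes> (w \<otimes> f)" using eq q(1) dc by (simp add: h_def inv_mult_group)
    also have "inv d \<otimes> inv x = inv x \<otimes> inv d" using dx q(1) dc by (metis inv_mult_group)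
    finally have "d = inv d \<otimes> (w \<otimes> f)" using q(1) dc wc fc by (simp add: m_assoc)
    then have "d \<otimes> d = d \<otimes> (inv d \<otimes> (w \<otimes> f))" by simp
    then have ddw: "d \<otimes> d = w \<otimes> f" using dc wc fc by (simp add: inv_mult_cancel)
    show False
    proof (cases "w = \<one>")
      case True then show False using ddw wf(4) dd by simp
    next
      case False
      then have "w = z" using wf(1) by blast
      then have "z = d \<otimes> d \<otimes> inv f" using ddw zc fc dc by (metis inv_solve_right m_closed)
      moreover have "d \<otimes> d \<otimes> inv f \<in> ?D"
        by (rule subgroup.m_closed[OF D subgroup.m_closed[OF D dD dD] subgroup.m_inv_closed[OF D fD]])
      ultimately show False using zD by simp
    qed
  qed
qed

end

section \<open>The classification\<close>

abbreviation elementary :: "nat \<Rightarrow> (nat \<Rightarrow> int) monoid" where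
  "elementary n \<equiv> product_group {..<n} (\<lambda>_. integer_mod_group 2)"

lemma elementary_restrict:
  assumes "v \<in> carrier (elementary (Suc n))"
  shows "restrict v {..<n} \<in> carrier (elementary n)" "v n = 0 \<or> v n = 1"
proof -
  have v: "v i \<in> {0..<2}" if "i < Suc n" for i
    using assms that by (auto simp: carrier_integer_mod_group PiE_iff)
  then show "restrict v {..<n} \<in> carrier (elementary n)" by (auto simp: carrier_integer_mod_group)
  show "v n = 0 \<or> v n = 1" using v[of n] by auto
qed

lemma elementary_restrict_mult:
  "restrict (u \<otimes>\<^bsub>elementary (Suc n)\<^esub> v) {..<n} = restrict u {..<n} \<otimes>\<^bsub>elementary n\<^esub> restrict v {..<n}"
  "(u \<otimes>\<^bsub>elementary (Suc n)\<^esub> v) n = (u n + v n) mod 2"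
  by (auto simp: restrict_def)

context central_involutions begin

text \<open>
  The additional coordinate is mapped to the central involution \<open>c\<close>; the map stays injective because
  \<open>c\<close> is not in the image.
\<close>

lemma extend_elementary_embedding:
  assumes h: "h \<in> hom (dicyclic 2 \<times>\<times> elementary n) G" "inj_on h (carrier (dicyclic 2 \<times>\<times> elementary n))"
    and c: "c \<in> carrier G" "c \<otimes> c = \<one>" "c \<notin> h ` carrier (dicyclic 2 \<times>\<times> elementary n)"
  shows "\<exists>h' \<in> hom (dicyclic 2 \<times>\<times> elementary (Suc n)) G. inj_on h' (carrier (dicyclic 2 \<times>\<times> elementary (Suc n)))
    \<and> h ` carrier (dicyclic 2 \<times>\<times> elementary n) \<subseteq> h' ` carrier (dicyclic 2 \<times>\<times> elementary (Suc n))"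
proof -
  let ?P = "dicyclic 2 \<times>\<times> elementary n" and ?P' = "dicyclic 2 \<times>\<times> elementary (Suc n)"
  have gP: "group ?P" and gP': "group ?P'" by (rule balanced_dicyclic_times_elementary)+
  interpret P: group ?P by (rule gP)
  interpret P': group ?P' by (rule gP')
  interpret h: group_hom ?P G h using h(1) by (simp add: group_hom_def group_hom_axioms_def gP)
  define e where "e v = (if v n = 0 then \<one> else c)" for v :: "nat \<Rightarrow> int"
  define h' where "h' p = h (fst p, restrict (snd p) {..<n}) \<otimes> e (snd p)" for p
  have ec: "e v \<in> carrier G" for v using c by (simp add: e_def)
  have ecomm: "g \<otimes> e v = e v \<otimes> g" if "g \<in> carrier G" for g v
    using involution_central[OF c(1,2) that] that by (simp add: e_def)
  have emult: "e (u \<otimes>\<^bsub>elementary (Suc n)\<^esub> v) = e u \<otimes> e v"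
    if "u \<in> carrier (elementary (Suc n))" "v \<in> carrier (elementary (Suc n))" for u v
    using elementary_restrict(2)[OF that(1)] elementary_restrict(2)[OF that(2)] c
    unfolding e_def elementary_restrict_mult(2) by auto
  have in_P: "(q, restrict v {..<n}) \<in> carrier ?P" if "(q, v) \<in> carrier ?P'" for q v
    using that elementary_restrict(1)[of v n] by (simp del: carrier_product_group)
  have hom: "h' \<in> hom ?P' G"
  proof (rule homI)
    fix p assume p: "p \<in> carrier ?P'"
    then show "h' p \<in> carrier G" unfolding h'_def using in_P[of "fst p" "snd p"] ec by (simp del: carrier_DirProd)
    fix p' assume p': "p' \<in> carrier ?P'"
    obtain q u where qu: "p = (q, u)" by (cases p)
    obtain q' u' where qu': "p' = (q', u')" by (cases p')
    have m: "(q, restrict u {..<n}) \<in> carrier ?P" "(q', restrict u' {..<n}) \<in> carrier ?P"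
      using in_P p p' qu qu' by blast+
    have uc: "u \<in> carrier (elementary (Suc n))" "u' \<in> carrier (elementary (Suc n))"
      using p p' qu qu' by (simp_all del: carrier_product_group)
    have "h' (p \<otimes>\<^bsub>?P'\<^esub> p') = h ((q, restrict u {..<n}) \<otimes>\<^bsub>?P\<^esub> (q', restrict u' {..<n})) \<otimes> (e u \<otimes> e u')"
      unfolding h'_def qu qu' mult_DirProd fst_conv snd_conv elementary_restrict_mult(1) emult[OF uc] ..
    also have "\<dots> = (h (q, restrict u {..<n}) \<otimes> h (q', restrict u' {..<n})) \<otimes> (e u \<otimes> e u')"
      using h.hom_mult[OF m] by simp
    also have "\<dots> = (h (q, restrict u {..<n}) \<otimes> e u) \<otimes> (h (q', restrict u' {..<n}) \<otimes> e u')"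
      using ecomm[of "h (q', restrict u' {..<n})" u] h.hom_closed[OF m(1)] h.hom_closed[OF m(2)] ec
      by (metis m_assoc m_closed)
    finally show "h' (p \<otimes>\<^bsub>?P'\<^esub> p') = h' p \<otimes> h' p'" unfolding h'_def qu qu' by simp
  qed
  interpret h': group_hom ?P' G h' using hom by (simp add: group_hom_def group_hom_axioms_def gP')
  have "inj_on h' (carrier ?P')" unfolding h'.inj_on_one_iff
  proof (intro allI impI)
    fix p assume p: "p \<in> carrier ?P'" "h' p = \<one>"
    obtain q u where qu: "p = (q, u)" by (cases p)
    have m: "(q, restrict u {..<n}) \<in> carrier ?P" using in_P p qu by blast
    have uc: "u \<in> carrier (elementary (Suc n))" using p qu by (simp del: carrier_product_group)
    have hm: "h (q, restrict u {..<n}) \<in> carrier G" by (rule h.hom_closed[OF m])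
    have eq: "h (q, restrict u {..<n}) \<otimes> e u = \<one>" using p(2) unfolding h'_def qu by simp
    have un: "u n = 0"
    proof (rule ccontr)
      assume "u n \<noteq> 0"
      then have "h (q, restrict u {..<n}) \<otimes> c = \<one>" using eq by (simp add: e_def)
      then have "inv c = h (q, restrict u {..<n})" using hm c(1) by (intro inv_equality)
      moreover have "inv c = c" using c by (simp add: inv_equality)
      ultimately have "h (q, restrict u {..<n}) = c" by simp
      then show False using c(3) imageI[OF m, of h] by simp
    qed
    then have "h (q, restrict u {..<n}) = \<one>" using eq hm by (simp add: e_def)
    then have "(q, restrict u {..<n}) = \<one>\<^bsub>?P\<^esub>" using h(2) m unfolding h.inj_on_one_iff by blast
    then have q: "q = \<one>\<^bsub>dicyclic 2\<^esub>" "restrict u {..<n} = restrict (\<lambda>_. 0) {..<n}" by simp_all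
    have "u = restrict (\<lambda>_. 0) {..<Suc n}"
    proof (rule PiE_ext)
      show "u \<in> (\<Pi>\<^sub>E i\<in>{..<Suc n}. carrier (integer_mod_group 2))" using uc by simp
      show "restrict (\<lambda>_. 0) {..<Suc n} \<in> (\<Pi>\<^sub>E i\<in>{..<Suc n}. carrier (integer_mod_group 2))" by simp
      fix i assume "i \<in> {..<Suc n}"
      then have "i < n \<or> i = n" by auto
      then show "u i = restrict (\<lambda>_. 0) {..<Suc n} i"
        using un fun_cong[OF q(2), of i] by auto
    qed
    then show "p = \<one>\<^bsub>?P'\<^esub>" using q(1) qu by simp
  qed
  moreover have "h ` carrier ?P \<subseteq> h' ` carrier ?P'"
  proof (rule image_subsetI)
    fix p assume p: "p \<in> carrier ?P"
    obtain q u where qu: "p = (q, u)" by (cases p)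
    have uP: "u \<in> (\<Pi>\<^sub>E i\<in>{..<n}. carrier (integer_mod_group 2))" and qc: "q \<in> carrier (dicyclic 2)" using p qu by simp_all
    define w where "w = u(n := 0)"
    have wP: "w \<in> (\<Pi>\<^sub>E i\<in>{..<Suc n}. carrier (integer_mod_group 2))"
      using uP by (auto simp: w_def PiE_iff extensional_def)
    have "restrict w {..<n} = u" using uP by (auto simp: w_def PiE_iff extensional_def restrict_def)
    then have "h' (q, w) = h (q, u) \<otimes> \<one>" by (simp add: h'_def e_def w_def)
    then have "h p = h' (q, w)" using h.hom_closed[OF p] qu by simp
    moreover have "(q, w) \<in> carrier ?P'" using qc wP by simp
    ultimately show "h p \<in> h' ` carrier ?P'" by blast
  qed
  ultimately show ?thesis using hom by blast
qed

text \<open>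
  The embedding of \<open>Q\<^sub>8\<close> is extended by one central involution at a time, as long as it is not onto.
  If \<open>g\<close> lies outside the image, then \<open>g\<close> sends \<open>x\<close> to \<open>x\<close> or \<open>x^-1\<close> and \<open>y\<close> to \<open>y\<close> or \<open>y^-1\<close>.
  Conjugation by one of \<open>\<one>, x, y, xy\<close> does the same, so for a suitable such \<open>t\<close> the product \<open>g t\<close>
  commutes with \<open>x\<close> and \<open>y\<close>. It is an involution by \<open>quaternion_centralizer_exponent_two\<close>, and it lies
  outside the image as well. The process stops because each step doubles the image.
\<close>

theorem quaternion_pair_iso:
  assumes q: "quaternion_pair x y"
  shows "\<exists>n. G \<cong> dicyclic 2 \<times>\<times> elementary n"
proof -
  have qp: "x \<in> carrier G" "y \<in> carrier G" "x \<otimes> x \<noteq> \<one>" "(x \<otimes> x) \<otimes> (x \<otimes> x) = \<one>" "y \<otimes> y = x \<otimes> x" "y \<otimes> x = inv x \<otimes> y"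
    using q by (simp_all add: quaternion_pair_def)
  define good where "good n h \<longleftrightarrow> h \<in> hom (dicyclic 2 \<times>\<times> elementary n) G \<and>
    inj_on h (carrier (dicyclic 2 \<times>\<times> elementary n)) \<and> x \<in> h ` carrier (dicyclic 2 \<times>\<times> elementary n) \<and>
    y \<in> h ` carrier (dicyclic 2 \<times>\<times> elementary n)" for n h
  have base: "\<exists>h. good 0 h"
  proof -
    obtain f where f: "f \<in> hom (dicyclic 2) G" "inj_on f (carrier (dicyclic 2))"
      "x \<in> f ` carrier (dicyclic 2)" "y \<in> f ` carrier (dicyclic 2)"
      using quaternion_embedding[OF q] by blast
    have "(f \<circ> fst) \<in> hom (dicyclic 2 \<times>\<times> elementary 0) G"
      using f(1) by (auto simp: hom_def)
    moreover have "inj_on (f \<circ> fst) (carrier (dicyclic 2 \<times>\<times> elementary 0))"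
      using f(2) by (auto simp: inj_on_def)
    moreover have "(f \<circ> fst) ` carrier (dicyclic 2 \<times>\<times> elementary 0) = f ` carrier (dicyclic 2)"
      by (auto simp: image_iff)
    ultimately show ?thesis unfolding good_def using f(3,4) by metis
  qed
  have step: "(\<exists>h. good (Suc n) h) \<or> G \<cong> dicyclic 2 \<times>\<times> elementary n" if g: "good n h" for n h
  proof (cases "h ` carrier (dicyclic 2 \<times>\<times> elementary n) = carrier G")
    case True
    have "h \<in> iso (dicyclic 2 \<times>\<times> elementary n) G" using g True by (simp add: good_def iso_def bij_betw_def)
    then have "dicyclic 2 \<times>\<times> elementary n \<cong> G" by (rule is_isoI)
    then show ?thesis using group.iso_sym[OF balanced_dicyclic_times_elementary(1)] by blast
  next
    case False
    let ?P = "dicyclic 2 \<times>\<times> elementary n"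
    define H where "H = h ` carrier ?P"
    have gh: "h \<in> hom ?P G" "inj_on h (carrier ?P)" "x \<in> H" "y \<in> H" using g by (simp_all add: good_def H_def)
    have gP: "group ?P" by (rule balanced_dicyclic_times_elementary)
    interpret h: group_hom ?P G h using gh(1) by (simp add: group_hom_def group_hom_axioms_def gP)
    have H: "subgroup H G" unfolding H_def by (rule h.img_is_subgroup)
    obtain g where gG: "g \<in> carrier G" "g \<notin> H" using False subgroup.subset[OF H] unfolding H_def by blast
    have y4: "y \<otimes> y \<noteq> \<one>" "(y \<otimes> y) \<otimes> (y \<otimes> y) = \<one>" using qp by simp_all
    have xg: "x \<otimes> g = g \<otimes> x \<or> x \<otimes> g = g \<otimes> inv x" by (rule order_four_normal[OF qp(1,3,4) gG(1)])
    have yg: "y \<otimes> g = g \<otimes> y \<or> y \<otimes> g = g \<otimes> inv y" by (rule order_four_normal[OF qp(2) y4 gG(1)])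
    have xy: "x \<otimes> y = y \<otimes> inv x" using invertsD(1)[OF qp(6,2,1)] by simp
    have ixy: "inv x \<otimes> y = y \<otimes> x" using qp(6) by simp
    have yx: "y \<otimes> x = x \<otimes> inv y"
    proof -
      have iy: "inv y = inv (x \<otimes> x) \<otimes> y"
        using qp by (intro inv_equality) (simp_all add: m_assoc)
      have "x \<otimes> inv y = x \<otimes> (inv x \<otimes> inv x) \<otimes> y" unfolding iy using qp(1,2) by (simp add: m_assoc inv_mult_group)
      then show ?thesis using qp(1,2,6) by (simp add: inv_mult_cancel)
    qed
    have iyx: "inv y \<otimes> x = x \<otimes> y"
    proof -
      have "inv y \<otimes> (y \<otimes> x) \<otimes> y = inv y \<otimes> (x \<otimes> inv y) \<otimes> y" using yx by simp
      then show ?thesis using qp(1,2) by (simp add: m_assoc inv_mult_cancel)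
    qed
    \<comment> \<open>a product \<open>g t\<close> that commutes with \<open>x\<close> and \<open>y\<close> allows the extension to be continued\<close>
    have main: False if t: "t \<in> H" "t \<in> carrier G" "x \<otimes> (g \<otimes> t) = (g \<otimes> t) \<otimes> x" "y \<otimes> (g \<otimes> t) = (g \<otimes> t) \<otimes> y"
      and no: "\<not> (\<exists>h. good (Suc n) h)" for t
    proof -
      have gt: "g \<otimes> t \<in> carrier G" using gG t by simp
      have sq: "(g \<otimes> t) \<otimes> (g \<otimes> t) = \<one>"
        by (rule quaternion_centralizer_exponent_two[OF q gt t(3)[symmetric] t(4)[symmetric]])
      have "g \<otimes> t \<notin> H"
      proof
        assume "g \<otimes> t \<in> H"
        then have "g \<otimes> t \<otimes> inv t \<in> H" by (rule subgroup.m_closed[OF H _ subgroup.m_inv_closed[OF H t(1)]])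
        then show False using gG t by (simp add: m_assoc)
      qed
      then have "\<exists>h' \<in> hom (dicyclic 2 \<times>\<times> elementary (Suc n)) G. inj_on h' (carrier (dicyclic 2 \<times>\<times> elementary (Suc n)))
          \<and> H \<subseteq> h' ` carrier (dicyclic 2 \<times>\<times> elementary (Suc n))"
        unfolding H_def by (intro extend_elementary_embedding[OF gh(1,2) gt sq])
      then show False using no gh(3,4) unfolding good_def by blast
    qed
    have "\<exists>t. t \<in> H \<and> t \<in> carrier G \<and> x \<otimes> (g \<otimes> t) = (g \<otimes> t) \<otimes> x \<and> y \<otimes> (g \<otimes> t) = (g \<otimes> t) \<otimes> y"
    proof -
      note c = qp(1,2) gG(1)
      consider "x \<otimes> g = g \<otimes> x" "y \<otimes> g = g \<otimes> y" | "x \<otimes> g = g \<otimes> x" "y \<otimes> g = g \<otimes> inv y"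
        | "x \<otimes> g = g \<otimes> inv x" "y \<otimes> g = g \<otimes> y" | "x \<otimes> g = g \<otimes> inv x" "y \<otimes> g = g \<otimes> inv y" using xg yg by blast
      then show ?thesis
      proof cases
        case 1
        then show ?thesis using c subgroup.one_closed[OF H] by (intro exI[of _ \<one>]) simp
      next
        case 2
        have "x \<otimes> (g \<otimes> x) = (g \<otimes> x) \<otimes> x" using assoc_rewrite[OF 2(1) c(1,3,1)] .
        moreover have "y \<otimes> (g \<otimes> x) = (g \<otimes> x) \<otimes> y" using assoc_rewrite[OF 2(2) c(2,3,1)] c iyx by (simp add: m_assoc)
        ultimately show ?thesis using c gh(3) by blast
      next
        case 3
        have "x \<otimes> (g \<otimes> y) = (g \<otimes> y) \<otimes> x" using assoc_rewrite[OF 3(1) c(1,3,2)] c ixy by (simp add: m_assoc)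
        moreover have "y \<otimes> (g \<otimes> y) = (g \<otimes> y) \<otimes> y" using assoc_rewrite[OF 3(2) c(2,3,2)] .
        ultimately show ?thesis using c gh(4) by blast
      next
        case 4
        have "x \<otimes> (g \<otimes> (x \<otimes> y)) = (g \<otimes> (x \<otimes> y)) \<otimes> x"
        proof -
          have "x \<otimes> (g \<otimes> (x \<otimes> y)) = g \<otimes> y" using assoc_rewrite[OF 4(1) c(1,3), of "x \<otimes> y"] c by (simp add: m_assoc inv_mult_cancel)
          moreover have "(g \<otimes> (x \<otimes> y)) \<otimes> x = g \<otimes> (y \<otimes> (inv x \<otimes> x))" using c xy by (simp add: m_assoc)
          ultimately show ?thesis using c by simp
        qed
        moreover have "y \<otimes> (g \<otimes> (x \<otimes> y)) = (g \<otimes> (x \<otimes> y)) \<otimes> y"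
        proof -
          have "y \<otimes> (g \<otimes> (x \<otimes> y)) = g \<otimes> (inv y \<otimes> x) \<otimes> y" using assoc_rewrite[OF 4(2) c(2,3), of "x \<otimes> y"] c by (simp add: m_assoc)
          then show ?thesis using iyx c by (simp add: m_assoc)
        qed
        ultimately show ?thesis using c gh(3,4) subgroup.m_closed[OF H gh(3,4)] by (intro exI[of _ "x \<otimes> y"]) simp
      qed
    qed
    then show ?thesis using main by blast
  qed
  show ?thesis
  proof (rule ccontr)
    assume no: "\<not> ?thesis"
    have "\<exists>h. good n h" for n
    proof (induction n)
      case 0 then show ?case by (rule base)
    next
      case (Suc n) then show ?case using step no by blast
    qed
    then obtain h where h: "good (card (carrier G)) h" by blast
    define N where "N = card (carrier G)"
    have "card (carrier (dicyclic 2 \<times>\<times> elementary N)) \<le> card (carrier G)"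
    proof (rule card_inj_on_le)
      show "inj_on h (carrier (dicyclic 2 \<times>\<times> elementary N))" using h by (simp add: good_def N_def)
      show "h ` carrier (dicyclic 2 \<times>\<times> elementary N) \<subseteq> carrier G" using hom_carrier[of h _ G] h unfolding good_def N_def by blast
    qed simp
    moreover have "2 ^ N \<le> card (carrier (dicyclic 2 \<times>\<times> elementary N))"
    proof -
      have "group (dicyclic 2)" "finite (carrier (dicyclic 2))" using balanced_dicyclic[of 2] by (simp_all add: balanced_def)
      then have "1 \<le> card (carrier (dicyclic 2))" using group.is_monoid monoid.carrier_not_empty by (metis One_nat_def Suc_leI card_gt_0_iff)
      moreover have "card (carrier (elementary N)) = 2 ^ N" by (simp add: card_PiE carrier_integer_mod_group)
      ultimately show ?thesis by (simp add: card_cartesian_product del: carrier_product_group)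
    qed
    ultimately have "2 ^ N \<le> N" by (simp add: N_def)
    then show False using less_exp[of N] by simp
  qed
qed

end

theorem theorem1p1:
  fixes G :: "('a, 'b) monoid_scheme"
  assumes "group G" and "finite (carrier G)"
  shows "balanced G \<longleftrightarrow>
      comm_group G
    \<or> (\<exists>n::nat. G \<cong> dicyclic 2 \<times>\<times> product_group {..<n} (\<lambda>_. integer_mod_group 2))
    \<or> G \<cong> dihedral 3
    \<or> G \<cong> dihedral 4
    \<or> G \<cong> dihedral 5
    \<or> G \<cong> dicyclic 3
    \<or> G \<cong> dicyclic 4
    \<or> G \<cong> C4_sdprod_C4
    \<or> G \<cong> dicyclic 5"
    (is "_ \<longleftrightarrow> ?list")
proof
  assume "?list"
  moreover have "balanced G" if "comm_group G" by (rule comm_group.balanced_if_finite[OF that assms(2)])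
  ultimately show "balanced G"
    using balanced_iso[OF assms(1) balanced_dicyclic_times_elementary(1) _ balanced_dicyclic_times_elementary(2)]
      balanced_iso[OF assms(1) balanced_dihedral(1) _ balanced_dihedral(2)]
      balanced_iso[OF assms(1) balanced_dicyclic(1) _ balanced_dicyclic(2)]
      balanced_iso[OF assms(1) balanced_C4_sdprod_C4(1) _ balanced_C4_sdprod_C4(2)] by auto
next
  assume bal: "balanced G"
  interpret balanced_group G
    by (intro balanced_group.intro balanced_group_axioms.intro assms(1) bal)
  show "?list"
  proof (cases "\<exists>a g. a \<in> carrier G \<and> a \<otimes>\<^bsub>G\<^esub> a = \<one>\<^bsub>G\<^esub> \<and> g \<in> carrier G \<and> a \<otimes>\<^bsub>G\<^esub> g \<noteq> g \<otimes>\<^bsub>G\<^esub> a")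
    case True
    then show ?thesis using noncentral_involution_iso by blast
  next
    case central: False
    then have c: "t \<otimes>\<^bsub>G\<^esub> g = g \<otimes>\<^bsub>G\<^esub> t" if "t \<in> carrier G" "t \<otimes>\<^bsub>G\<^esub> t = \<one>\<^bsub>G\<^esub>" "g \<in> carrier G" for t g
      using that by blast
    show ?thesis
    proof (cases "\<exists>x g. x \<in> carrier G \<and> x \<otimes>\<^bsub>G\<^esub> x \<noteq> \<one>\<^bsub>G\<^esub> \<and> (x \<otimes>\<^bsub>G\<^esub> x) \<otimes>\<^bsub>G\<^esub> (x \<otimes>\<^bsub>G\<^esub> x) = \<one>\<^bsub>G\<^esub> \<and> g \<in> carrier G \<and>
        x \<otimes>\<^bsub>G\<^esub> g \<noteq> g \<otimes>\<^bsub>G\<^esub> x \<and> x \<otimes>\<^bsub>G\<^esub> g \<noteq> g \<otimes>\<^bsub>G\<^esub> inv\<^bsub>G\<^esub> x")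
      case True
      then obtain x g where xg: "x \<in> carrier G" "x \<otimes>\<^bsub>G\<^esub> x \<noteq> \<one>\<^bsub>G\<^esub>" "(x \<otimes>\<^bsub>G\<^esub> x) \<otimes>\<^bsub>G\<^esub> (x \<otimes>\<^bsub>G\<^esub> x) = \<one>\<^bsub>G\<^esub>" "g \<in> carrier G"
        "x \<otimes>\<^bsub>G\<^esub> g \<noteq> g \<otimes>\<^bsub>G\<^esub> x" "x \<otimes>\<^bsub>G\<^esub> g \<noteq> g \<otimes>\<^bsub>G\<^esub> inv\<^bsub>G\<^esub> x" by blast
      then show ?thesis using nonnormal_order_four_iso[OF c xg] by blast
    next
      case False
      interpret central_involutions G
        by unfold_locales (use c False in blast)+
      show ?thesis
      proof (cases "\<exists>a b. a \<in> carrier G \<and> b \<in> carrier G \<and> a \<otimes>\<^bsub>G\<^esub> b \<noteq> b \<otimes>\<^bsub>G\<^esub> a")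
        case True
        then obtain x y where "quaternion_pair x y" using quaternion_pair_exists by blast
        then show ?thesis using quaternion_pair_iso by blast
      next
        case False
        then have "comm_group G" by (intro group_comm_groupI) blast
        then show ?thesis by blast
      qed
    qed
  qed
qed

end
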